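(* Let $\lambda>0$, $\tau>0$, $\sigma>0$, $\mu_0>0$, $b\in\{1,-1\}$; let $\rho\colon[-\tau,0]\to\mathbb{R}$ and $g\colon\mathbb{R}\to\mathbb{R}$ be continuous and let $f\colon\mathbb{R}\times\mathbb{R}\to\mathbb{R}$, $(t,\upsilon)\mapsto f(t,\upsilon)$, be continuously differentiable with $0\le\frac{\partial}{\partial\upsilon}f(t,\upsilon)\le\mu_0$ for all $t,\upsilon\in\mathbb{R}$. Suppose $g$ and $f$ are $\sigma$-periodic in $t$. Let $(\psi,\vartheta)$ be the $\sigma$-periodic cocycle in $\mathbb{H}=\mathbb{R}\times L_2([-\tau,0];\mathbb{R})$ generated by the delay equation $$\dot{x}(t)=-\lambda x(t)+b f\Bigl(t,\int_{-\tau}^{0}\rho(s)x(t+s)\,ds\Bigr)+g(t).$$ Put $$W(p):=-\frac{b}{\lambda+p}\int_{-\tau}^{0}\rho(s)e^{ps}\,ds,\qquad p\in\mathbb{C},\ p\ne-\lambda,$$ and suppose that for some $\nu>\lambda$ we have $$\operatorname{Re}W(i\omega-\nu)+\frac{1}{\mu_0}>0\quad\text{for all }\omega\in\mathbb{R}.$$ Then any trajectory $t\mapsto\psi^{t}(q,u_0)$, $t\ge0$, that is bounded in the future converges to a $\sigma$-periodic trajectory; that is, there is a $\sigma$-periodic trajectory $u^{*}$ at $q$ with $\psi^{t}(q,u_0)-u^{*}(t)\to0$ in $\mathbb{H}$ as $t\to+\infty$.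
   Context: The equation is posed in $\mathbb{H}=\mathbb{R}\times L_2([-\tau,0];\mathbb{R})$ as follows. Let $\mathcal{D}(A)=\{(x_0,\phi)\in\mathbb{H}:\phi\in W^{1,2}(-\tau,0;\mathbb{R}),\ \phi(0)=x_0\}$, $A(x,\phi)=(-\lambda x,\frac{\partial}{\partial s}\phi)$; let $B\colon\mathbb{R}\to\mathbb{H}$, $B\xi=(b\xi,0)$, and $C\colon\mathbb{H}\to\mathbb{R}$, $C(x,\phi)=\int_{-\tau}^{0}\rho(s)\phi(s)ds$. The operator $A$ generates a $C_0$-semigroup $S(t)$ in $\mathbb{H}$. For $q\in\mathbb{R}$ and $u_0\in\mathbb{H}$ let $u(t,q,u_0)$, $t\ge q$, be the (unique) generalized (mild) solution of $$\dot{u}=Au+Bf(t,Cu)+(g(t),0),\qquad u(q)=u_0,$$ i.e. the continuous solution of $u(t)=S(t-q)u_0+\int_q^t S(t-s)[Bf(s,Cu(s))+(g(s),0)]ds$. The cocycle $(\psi,\vartheta)$ generated by the equation is given by $\mathcal{Q}=\mathbb{R}/\sigma\mathbb{Z}$, $\vartheta^{t}(\theta)=\theta+t$ and $\psi^{t}(q,u_0):=u(t+q,q,u_0)$ for $t\ge0$ (well defined on $\mathcal{Q}$ by $\sigma$-periodicity). A $\sigma$-periodic trajectory at $q$ is a continuous map $u^{*}\colon\mathbb{R}\to\mathbb{H}$ with $u^{*}(t+s)=\psi^{t}(\vartheta^{s}(q),u^{*}(s))$ for all $t\ge0$, $s\in\mathbb{R}$, and $u^{*}(t+\sigma)=u^{*}(t)$.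 *)

theory Defs
  imports "HOL-Analysis.Analysis" "HOL-Library.Real_Mod"
begin

section \<open>The Hilbert space of square integrable real functions\<close>

definition square_integrable :: "(real \<Rightarrow> real) \<Rightarrow> bool" where
  "square_integrable f \<longleftrightarrow> f \<in> borel_measurable lborel \<and> integrable lborel (\<lambda>s. (f s)\<^sup>2)"

definition l2_rel :: "(real \<Rightarrow> real) \<Rightarrow> (real \<Rightarrow> real) \<Rightarrow> bool" where
  "l2_rel f g \<longleftrightarrow> square_integrable f \<and> square_integrable g \<and> (AE s in lborel. f s = g s)"

lemma square_integrable_zero: "square_integrable (\<lambda>_. 0)"
  by (simp add: square_integrable_def)

lemma square_integrable_mult:
  assumes "square_integrable f" "square_integrable g"
  shows "integrable lborel (\<lambda>s. f s * g s)"
proof (rule Bochner_Integration.integrable_bound)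
  show "integrable lborel (\<lambda>s. (f s)\<^sup>2 + (g s)\<^sup>2)"
    using assms by (simp add: square_integrable_def)
  show "(\<lambda>s. f s * g s) \<in> borel_measurable lborel"
    using assms by (auto simp: square_integrable_def)
  have "\<bar>f s * g s\<bar> \<le> (f s)\<^sup>2 + (g s)\<^sup>2" for s
  proof -
    have "0 \<le> (\<bar>f s\<bar> - \<bar>g s\<bar>)\<^sup>2" by simp
    then have "2 * \<bar>f s * g s\<bar> \<le> (f s)\<^sup>2 + (g s)\<^sup>2" by (simp add: power2_diff abs_mult)
    then show ?thesis by linarith
  qed
  then show "AE s in lborel. norm (f s * g s) \<le> norm ((f s)\<^sup>2 + (g s)\<^sup>2)"
    by simp
qed

lemma square_integrable_add:
  assumes "square_integrable f" "square_integrable g"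
  shows "square_integrable (\<lambda>s. f s + g s)"
  using assms square_integrable_mult [OF assms]
  by (auto simp: square_integrable_def power2_sum mult.assoc)

lemma square_integrable_scale:
  assumes "square_integrable f"
  shows "square_integrable (\<lambda>s. c * f s)"
  using assms by (auto simp: square_integrable_def power_mult_distrib)

quotient_type l2 = "real \<Rightarrow> real" / partial: l2_rel
proof (rule part_equivpI)
  show "\<exists>f. l2_rel f f"
    using square_integrable_zero by (auto simp: l2_rel_def)
  show "symp l2_rel"
    by (rule sympI) (auto simp: l2_rel_def)
  show "transp l2_rel"
    by (rule transpI) (auto simp: l2_rel_def elim: eventually_elim2)
qed

instantiation l2 :: real_inner
begin

lift_definition zero_l2 :: l2 is "\<lambda>_. 0"
  by (simp add: l2_rel_def square_integrable_zero)

lift_definition plus_l2 :: "l2 \<Rightarrow> l2 \<Rightarrow> l2" is "\<lambda>f g s. f s + g s"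
  by (auto simp: l2_rel_def square_integrable_add elim: eventually_elim2)

lift_definition scaleR_l2 :: "real \<Rightarrow> l2 \<Rightarrow> l2" is "\<lambda>c f s. c * f s"
  by (auto simp: l2_rel_def square_integrable_scale)

definition uminus_l2 :: "l2 \<Rightarrow> l2" where "uminus_l2 x = (-1) *\<^sub>R x"

definition minus_l2 :: "l2 \<Rightarrow> l2 \<Rightarrow> l2" where "minus_l2 x y = x + (-1) *\<^sub>R y"

lift_definition inner_l2 :: "l2 \<Rightarrow> l2 \<Rightarrow> real" is "\<lambda>f g. \<integral>s. f s * g s \<partial>lborel"
  unfolding l2_rel_def
  by (rule integral_cong_AE) (auto simp: square_integrable_def elim: eventually_elim2)

definition norm_l2 :: "l2 \<Rightarrow> real" where "norm_l2 x = sqrt (inner x x)"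

definition sgn_l2 :: "l2 \<Rightarrow> l2" where "sgn_l2 x = inverse (norm x) *\<^sub>R x"

definition dist_l2 :: "l2 \<Rightarrow> l2 \<Rightarrow> real" where "dist_l2 x y = norm (x - y)"

definition uniformity_l2 :: "(l2 \<times> l2) filter" where
  "uniformity_l2 = (INF e\<in>{0<..}. principal {(x, y). dist x y < e})"

definition open_l2 :: "l2 set \<Rightarrow> bool" where
  "open_l2 U \<longleftrightarrow> (\<forall>x\<in>U. eventually (\<lambda>(x', y). x' = x \<longrightarrow> y \<in> U) uniformity)"

instance
proof
  fix x y z :: l2 and a c :: real
  show "x + y + z = x + (y + z)"
    by transfer (auto simp: l2_rel_def add.assoc intro!: square_integrable_add)
  show "x + y = y + x"
    by transfer (auto simp: l2_rel_def add.commute intro!: square_integrable_add)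
  show "0 + x = x"
    by transfer (auto simp: l2_rel_def)
  show "- x + x = 0"
    unfolding uminus_l2_def
    by transfer (auto simp: l2_rel_def square_integrable_zero)
  show "x - y = x + - y"
    by (simp add: minus_l2_def uminus_l2_def)
  show "a *\<^sub>R (x + y) = a *\<^sub>R x + a *\<^sub>R y"
    by transfer (auto simp: l2_rel_def distrib_left
        intro!: square_integrable_add square_integrable_scale)
  show "(a + c) *\<^sub>R x = a *\<^sub>R x + c *\<^sub>R x"
    by transfer (auto simp: l2_rel_def distrib_right
        intro!: square_integrable_add square_integrable_scale)
  show "a *\<^sub>R c *\<^sub>R x = (a * c) *\<^sub>R x"
    by transfer (auto simp: l2_rel_def mult.assoc intro!: square_integrable_scale)
  show "1 *\<^sub>R x = x"
    by transfer (auto simp: l2_rel_def)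
  show "dist x y = norm (x - y)" by (rule dist_l2_def)
  show "sgn x = inverse (norm x) *\<^sub>R x" by (rule sgn_l2_def)
  show "uniformity = (INF e\<in>{0<..}. principal {(x :: l2, y). dist x y < e})"
    by (rule uniformity_l2_def)
  show "open U \<longleftrightarrow> (\<forall>x\<in>U. eventually (\<lambda>(x', y). x' = x \<longrightarrow> y \<in> U) uniformity)"
    for U :: "l2 set" by (rule open_l2_def)
  show "norm x = sqrt (inner x x)" by (rule norm_l2_def)
  show "inner x y = inner y x"
    by transfer (simp add: mult.commute)
  show "inner (x + y) z = inner x z + inner y z"
    by transfer (simp add: l2_rel_def distrib_right square_integrable_mult)
  show "inner (a *\<^sub>R x) y = a * inner x y"
    by transfer (simp add: mult.assoc)
  show "0 \<le> inner x x"
    by transfer (simp add: integral_nonneg_AE)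
  show "inner x x = 0 \<longleftrightarrow> x = 0"
  proof (transfer, goal_cases)
    case (1 f)
    then have f: "square_integrable f" by (simp add: l2_rel_def)
    have "(\<integral>s. f s * f s \<partial>lborel) = 0 \<longleftrightarrow> (AE s in lborel. f s * f s = 0)"
      by (rule integral_nonneg_eq_0_iff_AE) (auto intro: square_integrable_mult f)
    then show ?case
      using f by (simp add: l2_rel_def square_integrable_zero)
  qed
qed

end


section \<open>$C_0$-semigroups and their generators\<close>

text \<open>Operators on a linear subspace \<open>X\<close> are total functions of which only the restriction to
  \<open>X\<close> matters.\<close>

definition C0_semigroup_on :: "'a::real_normed_vector set \<Rightarrow> (real \<Rightarrow> 'a \<Rightarrow> 'a) \<Rightarrow> bool" where
  "C0_semigroup_on X S \<longleftrightarrow>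
     (\<forall>t\<ge>0. (\<forall>x\<in>X. S t x \<in> X)
        \<and> (\<forall>x\<in>X. \<forall>y\<in>X. \<forall>a c. S t (a *\<^sub>R x + c *\<^sub>R y) = a *\<^sub>R S t x + c *\<^sub>R S t y)
        \<and> (\<exists>K. \<forall>x\<in>X. norm (S t x) \<le> K * norm x))
   \<and> (\<forall>x\<in>X. S 0 x = x)
   \<and> (\<forall>t\<ge>0. \<forall>s\<ge>0. \<forall>x\<in>X. S (t + s) x = S t (S s x))
   \<and> (\<forall>x\<in>X. ((\<lambda>t. S t x) \<longlongrightarrow> x) (at_right 0))"

definition generates :: "'a::real_normed_vector set \<Rightarrow> 'a set \<Rightarrow> ('a \<Rightarrow> 'a) \<Rightarrow> (real \<Rightarrow> 'a \<Rightarrow> 'a) \<Rightarrow> bool"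
  where "generates X D A S \<longleftrightarrow> C0_semigroup_on X S
   \<and> D = {x \<in> X. \<exists>y\<in>X. ((\<lambda>h. (S h x - x) /\<^sub>R h) \<longlongrightarrow> y) (at_right 0)}
   \<and> (\<forall>x\<in>D. ((\<lambda>h. (S h x - x) /\<^sub>R h) \<longlongrightarrow> A x) (at_right 0))"

text \<open>A generator determines \<open>S t x\<close> for \<open>t \<ge> 0\<close> and \<open>x \<in> X\<close>, so the choice below is immaterial
  there.\<close>

definition semigroup_generated_by ::
    "'a::real_normed_vector set \<Rightarrow> 'a set \<Rightarrow> ('a \<Rightarrow> 'a) \<Rightarrow> real \<Rightarrow> 'a \<Rightarrow> 'a" where
  "semigroup_generated_by X D A = (SOME S. generates X D A S)"


section \<open>The phase space and the operators of the delay equation\<close>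

text \<open>$L_2([-\tau,0])$ is identified isometrically with the closed subspace of those elements of
  \<open>l2\<close> that vanish almost everywhere outside of $[-\tau,0]$. The norm of the product type
  \<open>real \<times> l2\<close> is the Hilbert space norm of the direct sum.\<close>

definition L2_on :: "real set \<Rightarrow> l2 set" where
  "L2_on I = {\<phi>. AE s in lborel. s \<notin> I \<longrightarrow> rep_l2 \<phi> s = 0}"

definition H :: "real \<Rightarrow> (real \<times> l2) set" where
  "H \<tau> = UNIV \<times> L2_on {-\<tau>..0}"

text \<open>Weak derivatives on $(-\tau,0)$, tested against compactly supported $C^1$ functions.\<close>

definition test_function :: "real \<Rightarrow> (real \<Rightarrow> real) \<Rightarrow> (real \<Rightarrow> real) \<Rightarrow> bool" where
  "test_function \<tau> \<eta> \<eta>' \<longleftrightarrow>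
     (\<forall>s. (\<eta> has_real_derivative \<eta>' s) (at s)) \<and> continuous_on UNIV \<eta>'
   \<and> (\<exists>K. compact K \<and> K \<subseteq> {-\<tau><..<0} \<and> (\<forall>s. s \<notin> K \<longrightarrow> \<eta> s = 0))"

definition has_weak_derivative :: "real \<Rightarrow> l2 \<Rightarrow> l2 \<Rightarrow> bool" where
  "has_weak_derivative \<tau> \<phi> \<phi>' \<longleftrightarrow>
     (\<forall>\<eta> \<eta>'. test_function \<tau> \<eta> \<eta>' \<longrightarrow>
        (LINT s:{-\<tau>..0}|lborel. rep_l2 \<phi> s * \<eta>' s)
          = - (LINT s:{-\<tau>..0}|lborel. rep_l2 \<phi>' s * \<eta> s))"

definition W12 :: "real \<Rightarrow> l2 set" where
  "W12 \<tau> = {\<phi> \<in> L2_on {-\<tau>..0}. \<exists>\<phi>'\<in>L2_on {-\<tau>..0}. has_weak_derivative \<tau> \<phi> \<phi>'}"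

definition weak_derivative :: "real \<Rightarrow> l2 \<Rightarrow> l2" where
  "weak_derivative \<tau> \<phi> = (THE \<phi>'. \<phi>' \<in> L2_on {-\<tau>..0} \<and> has_weak_derivative \<tau> \<phi> \<phi>')"

text \<open>\<open>\<phi>(0) = x\<close>, read off from the continuous representative of \<open>\<phi>\<close>.\<close>

definition has_value_at_0 :: "real \<Rightarrow> l2 \<Rightarrow> real \<Rightarrow> bool" where
  "has_value_at_0 \<tau> \<phi> x \<longleftrightarrow>
     (\<exists>c. continuous_on {-\<tau>..0} c \<and> (AE s in lborel. s \<in> {-\<tau>..0} \<longrightarrow> rep_l2 \<phi> s = c s) \<and> c 0 = x)"

definition dom_A :: "real \<Rightarrow> (real \<times> l2) set" where
  "dom_A \<tau> = {(x, \<phi>) \<in> H \<tau>. \<phi> \<in> W12 \<tau> \<and> has_value_at_0 \<tau> \<phi> x}"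

definition op_A :: "real \<Rightarrow> real \<Rightarrow> real \<times> l2 \<Rightarrow> real \<times> l2" where
  "op_A lam \<tau> = (\<lambda>(x, \<phi>). (- lam * x, weak_derivative \<tau> \<phi>))"

definition op_B :: "real \<Rightarrow> real \<Rightarrow> real \<times> l2" where
  "op_B b \<xi> = (b * \<xi>, 0)"

definition op_C :: "real \<Rightarrow> (real \<Rightarrow> real) \<Rightarrow> real \<times> l2 \<Rightarrow> real" where
  "op_C \<tau> \<rho> = (\<lambda>(x, \<phi>). LINT s:{-\<tau>..0}|lborel. \<rho> s * rep_l2 \<phi> s)"

definition delay_semigroup :: "real \<Rightarrow> real \<Rightarrow> real \<Rightarrow> real \<times> l2 \<Rightarrow> real \<times> l2" where
  "delay_semigroup lam \<tau> = semigroup_generated_by (H \<tau>) (dom_A \<tau>) (op_A lam \<tau>)"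


section \<open>Mild solutions and the cocycle\<close>

text \<open>The coefficients are passed in the order $\lambda, \tau, b, \rho, f, g$. Only the values of
  \<open>u\<close> on $[q,\infty)$ matter.\<close>

definition mild_solution ::
    "real \<Rightarrow> real \<Rightarrow> real \<Rightarrow> (real \<Rightarrow> real) \<Rightarrow> (real \<Rightarrow> real \<Rightarrow> real) \<Rightarrow> (real \<Rightarrow> real)
      \<Rightarrow> real \<Rightarrow> real \<times> l2 \<Rightarrow> (real \<Rightarrow> real \<times> l2) \<Rightarrow> bool" where
  "mild_solution lam \<tau> b \<rho> f g q u0 u \<longleftrightarrow>
     continuous_on {q..} u \<and> (\<forall>t\<ge>q. u t \<in> H \<tau>)
   \<and> (\<forall>t\<ge>q. ((\<lambda>s. delay_semigroup lam \<tau> (t - s) (op_B b (f s (op_C \<tau> \<rho> (u s))) + (g s, 0)))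
        has_integral (u t - delay_semigroup lam \<tau> (t - q) u0)) {q..t})"

text \<open>The base $\mathbb{R}/\sigma\mathbb{Z}$, with points as congruence classes of reals, and its
  shift flow.\<close>

definition base :: "real \<Rightarrow> real set set" where
  "base \<sigma> = UNIV // {(x, y). [x = y] (rmod \<sigma>)}"

definition shift :: "real \<Rightarrow> real set \<Rightarrow> real set" where
  "shift t \<theta> = (\<lambda>p. p + t) ` \<theta>"

text \<open>The description below is proper because mild solutions are unique and, for $\sigma$-periodic
  coefficients, $u(t+p,p,u_0)$ does not depend on the representative \<open>p\<close> of \<open>\<theta>\<close>.\<close>

definition cocycle ::
    "real \<Rightarrow> real \<Rightarrow> real \<Rightarrow> (real \<Rightarrow> real) \<Rightarrow> (real \<Rightarrow> real \<Rightarrow> real) \<Rightarrow> (real \<Rightarrow> real)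
      \<Rightarrow> real \<Rightarrow> real set \<Rightarrow> real \<times> l2 \<Rightarrow> real \<times> l2" where
  "cocycle lam \<tau> b \<rho> f g t \<theta> u0 =
     (THE w. \<exists>p\<in>\<theta>. \<exists>u. mild_solution lam \<tau> b \<rho> f g p u0 u \<and> w = u (t + p))"

text \<open>\<open>\<psi>\<close> is a cocycle over \<open>shift\<close> in the phase space \<open>X\<close>.\<close>

definition periodic_trajectory ::
    "'a::topological_space set \<Rightarrow> (real \<Rightarrow> real set \<Rightarrow> 'a \<Rightarrow> 'a) \<Rightarrow> real \<Rightarrow> real set
      \<Rightarrow> (real \<Rightarrow> 'a) \<Rightarrow> bool" where
  "periodic_trajectory X \<psi> \<sigma> \<theta> v \<longleftrightarrow>
     continuous_on UNIV v \<and> (\<forall>s. v s \<in> X)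
   \<and> (\<forall>t\<ge>0. \<forall>s. v (t + s) = \<psi> t (shift s \<theta>) (v s))
   \<and> (\<forall>t. v (t + \<sigma>) = v t)"


section \<open>Hypotheses on the coefficients\<close>

definition continuously_differentiable ::
    "('a::real_normed_vector \<Rightarrow> 'b::real_normed_vector) \<Rightarrow> bool" where
  "continuously_differentiable F \<longleftrightarrow>
     (\<exists>F' :: 'a \<Rightarrow> 'a \<Rightarrow>\<^sub>L 'b.
        (\<forall>z. (F has_derivative blinfun_apply (F' z)) (at z)) \<and> continuous_on UNIV F')"

definition transfer_W :: "real \<Rightarrow> real \<Rightarrow> real \<Rightarrow> (real \<Rightarrow> real) \<Rightarrow> complex \<Rightarrow> complex" where
  "transfer_W lam \<tau> b \<rho> p =
     - (of_real b / (of_real lam + p))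
       * (LINT s:{-\<tau>..0}|lborel. of_real (\<rho> s) * exp (p * of_real s))"

end

theory Submission
  imports Defs "HOL-Probability.Characteristic_Functions"
begin

text \<open>The operator \<open>A\<close> generates the semigroup that translates the history of \<open>x' = -lam x\<close>, so that mild
solutions are the solutions \<open>x\<close> of the scalar delay equation together with their history segments.
For a bounded solution \<open>x\<close> the difference \<open>z(t) = x(t + \<sigma>) - x(t)\<close> satisfies \<open>z' = -lam z + b \<xi>\<close>, where
\<open>\<xi> (Cz - \<xi>/\<mu>0) \<ge> 0\<close>. If \<open>z\<close> has arbitrarily large zeros, truncate \<open>z\<close> to the interval between two of
them: by Parseval's identity with the weight \<open>exp (\<nu> t)\<close>, the frequency condition bounds the
integral of \<open>exp (2 \<nu> t) \<xi>(t)\<^sup>2\<close>, and since \<open>\<nu> > lam\<close> this makes \<open>z\<close> decay like \<open>exp (- lam t)\<close>.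
Otherwise \<open>z\<close> is eventually of constant sign. In both cases \<open>x(t + n \<sigma>)\<close> converges for every \<open>t\<close>, in
the second one by monotonicity, and the limit is the periodic solution.\<close>

section \<open>Square integrable functions\<close>

text \<open>The line Re p = -\<open>\<nu>\<close> lies to the left of the pole -\<open>lam\<close>
  of \<open>W\<close>. With the weight exp(\<open>\<nu>\<close> t) the free mode
  exp(-\<open>lam\<close> t) grows, and the frequency inequality sees only pairs of input and output
  that vanish at both ends. Truncating \<open>z\<close> at a time \<open>T\<close> leaves the
  boundary term exp(\<open>\<nu>\<close> T) z(T), a single scalar obstruction that disappears
  exactly at the zeros of \<open>z\<close>. This is why the argument splits according to the zeros
  of \<open>z\<close>, and why the remaining case has a sign to work with.

  The transfer function from \<open>\<xi>\<close> to the delayed term is -\<open>W\<close>. So the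
  weighted integral of \<open>\<xi>\<close> (\<open>\<xi>\<close>/\<open>\<mu>0\<close> - Cz) is an
  integral of (Re \<open>W\<close> + 1/\<open>\<mu>0\<close>) against the squared modulus of the
  transform of \<open>\<xi>\<close>, hence nonnegative with a margin \<open>\<delta>\<close>,
  whereas the sector condition makes the integrand nonpositive at each time. Only the history before
  the first zero escapes the sector condition, and it bounds everything else.

  The semigroup in the definition of a mild solution is an arbitrary choice among those with the
  given generator. Before any equation can be used, the generator of the translations has to be
  computed, domain included, and shown to determine its semigroup.\<close>

lemma l2_rel_refl [simp]: "l2_rel f f \<longleftrightarrow> square_integrable f"
  by (simp add: l2_rel_def)

lemma square_integrable_rep [simp]: "square_integrable (rep_l2 \<phi>)"
  using Quotient3_rep_reflp[OF Quotient3_l2, of \<phi>] by simp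

lemma abs_rep_l2 [simp]: "abs_l2 (rep_l2 \<phi>) = \<phi>"
  by (rule Quotient3_abs_rep[OF Quotient3_l2])

lemma rep_abs_l2: "square_integrable f \<Longrightarrow> AE s in lborel. rep_l2 (abs_l2 f) s = f s"
  using rep_abs_rsp_left[OF Quotient3_l2, of f f] by (simp add: l2_rel_def)

lemma abs_l2_eqI:
  assumes "square_integrable f" "square_integrable g" "AE s in lborel. f s = g s"
  shows "abs_l2 f = abs_l2 g"
  using assms by (intro Quotient3_rel_abs[OF Quotient3_l2]) (simp add: l2_rel_def)

lemma l2_eqI: "AE s in lborel. rep_l2 \<phi> s = rep_l2 \<psi> s \<Longrightarrow> \<phi> = \<psi>"
  using abs_l2_eqI[of "rep_l2 \<phi>" "rep_l2 \<psi>"] by simp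

lemma abs_l2_add: "square_integrable f \<Longrightarrow> square_integrable g \<Longrightarrow> abs_l2 f + abs_l2 g = abs_l2 (\<lambda>s. f s + g s)"
  by (rule plus_l2.abs_eq) simp_all

lemma abs_l2_scaleR: "square_integrable f \<Longrightarrow> c *\<^sub>R abs_l2 f = abs_l2 (\<lambda>s. c * f s)"
  by (rule scaleR_l2.abs_eq) simp_all

lemma square_integrable_diff:
  "square_integrable f \<Longrightarrow> square_integrable g \<Longrightarrow> square_integrable (\<lambda>s. f s - g s)"
  using square_integrable_add[of f "\<lambda>s. (-1) * g s"] square_integrable_scale[of g "-1"] by simp

lemma abs_l2_diff:
  assumes "square_integrable f" "square_integrable g"
  shows "abs_l2 f - abs_l2 g = abs_l2 (\<lambda>s. f s - g s)"
proof -
  have "abs_l2 f - abs_l2 g = abs_l2 f + (-1) *\<^sub>R abs_l2 g" by (rule minus_l2_def)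
  also have "\<dots> = abs_l2 f + abs_l2 (\<lambda>s. (-1) * g s)" by (subst abs_l2_scaleR[OF assms(2)]) (rule refl)
  also have "\<dots> = abs_l2 (\<lambda>s. f s - g s)"
    using abs_l2_add[OF assms(1) square_integrable_scale[OF assms(2), of "-1"]] by simp
  finally show ?thesis .
qed

lemma abs_l2_0: "abs_l2 (\<lambda>s. 0) = 0"
  by (simp add: zero_l2.abs_eq)

lemma inner_abs_l2:
  "square_integrable f \<Longrightarrow> square_integrable g \<Longrightarrow> inner (abs_l2 f) (abs_l2 g) = (\<integral>s. f s * g s \<partial>lborel)"
  by (rule inner_l2.abs_eq) simp_all

lemma norm_abs_l2_sq: "square_integrable f \<Longrightarrow> (norm (abs_l2 f))\<^sup>2 = (\<integral>s. (f s)\<^sup>2 \<partial>lborel)"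
  unfolding power2_norm_eq_inner by (simp add: inner_abs_l2 power2_eq_square)

lemma norm_l2_sq: "(norm \<phi>)\<^sup>2 = (\<integral>s. (rep_l2 \<phi> s)\<^sup>2 \<partial>lborel)"
  using norm_abs_l2_sq[of "rep_l2 \<phi>"] by simp

lemma square_integrable_measurable: "square_integrable f \<Longrightarrow> f \<in> borel_measurable borel"
  by (simp add: square_integrable_def)

lemma rep_l2_measurable [measurable]: "rep_l2 \<phi> \<in> borel_measurable borel"
  using square_integrable_measurable square_integrable_rep by blast

lemma square_integrable_bound:
  assumes "square_integrable g" "f \<in> borel_measurable borel" "AE s in lborel. \<bar>f s\<bar> \<le> \<bar>g s\<bar>"
  shows "square_integrable f"
  unfolding square_integrable_def
proof
  show "f \<in> borel_measurable lborel" using assms(2) by simp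
  show "integrable lborel (\<lambda>s. (f s)\<^sup>2)"
  proof (rule Bochner_Integration.integrable_bound)
    show "integrable lborel (\<lambda>s. (g s)\<^sup>2)" using assms(1) by (simp add: square_integrable_def)
    show "(\<lambda>s. (f s)\<^sup>2) \<in> borel_measurable lborel" using assms(2) by simp
    show "AE s in lborel. norm ((f s)\<^sup>2) \<le> norm ((g s)\<^sup>2)"
      using assms(3) by eventually_elim (simp add: abs_le_square_iff)
  qed
qed

lemma square_integrable_indicator_Icc: "square_integrable (\<lambda>s. c * indicator {a..b::real} s)"
proof -
  have "(\<lambda>s. (c * indicator {a..b} s)\<^sup>2) = (\<lambda>s. c\<^sup>2 * indicator {a..b::real} s)"
    by (auto simp: fun_eq_iff indicator_def)
  then show ?thesis
    unfolding square_integrable_def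
    by (auto intro!: integrable_real_indicator simp: emeasure_lborel_Icc_eq)
qed

lemma square_integrable_bounded_support:
  assumes "f \<in> borel_measurable borel" "\<And>s. \<bar>f s\<bar> \<le> c" "\<And>s. s \<notin> {a..b} \<Longrightarrow> f s = 0"
  shows "square_integrable f"
proof (rule square_integrable_bound[OF square_integrable_indicator_Icc assms(1), of c a b])
  have "\<bar>f s\<bar> \<le> \<bar>c * indicator {a..b} s\<bar>" for s
    using assms(2)[of s] assms(3)[of s] by (cases "s \<in> {a..b}") auto
  then show "AE s in lborel. \<bar>f s\<bar> \<le> \<bar>c * indicator {a..b} s\<bar>" by simp
qed

section \<open>Translation and continuous approximation in L2\<close>

lemma AE_translate:
  fixes P :: "real \<Rightarrow> bool"
  assumes "AE s in lborel. P s"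
  shows "AE s in lborel. P (t + s)"
proof -
  obtain N where N: "N \<in> null_sets lborel" "{s. \<not> P s} \<subseteq> N"
    using assms by (auto simp: eventually_ae_filter)
  have [measurable]: "N \<in> sets borel" using N(1) by (simp add: null_sets_def)
  have "AE s in lborel. s \<notin> N" by (rule AE_not_in[OF N(1)])
  then have "AE s in lborel. t + 1 * s \<notin> N"
    by (intro AE_borel_affine) auto
  then show ?thesis by (rule eventually_mono) (use N(2) in auto)
qed

lemma square_integrable_translate:
  assumes "square_integrable f"
  shows "square_integrable (\<lambda>s. f (t + s))"
  using assms lborel_integrable_real_affine[of "\<lambda>s. (f s)\<^sup>2" 1 t]
  by (auto simp: square_integrable_def)

lemma integral_translate: "(\<integral>s. f (t + s) \<partial>lborel) = (\<integral>s. f s \<partial>lborel)" for f :: "real \<Rightarrow> 'a::{banach, second_countable_topology}"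
  using lborel_integral_real_affine[of 1 f t] by simp

lemma l2_tendsto_0I:
  assumes sq: "\<And>k. square_integrable (f k)" and g: "square_integrable g"
    and bd: "\<And>k. AE s in lborel. \<bar>f k s\<bar> \<le> \<bar>g s\<bar>"
    and lim: "AE s in lborel. (\<lambda>k. f k s) \<longlonglongrightarrow> 0"
  shows "(\<lambda>k. abs_l2 (f k)) \<longlonglongrightarrow> 0"
proof -
  have [measurable]: "f k \<in> borel_measurable borel" for k
    using sq square_integrable_measurable by blast
  have [measurable]: "g \<in> borel_measurable borel" using g square_integrable_measurable by blast
  have "(\<lambda>k. \<integral>s. (f k s)\<^sup>2 \<partial>lborel) \<longlonglongrightarrow> (\<integral>s. 0 \<partial>(lborel::real measure))"
  proof (rule integral_dominated_convergence[where w="\<lambda>s. (g s)\<^sup>2"])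
    show "integrable lborel (\<lambda>s. (g s)\<^sup>2)" using g by (simp add: square_integrable_def)
    show "AE s in lborel. (\<lambda>k. (f k s)\<^sup>2) \<longlonglongrightarrow> 0"
      using lim by eventually_elim (auto intro!: tendsto_eq_intros)
    show "AE s in lborel. norm ((f k s)\<^sup>2) \<le> (g s)\<^sup>2" for k
      using bd[of k] by eventually_elim (simp add: abs_le_square_iff)
  qed auto
  then have "(\<lambda>k. (norm (abs_l2 (f k)))\<^sup>2) \<longlonglongrightarrow> 0" by (simp add: norm_abs_l2_sq sq)
  then have "(\<lambda>k. sqrt ((norm (abs_l2 (f k)))\<^sup>2)) \<longlonglongrightarrow> sqrt 0" by (rule tendsto_real_sqrt)
  then show ?thesis by (simp add: tendsto_norm_zero_iff)
qed

text \<open>A measurable function is an almost everywhere limit of continuous functions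
  \<open>g k\<close>. Clipping their values to [-n, n] and multiplying by a cut-off does not disturb
  the limit and provides a common majorant, so dominated convergence turns the pointwise limit into
  one in L2.\<close>

lemma bounded_approx:
  assumes [measurable]: "F \<in> borel_measurable borel"
    and bd: "\<And>s. \<bar>F s\<bar> \<le> n" and supp: "\<And>s. \<bar>s\<bar> > n \<Longrightarrow> F s = 0" and e: "e > 0"
  shows "\<exists>h M. continuous_on UNIV h \<and> (\<forall>s. \<bar>h s\<bar> \<le> M) \<and> (\<forall>s. \<bar>s\<bar> > M \<longrightarrow> h s = (0::real))
    \<and> norm (abs_l2 F - abs_l2 h) < e"
proof -
  have n0: "n \<ge> 0" using bd[of 0] by linarith
  have "F \<in> borel_measurable lebesgue" by (simp add: measurable_completion)
  then have "F measurable_on UNIV" by (rule lebesgue_measurable_imp_measurable_on_real)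
      (auto simp: )
  then obtain N g where N: "negligible N" and g: "\<And>k. continuous_on UNIV (g k)"
    and lim: "\<And>x. x \<notin> N \<Longrightarrow> (\<lambda>k. g k x) \<longlonglongrightarrow> F x"
    unfolding measurable_on_def by (auto simp: )
  \<comment> \<open>A trapezoid: 1 on [-n, n], where \<open>F\<close> may be nonzero, and 0 outside
    of [-(n+1), n+1].\<close>
  define c where "c s = max 0 (min 1 (n + 1 - \<bar>s\<bar>))" for s :: real
  define h where "h k s = c s * max (-n) (min n (g k s))" for k s
  have hc: "continuous_on UNIV (h k)" for k
    unfolding h_def c_def using g[of k] by (intro continuous_intros)
  have c01: "0 \<le> c s" "c s \<le> 1" for s by (auto simp: c_def)
  have hb: "\<bar>h k s\<bar> \<le> n" for k s
  proof -
    have "\<bar>max (-n) (min n (g k s))\<bar> \<le> n" using n0 by auto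
    then have "\<bar>c s\<bar> * \<bar>max (-n) (min n (g k s))\<bar> \<le> 1 * n"
      using c01[of s] n0 by (intro mult_mono) auto
    then show ?thesis by (simp add: h_def abs_mult)
  qed
  have hs: "\<bar>s\<bar> > n + 1 \<Longrightarrow> h k s = 0" for k s by (auto simp: h_def c_def)
  have sh: "square_integrable (h k)" for k
  proof (rule square_integrable_bounded_support[where c=n and a="-(n+1)" and b="n+1"])
    show "h k \<in> borel_measurable borel" by (rule borel_measurable_continuous_onI[OF hc])
  qed (use hb hs in auto)
  have sF: "square_integrable F"
    by (rule square_integrable_bounded_support[where c=n and a="-n" and b="n"]) (use bd supp in auto)
  have "AE x in lebesgue. x \<notin> N"
    using N by (intro AE_not_in) (simp add: negligible_iff_null_sets)
  then have NA: "AE x in lborel. x \<notin> N" by (simp add: AE_completion_iff)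
  have "(\<lambda>k. abs_l2 (\<lambda>s. F s - h k s)) \<longlonglongrightarrow> 0"
  proof (rule l2_tendsto_0I[OF _ square_integrable_indicator_Icc[of "2*n" "-(n+1)" "n+1"]])
    show "square_integrable (\<lambda>s. F s - h k s)" for k by (rule square_integrable_diff[OF sF sh])
    have "\<bar>F s - h k s\<bar> \<le> \<bar>2 * n * indicator {- (n + 1)..n + 1} s\<bar>" for k s
      using bd[of s] hb[of k s] supp[of s] hs[of s k] n0 by (cases "\<bar>s\<bar> > n + 1") (auto simp: indicator_def)
    then show "AE s in lborel. \<bar>F s - h k s\<bar> \<le> \<bar>2 * n * indicator {- (n + 1)..n + 1} s\<bar>" for k by simp
    show "AE s in lborel. (\<lambda>k. F s - h k s) \<longlonglongrightarrow> 0"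
      using NA
    proof eventually_elim
      case (elim s)
      have "(\<lambda>k. F s - h k s) \<longlonglongrightarrow> F s - c s * max (-n) (min n (F s))"
        unfolding h_def by (intro tendsto_intros lim elim)
      moreover have "c s * max (-n) (min n (F s)) = F s"
        using bd[of s] supp[of s] by (cases "\<bar>s\<bar> > n") (auto simp: c_def)
      ultimately show ?case by simp
    qed
  qed
  then have "(\<lambda>k. abs_l2 F - abs_l2 (h k)) \<longlonglongrightarrow> 0" by (simp add: abs_l2_diff sF sh)
  then obtain k where "norm (abs_l2 F - abs_l2 (h k)) < e"
    using e by (auto simp: LIMSEQ_iff dest!: spec[of _ e])
  then show ?thesis using hc hb hs n0
    by (intro exI[of _ "h k"] exI[of _ "n+1"]) (auto intro: order_trans[OF hb])
qed

text \<open>Truncating a representative both in its argument and in its values reduces this to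
  \<open>bounded_approx\<close>; the truncations converge by dominated convergence with majorant
  twice the function.\<close>

lemma continuous_dense_l2:
  assumes e: "e > 0"
  shows "\<exists>h M. continuous_on UNIV h \<and> (\<forall>s. \<bar>h s\<bar> \<le> M) \<and> (\<forall>s. \<bar>s\<bar> > M \<longrightarrow> h s = (0::real))
    \<and> norm (\<phi> - abs_l2 h) < e"
proof -
  define E where "E = rep_l2 \<phi>"
  have [measurable]: "E \<in> borel_measurable borel" by (simp add: E_def)
  define F where "F k s = indicator {-real k..real k} s * max (-real k) (min (real k) (E s))" for k s
  have [measurable]: "F k \<in> borel_measurable borel" for k unfolding F_def by measurable
  have Fb: "\<bar>F k s\<bar> \<le> real k" "\<bar>F k s\<bar> \<le> \<bar>E s\<bar>" for k s by (auto simp: F_def indicator_def)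
  have sE: "square_integrable E" by (simp add: E_def)
  have sF: "square_integrable (F k)" for k
    by (rule square_integrable_bound[OF sE]) (use Fb in auto)
  have "(\<lambda>k. abs_l2 (\<lambda>s. E s - F k s)) \<longlonglongrightarrow> 0"
  proof (rule l2_tendsto_0I[OF _ square_integrable_scale[OF sE, of 2]])
    show "square_integrable (\<lambda>s. E s - F k s)" for k by (rule square_integrable_diff[OF sE sF])
    show "AE s in lborel. \<bar>E s - F k s\<bar> \<le> \<bar>2 * E s\<bar>" for k
    proof (rule AE_I2)
      fix s show "\<bar>E s - F k s\<bar> \<le> \<bar>2 * E s\<bar>" using Fb(2)[of k s] by linarith
    qed
    show "AE s in lborel. (\<lambda>k. E s - F k s) \<longlonglongrightarrow> 0"
    proof (rule AE_I2)
      fix s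
      obtain K :: nat where K: "max \<bar>s\<bar> \<bar>E s\<bar> \<le> real K" using real_arch_simple by blast
      have "\<forall>\<^sub>F k in sequentially. E s - F k s = 0"
        using eventually_ge_at_top[of K]
      proof eventually_elim
        case (elim k)
        then have "real K \<le> real k" by simp
        then show ?case using K by (auto simp: F_def indicator_def)
      qed
      then show "(\<lambda>k. E s - F k s) \<longlonglongrightarrow> 0" by (rule tendsto_eventually)
    qed
  qed
  then have "(\<lambda>k. abs_l2 E - abs_l2 (F k)) \<longlonglongrightarrow> 0" by (simp add: abs_l2_diff sE sF)
  then obtain k where k: "norm (\<phi> - abs_l2 (F k)) < e/2"
    using e by (auto simp: LIMSEQ_iff E_def dest!: spec[of _ "e/2"])
  have FS: "F k s = 0" if "\<bar>s\<bar> > real k" for s using that by (auto simp: F_def indicator_def)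
  have e2: "e/2 > 0" using e by simp
  obtain h M where h: "continuous_on UNIV h" "\<forall>s. \<bar>h s\<bar> \<le> M" "\<forall>s. \<bar>s\<bar> > M \<longrightarrow> h s = (0::real)"
     "norm (abs_l2 (F k) - abs_l2 h) < e/2"
    using bounded_approx[OF \<open>F k \<in> borel_measurable borel\<close> Fb(1) FS e2] by blast
  have "norm (\<phi> - abs_l2 h) \<le> norm (\<phi> - abs_l2 (F k)) + norm (abs_l2 (F k) - abs_l2 h)"
    using norm_triangle_ineq[of "\<phi> - abs_l2 (F k)" "abs_l2 (F k) - abs_l2 h"] by simp
  then have "norm (\<phi> - abs_l2 h) < e" using k h(4) by simp
  then show ?thesis using h by blast
qed

text \<open>The limit is taken along sequences so that dominated convergence applies. A convergent
  sequence of shifts is bounded by some \<open>B\<close>, so all translates are supported in one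
  interval.\<close>

lemma translate_tendsto_continuous:
  assumes h: "continuous_on UNIV h" "\<And>s. \<bar>h s\<bar> \<le> M" "\<And>s. \<bar>s\<bar> > M \<Longrightarrow> h s = (0::real)"
  shows "((\<lambda>t. abs_l2 (\<lambda>s. h (t + s) - h s)) \<longlongrightarrow> 0) (at 0)"
  unfolding tendsto_at_iff_sequentially comp_def
proof (intro allI impI)
  fix X :: "nat \<Rightarrow> real" assume X: "\<forall>i. X i \<in> UNIV - {0}" "X \<longlonglongrightarrow> 0"
  have M0: "M \<ge> 0" using h(2)[of 0] by linarith
  have sh: "square_integrable h"
    by (rule square_integrable_bounded_support[where c=M and a="-M" and b="M"])
      (use h in \<open>auto intro: borel_measurable_continuous_onI\<close>)
  obtain B where B: "B \<ge> 0" "\<And>i. \<bar>X i\<bar> \<le> B"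
  proof -
    obtain B where "B > 0" "\<And>i. norm (X i) \<le> B"
      using BseqE[OF convergent_imp_Bseq[OF convergentI[OF X(2)]]] by blast
    then show ?thesis using that[of B] by auto
  qed
  show "(\<lambda>i. abs_l2 (\<lambda>s. h (X i + s) - h s)) \<longlonglongrightarrow> 0"
  proof (rule l2_tendsto_0I[OF _ square_integrable_indicator_Icc[of "2*M" "-(M+B)" "M+B"]])
    show "square_integrable (\<lambda>s. h (X i + s) - h s)" for i
      by (intro square_integrable_diff square_integrable_translate sh)
    have "\<bar>h (X i + s) - h s\<bar> \<le> \<bar>2 * M * indicator {- (M + B)..M + B} s\<bar>" for i s
    proof (cases "\<bar>s\<bar> > M + B")
      case True
      then have "\<bar>s\<bar> > M" "\<bar>X i + s\<bar> > M" using B(1) B(2)[of i] by linarith+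
      then show ?thesis using h(3) by simp
    next
      case False
      then show ?thesis using h(2)[of s] h(2)[of "X i + s"] M0 by (auto simp: indicator_def)
    qed
    then show "AE s in lborel. \<bar>h (X i + s) - h s\<bar> \<le> \<bar>2 * M * indicator {- (M + B)..M + B} s\<bar>" for i by simp
    show "AE s in lborel. (\<lambda>k. h (X k + s) - h s) \<longlonglongrightarrow> 0"
    proof (rule AE_I2)
      fix s
      have "(\<lambda>k. h (X k + s)) \<longlonglongrightarrow> h (0 + s)"
        using h(1) by (intro continuous_on_tendsto_compose[OF h(1)] tendsto_intros X) auto
      then show "(\<lambda>k. h (X k + s) - h s) \<longlonglongrightarrow> 0" by (simp add: LIM_zero_iff)
    qed
  qed
qed

text \<open>Translation is an isometry of L2: replacing \<open>f\<close> by a continuous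
  \<open>h\<close> costs the same before and after the shift, which gives an estimate in three
  thirds of \<open>e\<close>.\<close>

lemma translate_tendsto:
  assumes f: "square_integrable f"
  shows "((\<lambda>t. abs_l2 (\<lambda>s. f (t + s) - f s)) \<longlongrightarrow> 0) (at 0)"
proof (rule tendstoI)
  fix e :: real assume e: "e > 0"
  then have e3: "e/3 > 0" by simp
  obtain h M where h: "continuous_on UNIV h" "\<And>s. \<bar>h s\<bar> \<le> M" "\<And>s. \<bar>s\<bar> > M \<Longrightarrow> h s = (0::real)"
     and a: "norm (abs_l2 f - abs_l2 h) < e/3"
    using continuous_dense_l2[OF e3, of "abs_l2 f"] by blast
  have sh: "square_integrable h"
    by (rule square_integrable_bounded_support[where c=M and a="-M" and b="M"])
      (use h in \<open>auto intro: borel_measurable_continuous_onI\<close>)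
  note sq = f sh square_integrable_translate[OF f] square_integrable_translate[OF sh]
  have tr: "norm (abs_l2 (\<lambda>s. f (t + s)) - abs_l2 (\<lambda>s. h (t + s))) = norm (abs_l2 f - abs_l2 h)" for t
  proof -
    have "(norm (abs_l2 (\<lambda>s. f (t + s)) - abs_l2 (\<lambda>s. h (t + s))))\<^sup>2 = (norm (abs_l2 f - abs_l2 h))\<^sup>2"
      by (simp add: abs_l2_diff sq norm_abs_l2_sq square_integrable_diff integral_translate[of "\<lambda>s. (f s - h s)\<^sup>2"])
    then show ?thesis by simp
  qed
  have "\<forall>\<^sub>F t in at 0. norm (abs_l2 (\<lambda>s. h (t + s) - h s)) < e/3"
    using translate_tendsto_continuous[OF h] e by (auto simp: tendsto_iff dest!: spec[of _ "e/3"])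
  then show "\<forall>\<^sub>F t in at 0. dist (abs_l2 (\<lambda>s. f (t + s) - f s)) 0 < e"
  proof eventually_elim
    case (elim t)
    have eq: "abs_l2 (\<lambda>s. f (t + s) - f s) = (abs_l2 (\<lambda>s. f (t + s)) - abs_l2 (\<lambda>s. h (t + s)))
      + abs_l2 (\<lambda>s. h (t + s) - h s) - (abs_l2 f - abs_l2 h)"
      unfolding abs_l2_diff[OF sq(3,1), symmetric] abs_l2_diff[OF sq(4,2), symmetric] by simp
    have "norm (abs_l2 (\<lambda>s. f (t + s) - f s)) \<le> norm (abs_l2 (\<lambda>s. f (t + s)) - abs_l2 (\<lambda>s. h (t + s)))
        + norm (abs_l2 (\<lambda>s. h (t + s) - h s)) + norm (abs_l2 f - abs_l2 h)"
      unfolding eq by (rule order_trans[OF norm_triangle_ineq4 add_right_mono[OF norm_triangle_ineq]])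
    then show ?case using a elim tr[of t] by (simp add: dist_norm)
  qed
qed

text \<open>Stated with the nonnegative integral so that square integrability comes out as a
  conclusion. This fits a bound obtained from Tonelli's theorem, as in
  \<open>average_bound\<close>.\<close>

lemma norm_abs_l2_leI:
  assumes [measurable]: "f \<in> borel_measurable borel" and c: "c \<ge> 0"
    and le: "(\<integral>\<^sup>+s. ennreal ((f s)\<^sup>2) \<partial>lborel) \<le> ennreal (c\<^sup>2)"
  shows "square_integrable f" "norm (abs_l2 f) \<le> c"
proof -
  have "(\<integral>\<^sup>+s. ennreal ((f s)\<^sup>2) \<partial>lborel) < \<infinity>" using le by (rule order_le_less_trans) simp
  then have int: "integrable lborel (\<lambda>s. (f s)\<^sup>2)" by (intro integrableI_nonneg) auto
  then show sq: "square_integrable f" by (simp add: square_integrable_def)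
  have "ennreal (\<integral>s. (f s)\<^sup>2 \<partial>lborel) \<le> ennreal (c\<^sup>2)"
    using le nn_integral_eq_integral[OF int] by simp
  then have "(norm (abs_l2 f))\<^sup>2 \<le> c\<^sup>2" by (simp add: norm_abs_l2_sq[OF sq])
  then show "norm (abs_l2 f) \<le> c" using c by (rule power2_le_imp_le)
qed

lemma norm_abs_l2_mono:
  assumes "square_integrable g" "f \<in> borel_measurable borel" "AE s in lborel. \<bar>f s\<bar> \<le> \<bar>g s\<bar>"
  shows "norm (abs_l2 f) \<le> norm (abs_l2 g)"
proof -
  have f: "square_integrable f" by (rule square_integrable_bound[OF assms])
  have "(norm (abs_l2 f))\<^sup>2 \<le> (norm (abs_l2 g))\<^sup>2"
    unfolding norm_abs_l2_sq[OF f] norm_abs_l2_sq[OF assms(1)]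
  proof (rule integral_mono_AE)
    show "AE s in lborel. (f s)\<^sup>2 \<le> (g s)\<^sup>2"
      using assms(3) by eventually_elim (simp add: abs_le_square_iff)
  qed (use f assms(1) in \<open>auto simp: square_integrable_def\<close>)
  then show ?thesis by (rule power2_le_imp_le) simp
qed

lemma Cauchy_Schwarz_integral:
  assumes "square_integrable f" "square_integrable g"
  shows "(\<integral>s. f s * g s \<partial>lborel)\<^sup>2 \<le> (\<integral>s. (f s)\<^sup>2 \<partial>lborel) * (\<integral>s. (g s)\<^sup>2 \<partial>lborel)"
  using Cauchy_Schwarz_ineq[of "abs_l2 f" "abs_l2 g"] assms
  by (simp add: inner_abs_l2 power2_eq_square)

section \<open>Locally square integrable functions and history segments\<close>

text \<open>A class that contains the elements of \<open>l2\<close> as well as continuous functions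
  and is closed under translation and under gluing at a point; it therefore contains every L2
  history continued by a solution.\<close>

definition locally_L2 :: "(real \<Rightarrow> real) \<Rightarrow> bool" where
  "locally_L2 y \<longleftrightarrow> y \<in> borel_measurable borel \<and> (\<forall>a b. square_integrable (\<lambda>s. indicator {a..b} s * y s))"

lemma locally_L2_measurable: "locally_L2 y \<Longrightarrow> y \<in> borel_measurable borel"
  by (simp add: locally_L2_def)

lemma locally_L2_cut: "locally_L2 y \<Longrightarrow> square_integrable (\<lambda>s. indicator {a..b} s * y s)"
  by (simp add: locally_L2_def)

lemma locally_L2_mono:
  assumes "locally_L2 y" "z \<in> borel_measurable borel" "\<And>s. \<bar>z s\<bar> \<le> \<bar>y s\<bar>"
  shows "locally_L2 z"
  unfolding locally_L2_def
proof (intro conjI allI assms(2))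
  fix a b
  show "square_integrable (\<lambda>s. indicator {a..b} s * z s)"
    by (rule square_integrable_bound[OF locally_L2_cut[OF assms(1), of a b]])
       (use assms(2,3) in \<open>auto simp: indicator_def\<close>)
qed

lemma square_integrable_imp_locally_L2:
  assumes "square_integrable y" shows "locally_L2 y"
  unfolding locally_L2_def
proof (intro conjI allI)
  show m: "y \<in> borel_measurable borel" using assms by (rule square_integrable_measurable)
  fix a b
  show "square_integrable (\<lambda>s. indicator {a..b} s * y s)"
    by (rule square_integrable_bound[OF assms]) (use m in \<open>auto simp: indicator_def\<close>)
qed

lemma locally_L2_rep [simp]: "locally_L2 (rep_l2 \<phi>)"
  by (simp add: square_integrable_imp_locally_L2)

lemma locally_L2_continuous_on:
  assumes c: "continuous_on {p..} x"
  shows "locally_L2 (\<lambda>r. indicator {p..} r * x r)"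
  unfolding locally_L2_def
proof (intro conjI allI)
  show m: "(\<lambda>r. indicator {p..} r * x r) \<in> borel_measurable borel"
    using borel_measurable_continuous_on_indicator[OF _ c] by simp
  fix a b
  have "compact (x ` {p..b})"
    by (intro compact_continuous_image continuous_on_subset[OF c]) auto
  then obtain K where K: "\<And>r. r \<in> {p..b} \<Longrightarrow> \<bar>x r\<bar> \<le> K"
    using compact_imp_bounded[THEN bounded_iff[THEN iffD1]] by (metis imageI real_norm_def)
  show "square_integrable (\<lambda>s. indicator {a..b} s * (indicator {p..} s * x s))"
  proof (rule square_integrable_bounded_support[where c="max K 0" and a=a and b=b])
    show "\<bar>indicator {a..b} s * (indicator {p..} s * x s)\<bar> \<le> max K 0" for s
      using K[of s] by (auto simp: indicator_def)
  qed (use m in auto)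
qed

lemma locally_L2_add: "locally_L2 y \<Longrightarrow> locally_L2 z \<Longrightarrow> locally_L2 (\<lambda>s. y s + z s)"
  unfolding locally_L2_def by (auto simp: distrib_left intro!: square_integrable_add)

lemma locally_L2_scale: "locally_L2 y \<Longrightarrow> locally_L2 (\<lambda>s. c * y s)"
proof -
  assume "locally_L2 y"
  then have "square_integrable (\<lambda>s. c * (indicator {a..b} s * y s))" for a b
    by (intro square_integrable_scale locally_L2_cut)
  then show ?thesis using \<open>locally_L2 y\<close> unfolding locally_L2_def by (auto simp: ac_simps)
qed

lemma locally_L2_diff: "locally_L2 y \<Longrightarrow> locally_L2 z \<Longrightarrow> locally_L2 (\<lambda>s. y s - z s)"
  unfolding locally_L2_def by (auto simp: right_diff_distrib intro!: square_integrable_diff)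

lemma locally_L2_translate: "locally_L2 y \<Longrightarrow> locally_L2 (\<lambda>s. y (t + s))"
  unfolding locally_L2_def
proof (intro conjI allI)
  assume y: "y \<in> borel_measurable borel \<and> (\<forall>a b. square_integrable (\<lambda>s. indicator {a..b} s * y s))"
  then have [measurable]: "y \<in> borel_measurable borel" by simp
  show "(\<lambda>s. y (t + s)) \<in> borel_measurable borel" by measurable
  fix a b
  have "square_integrable (\<lambda>s. indicator {t+a..t+b} (t + s) * y (t + s))"
    using y by (intro square_integrable_translate[of "\<lambda>s. indicator {t+a..t+b} s * y s"]) auto
  then show "square_integrable (\<lambda>s. indicator {a..b} s * y (t + s))"
    by (simp add: indicator_def)
qed

lemma locally_L2_if:
  assumes "locally_L2 y" "continuous_on {p..} x"
  shows "locally_L2 (\<lambda>r. if r < p then y r else x r)"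
proof -
  have "locally_L2 (\<lambda>r. indicator {..<p} r * y r)"
    by (rule locally_L2_mono[OF assms(1)])
       (use locally_L2_measurable[OF assms(1)] in \<open>auto simp: indicator_def\<close>)
  from locally_L2_add[OF this locally_L2_continuous_on[OF assms(2)]]
  show ?thesis
    by (rule back_subst[of locally_L2]) (auto simp: indicator_def fun_eq_iff)
qed

lemma locally_L2_continuous: "continuous_on UNIV x \<Longrightarrow> locally_L2 x"
proof -
  assume x: "continuous_on UNIV x"
  show "locally_L2 x"
    unfolding locally_L2_def
  proof (intro conjI allI)
    show m: "x \<in> borel_measurable borel" using x by (rule borel_measurable_continuous_onI)
    fix a b
    have "locally_L2 (\<lambda>r. indicator {a..} r * x r)"
      by (rule locally_L2_continuous_on) (use x continuous_on_subset in blast)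
    from locally_L2_cut[OF this, of a b]
    show "square_integrable (\<lambda>s. indicator {a..b} s * x s)"
      by (rule back_subst[of square_integrable]) (auto simp: indicator_def fun_eq_iff)
  qed
qed

lemma locally_L2_integrable:
  assumes "locally_L2 y"
  shows "integrable lborel (\<lambda>s. indicator {a..b} s * y s)"
  using square_integrable_mult[OF square_integrable_indicator_Icc[of 1 a b] locally_L2_cut[OF assms, of a b]]
  by (rule back_subst[of "integrable lborel"]) (auto simp: indicator_def fun_eq_iff)

text \<open>\<open>seg \<tau> (\<lambda>s. y (t + s))\<close> is the history segment of
  \<open>y\<close> at time t, as an element of the phase space.\<close>

definition seg :: "real \<Rightarrow> (real \<Rightarrow> real) \<Rightarrow> l2" where
  "seg \<tau> y = abs_l2 (\<lambda>s. indicator {-\<tau>..0} s * y s)"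

lemma rep_seg: "locally_L2 y \<Longrightarrow> AE s in lborel. rep_l2 (seg \<tau> y) s = indicator {-\<tau>..0} s * y s"
  unfolding seg_def by (intro rep_abs_l2 locally_L2_cut)

lemma seg_in_L2_on: "locally_L2 y \<Longrightarrow> seg \<tau> y \<in> L2_on {-\<tau>..0}"
  unfolding L2_on_def using rep_seg[of y \<tau>] by (auto elim: eventually_mono)

lemma seg_cong:
  assumes "locally_L2 y" "locally_L2 z" "AE s in lborel. s \<in> {-\<tau>..0} \<longrightarrow> y s = z s"
  shows "seg \<tau> y = seg \<tau> z"
  unfolding seg_def
  by (intro abs_l2_eqI locally_L2_cut assms(1,2)) (use assms(3) in \<open>auto elim!: eventually_mono simp: indicator_def\<close>)

lemma seg_rep:
  assumes "\<phi> \<in> L2_on {-\<tau>..0}" shows "seg \<tau> (rep_l2 \<phi>) = \<phi>"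
proof (rule l2_eqI)
  have "AE s in lborel. s \<notin> {-\<tau>..0} \<longrightarrow> rep_l2 \<phi> s = 0" using assms by (simp add: L2_on_def)
  with rep_seg[of "rep_l2 \<phi>" \<tau>, simplified]
  show "AE s in lborel. rep_l2 (seg \<tau> (rep_l2 \<phi>)) s = rep_l2 \<phi> s"
    by eventually_elim (auto simp: indicator_def)
qed

lemma seg_add: "locally_L2 y \<Longrightarrow> locally_L2 z \<Longrightarrow> seg \<tau> y + seg \<tau> z = seg \<tau> (\<lambda>s. y s + z s)"
  unfolding seg_def by (simp add: abs_l2_add locally_L2_cut distrib_left)

lemma seg_diff: "locally_L2 y \<Longrightarrow> locally_L2 z \<Longrightarrow> seg \<tau> y - seg \<tau> z = seg \<tau> (\<lambda>s. y s - z s)"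
  unfolding seg_def by (simp add: abs_l2_diff locally_L2_cut right_diff_distrib)

lemma seg_scale: "locally_L2 y \<Longrightarrow> c *\<^sub>R seg \<tau> y = seg \<tau> (\<lambda>s. c * y s)"
  unfolding seg_def by (simp add: abs_l2_scaleR locally_L2_cut mult.left_commute)

lemma inner_seg:
  assumes "locally_L2 y"
  shows "inner \<zeta> (seg \<tau> y) = (\<integral>s. indicator {-\<tau>..0} s * (rep_l2 \<zeta> s * y s) \<partial>lborel)"
  using inner_abs_l2[of "rep_l2 \<zeta>", OF _ locally_L2_cut[OF assms, of "-\<tau>" 0]]
  by (simp add: seg_def mult.left_commute)

lemma norm_seg_sq: "locally_L2 y \<Longrightarrow> (norm (seg \<tau> y))\<^sup>2 = (\<integral>s. indicator {-\<tau>..0} s * (y s)\<^sup>2 \<partial>lborel)"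
  unfolding seg_def
  by (subst norm_abs_l2_sq[OF locally_L2_cut]) (auto simp: indicator_def intro!: Bochner_Integration.integral_cong)

lemma norm_seg_le:
  assumes "\<tau> \<ge> 0" "y \<in> borel_measurable borel" "c \<ge> 0" "AE s in lborel. s \<in> {-\<tau>..0} \<longrightarrow> \<bar>y s\<bar> \<le> c"
  shows "norm (seg \<tau> y) \<le> c * sqrt \<tau>"
proof -
  have "norm (seg \<tau> y) \<le> norm (abs_l2 (\<lambda>s. c * indicator {-\<tau>..0} s))"
    unfolding seg_def
    by (rule norm_abs_l2_mono[OF square_integrable_indicator_Icc])
       (use assms in \<open>auto elim!: eventually_mono simp: indicator_def\<close>)
  also have "\<dots> = c * sqrt \<tau>"
  proof -
    have "(\<lambda>s. (c * indicator {-\<tau>..0} s)\<^sup>2) = (\<lambda>s. c\<^sup>2 * indicator {-\<tau>..0::real} s)"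
      by (auto simp: fun_eq_iff indicator_def)
    then have "(norm (abs_l2 (\<lambda>s. c * indicator {-\<tau>..0} s)))\<^sup>2 = (c * sqrt \<tau>)\<^sup>2"
      using assms(1,3) by (simp add: norm_abs_l2_sq square_integrable_indicator_Icc power_mult_distrib)
    then show ?thesis by (rule power2_eq_imp_eq) (use assms in auto)
  qed
  finally show ?thesis .
qed

text \<open>Brings estimates for globally square integrable functions to a window: \<open>z\<close>
  has to dominate \<open>y\<close> on the window only, so it may be built from a cut-off of
  \<open>y\<close>.\<close>

lemma norm_seg_mono:
  assumes "locally_L2 y" "square_integrable z" "\<And>s. s \<in> {-\<tau>..0} \<Longrightarrow> \<bar>y s\<bar> \<le> \<bar>z s\<bar>"
  shows "norm (seg \<tau> y) \<le> norm (abs_l2 z)"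
  unfolding seg_def
  by (rule norm_abs_l2_mono[OF assms(2)])
     (use assms locally_L2_measurable in \<open>auto simp: indicator_def\<close>)

text \<open>By the Cauchy--Schwarz inequality on \<open>[0, h]\<close> and Fubini's theorem.\<close>

lemma average_bound:
  assumes f: "square_integrable f" and h: "h > 0" and c: "c \<ge> 0"
    and tr: "\<And>r. 0 \<le> r \<Longrightarrow> r \<le> h \<Longrightarrow> norm (abs_l2 (\<lambda>s. f (r + s) - f s)) \<le> c"
  shows "square_integrable (\<lambda>s. 1/h * (\<integral>r. indicator {0..h} r * f (s + r) \<partial>lborel) - f s)"
    and "norm (abs_l2 (\<lambda>s. 1/h * (\<integral>r. indicator {0..h} r * f (s + r) \<partial>lborel) - f s)) \<le> c"
proof -
  have [measurable]: "f \<in> borel_measurable borel" by (rule square_integrable_measurable[OF f])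
  define A where "A s = 1/h * (\<integral>r. indicator {0..h} r * f (s + r) \<partial>lborel) - f s" for s
  have [measurable]: "A \<in> borel_measurable borel" unfolding A_def by measurable
  have lf: "locally_L2 f" by (rule square_integrable_imp_locally_L2[OF f])
  have ind: "(\<integral>r. indicator {0..h} r \<partial>lborel) = h" using h by simp
  have L: "locally_L2 (\<lambda>r. f (s + r) - f s)" for s
    by (rule locally_L2_diff[OF locally_L2_translate[OF lf, of s] locally_L2_continuous[of "\<lambda>_. f s"]]) simp
  have sqd: "integrable lborel (\<lambda>r. indicator {0..h} r * (f (s + r) - f s)\<^sup>2)" for s
  proof -
    have "(\<lambda>r. (indicator {0..h} r * (f (s + r) - f s))\<^sup>2) = (\<lambda>r. indicator {0..h} r * (f (s + r) - f s)\<^sup>2)"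
      by (auto simp: indicator_def fun_eq_iff)
    then show ?thesis using locally_L2_cut[OF L, of 0 h s] by (simp add: square_integrable_def)
  qed
  have pt: "(A s)\<^sup>2 \<le> (\<integral>r. 1/h * (indicator {0..h} r * (f (s + r) - f s)\<^sup>2) \<partial>lborel)" for s
  proof -
    have "A s = 1/h * ((\<integral>r. indicator {0..h} r * f (s + r) \<partial>lborel) - (\<integral>r. indicator {0..h} r * f s \<partial>lborel))"
      using h ind by (simp add: A_def field_simps)
    also have "\<dots> = 1/h * (\<integral>r. indicator {0..h} r * f (s + r) - indicator {0..h} r * f s \<partial>lborel)"
      by (subst Bochner_Integration.integral_diff)
         (auto intro!: locally_L2_integrable[OF locally_L2_translate[OF lf]] integrable_real_indicator simp: emeasure_lborel_Icc_eq)
    \<comment> \<open>The indicator is doubled to obtain an inner product with the indicator of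
      [0, h], whose squared norm is \<open>h\<close>.\<close>
    also have "\<dots> = 1/h * (\<integral>r. indicator {0..h} r * (indicator {0..h} r * (f (s + r) - f s)) \<partial>lborel)"
      by (auto intro!: arg_cong[where f="\<lambda>x. 1/h * x"] Bochner_Integration.integral_cong simp: indicator_def simp del: times_divide_eq_left)
    finally have "(A s)\<^sup>2 = (1/h)\<^sup>2 * (\<integral>r. indicator {0..h} r * (indicator {0..h} r * (f (s + r) - f s)) \<partial>lborel)\<^sup>2"
      by (simp only: power_mult_distrib)
    also have "\<dots> \<le> (1/h)\<^sup>2 * ((\<integral>r. (indicator {0..h} r)\<^sup>2 \<partial>lborel) * (\<integral>r. (indicator {0..h} r * (f (s + r) - f s))\<^sup>2 \<partial>lborel))"
      by (intro mult_left_mono Cauchy_Schwarz_integral locally_L2_cut L) (use square_integrable_indicator_Icc[of 1 0 h] in auto)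
    also have "(\<integral>r. (indicator {0..h} r :: real)\<^sup>2 \<partial>lborel) = h"
      using ind by (simp add: power2_eq_square flip: indicator_inter_arith)
    also have "(\<integral>r. (indicator {0..h} r * (f (s + r) - f s))\<^sup>2 \<partial>lborel) = (\<integral>r. indicator {0..h} r * (f (s + r) - f s)\<^sup>2 \<partial>lborel)"
      by (auto intro!: Bochner_Integration.integral_cong simp: indicator_def)
    finally show ?thesis using h by (simp add: power2_eq_square field_simps)
  qed
  have "(\<integral>\<^sup>+s. ennreal ((A s)\<^sup>2) \<partial>lborel)
      \<le> (\<integral>\<^sup>+s. (\<integral>\<^sup>+r. ennreal (1/h * (indicator {0..h} r * (f (s + r) - f s)\<^sup>2)) \<partial>lborel) \<partial>lborel)"
  proof (rule nn_integral_mono)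
    fix s
    have "ennreal ((A s)\<^sup>2) \<le> ennreal (\<integral>r. 1/h * (indicator {0..h} r * (f (s + r) - f s)\<^sup>2) \<partial>lborel)"
      using pt by (rule ennreal_leI)
    also have "\<dots> = (\<integral>\<^sup>+r. ennreal (1/h * (indicator {0..h} r * (f (s + r) - f s)\<^sup>2)) \<partial>lborel)"
      using h by (intro nn_integral_eq_integral[symmetric] integrable_mult_right sqd) (auto simp: indicator_def)
    finally show "ennreal ((A s)\<^sup>2) \<le> (\<integral>\<^sup>+r. ennreal (1/h * (indicator {0..h} r * (f (s + r) - f s)\<^sup>2)) \<partial>lborel)" .
  qed
  also have "\<dots> = (\<integral>\<^sup>+r. (\<integral>\<^sup>+s. ennreal (1/h * (indicator {0..h} r * (f (s + r) - f s)\<^sup>2)) \<partial>lborel) \<partial>lborel)"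
    by (rule lborel_pair.Fubini') measurable
  also have "\<dots> \<le> (\<integral>\<^sup>+r. ennreal (c\<^sup>2 / h) * indicator {0..h} r \<partial>lborel)"
  proof (rule nn_integral_mono)
    fix r :: real
    show "(\<integral>\<^sup>+s. ennreal (1/h * (indicator {0..h} r * (f (s + r) - f s)\<^sup>2)) \<partial>lborel) \<le> ennreal (c\<^sup>2 / h) * indicator {0..h} r"
    proof (cases "r \<in> {0..h}")
      case False then show ?thesis by simp
    next
      case True
      have sq: "square_integrable (\<lambda>s. f (r + s) - f s)"
        by (intro square_integrable_diff square_integrable_translate f)
      have "(\<integral>\<^sup>+s. ennreal (1/h * (indicator {0..h} r * (f (s + r) - f s)\<^sup>2)) \<partial>lborel)
          = (\<integral>\<^sup>+s. ennreal (1/h * (f (r + s) - f s)\<^sup>2) \<partial>lborel)" using True by (simp add: add.commute)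
      also have "\<dots> = ennreal (\<integral>s. 1/h * (f (r + s) - f s)\<^sup>2 \<partial>lborel)"
        using sq h by (intro nn_integral_eq_integral integrable_mult_right) (auto simp: square_integrable_def)
      also have "\<dots> = ennreal (1/h * (norm (abs_l2 (\<lambda>s. f (r + s) - f s)))\<^sup>2)"
        by (simp add: norm_abs_l2_sq[OF sq])
      also have "\<dots> \<le> ennreal (c\<^sup>2 / h)"
        using tr[of r] True h by (intro ennreal_leI) (auto simp: divide_right_mono power_mono)
      finally show ?thesis using True by simp
    qed
  qed
  also have "\<dots> = ennreal (c\<^sup>2 / h) * ennreal h" using h by (subst nn_integral_cmult_indicator) auto
  also have "\<dots> = ennreal (c\<^sup>2)" using h by (simp flip: ennreal_mult)
  finally have le: "(\<integral>\<^sup>+s. ennreal ((A s)\<^sup>2) \<partial>lborel) \<le> ennreal (c\<^sup>2)" .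
  show "square_integrable (\<lambda>s. 1/h * (\<integral>r. indicator {0..h} r * f (s + r) \<partial>lborel) - f s)"
    "norm (abs_l2 (\<lambda>s. 1/h * (\<integral>r. indicator {0..h} r * f (s + r) \<partial>lborel) - f s)) \<le> c"
    using norm_abs_l2_leI[OF _ c le] unfolding A_def by auto
qed

text \<open>For small \<open>h\<close> all translates by r in [0, h] are within \<open>e/2\<close>
  of \<open>f\<close>, and \<open>average_bound\<close> passes this to their mean. Using
  \<open>e/2\<close> makes the final inequality strict.\<close>

lemma average_tendsto:
  assumes f: "square_integrable f" and e: "e > 0"
  shows "\<forall>\<^sub>F h in at_right 0. square_integrable (\<lambda>s. 1/h * (\<integral>r. indicator {0..h} r * f (s + r) \<partial>lborel) - f s)
    \<and> norm (abs_l2 (\<lambda>s. 1/h * (\<integral>r. indicator {0..h} r * f (s + r) \<partial>lborel) - f s)) < e"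
proof -
  from translate_tendsto[OF f] e have "\<forall>\<^sub>F t in at 0. norm (abs_l2 (\<lambda>s. f (t + s) - f s)) < e/2"
    by (auto simp: tendsto_iff dest!: spec[of _ "e/2"])
  then obtain d where d: "d > 0" "\<And>t. t \<noteq> 0 \<Longrightarrow> \<bar>t\<bar> < d \<Longrightarrow> norm (abs_l2 (\<lambda>s. f (t + s) - f s)) < e/2"
    unfolding eventually_at by (auto simp: dist_real_def)
  have d0: "norm (abs_l2 (\<lambda>s. f (r + s) - f s)) \<le> e/2" if "0 \<le> r" "r < d" for r
    using d(2)[of r] that e by (cases "r = 0") (auto simp: abs_l2_0)
  have "\<forall>\<^sub>F h in at_right 0. (0::real) < h \<and> h < d"
    using d(1) by (auto simp: eventually_at_right intro!: exI[of _ d])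
  then show ?thesis
  proof eventually_elim
    case (elim h)
    then show ?case using average_bound[OF f, of h "e/2"] d0 e by fastforce
  qed
qed

section \<open>The semigroup of the unforced equation\<close>

text \<open>\<open>extend lam z\<close> is the history \<open>snd z\<close> continued by the solution of \<open>x' = -lam x\<close> with
  \<open>x(0) = fst z\<close>; the semigroup generated by \<open>op_A\<close> translates it.\<close>

definition extend :: "real \<Rightarrow> real \<times> l2 \<Rightarrow> real \<Rightarrow> real" where
  "extend lam z s = (if s < 0 then rep_l2 (snd z) s else fst z * exp (- lam * s))"

definition translation_semigroup :: "real \<Rightarrow> real \<Rightarrow> real \<Rightarrow> real \<times> l2 \<Rightarrow> real \<times> l2" where
  "translation_semigroup lam \<tau> t z = (fst z * exp (- lam * t), seg \<tau> (\<lambda>s. extend lam z (t + s)))"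

lemma locally_L2_extend [simp]: "locally_L2 (extend lam z)"
proof -
  have "locally_L2 (\<lambda>s. if s < 0 then rep_l2 (snd z) s else fst z * exp (- lam * s))"
    by (intro locally_L2_if) (auto intro!: continuous_intros)
  then show ?thesis by (simp add: extend_def[abs_def])
qed

lemma locally_L2_extend_shift [simp]: "locally_L2 (\<lambda>s. extend lam z (t + s))"
  by (rule locally_L2_translate) simp

lemma AE_neq: "AE s in lborel. s \<noteq> (a::real)"
  by (rule AE_lborel_singleton)

lemma H_iff: "z \<in> H \<tau> \<longleftrightarrow> snd z \<in> L2_on {-\<tau>..0}"
  by (cases z) (simp add: H_def)

lemma seg_extend: "z \<in> H \<tau> \<Longrightarrow> seg \<tau> (extend lam z) = snd z"
proof -
  assume "z \<in> H \<tau>"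
  then have "snd z = seg \<tau> (rep_l2 (snd z))" by (simp add: H_iff seg_rep)
  also have "\<dots> = seg \<tau> (extend lam z)"
    by (rule seg_cong) (use AE_neq[of 0] in \<open>auto simp: extend_def elim!: eventually_mono\<close>)
  finally show ?thesis by simp
qed

lemma translation_semigroup_in_H [simp]: "translation_semigroup lam \<tau> t z \<in> H \<tau>"
  by (simp add: translation_semigroup_def H_iff seg_in_L2_on)

lemma translation_semigroup_0: "z \<in> H \<tau> \<Longrightarrow> translation_semigroup lam \<tau> 0 z = z"
  by (cases z) (simp add: translation_semigroup_def seg_extend[where lam=lam])

lemma rep_l2_add: "AE s in lborel. rep_l2 (\<phi> + \<psi>) s = rep_l2 \<phi> s + rep_l2 \<psi> s"
  using rep_abs_l2[of "\<lambda>s. rep_l2 \<phi> s + rep_l2 \<psi> s"] abs_l2_add[of "rep_l2 \<phi>" "rep_l2 \<psi>"]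
  by (simp add: square_integrable_add)

lemma rep_l2_scaleR: "AE s in lborel. rep_l2 (c *\<^sub>R \<phi>) s = c * rep_l2 \<phi> s"
  using rep_abs_l2[of "\<lambda>s. c * rep_l2 \<phi> s"] abs_l2_scaleR[of "rep_l2 \<phi>" c]
  by (simp add: square_integrable_scale)

text \<open>Holds almost everywhere only, because \<open>rep_l2\<close> picks representatives that
  need not respect the vector space operations.\<close>

lemma extend_linear:
  "AE s in lborel. extend lam (a *\<^sub>R y + c *\<^sub>R z) s = a * extend lam y s + c * extend lam z s"
  using rep_l2_add[of "a *\<^sub>R snd y" "c *\<^sub>R snd z"] rep_l2_scaleR[of a "snd y"] rep_l2_scaleR[of c "snd z"]
  by eventually_elim (auto simp: extend_def algebra_simps)

lemma translation_semigroup_linear: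
  "translation_semigroup lam \<tau> t (a *\<^sub>R y + c *\<^sub>R z)
   = a *\<^sub>R translation_semigroup lam \<tau> t y + c *\<^sub>R translation_semigroup lam \<tau> t z"
proof -
  have "seg \<tau> (\<lambda>s. extend lam (a *\<^sub>R y + c *\<^sub>R z) (t + s))
      = seg \<tau> (\<lambda>s. a * extend lam y (t + s) + c * extend lam z (t + s))"
    using AE_translate[OF extend_linear[of lam a y c z], of t]
    by (intro seg_cong locally_L2_add locally_L2_scale) (auto elim: eventually_mono)
  also have "\<dots> = a *\<^sub>R seg \<tau> (\<lambda>s. extend lam y (t + s)) + c *\<^sub>R seg \<tau> (\<lambda>s. extend lam z (t + s))"
    by (simp add: seg_scale seg_add locally_L2_scale)
  finally show ?thesis by (simp add: translation_semigroup_def algebra_simps)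
qed

lemma translation_semigroup_add:
  assumes "t \<ge> 0" "s \<ge> 0"
  shows "translation_semigroup lam \<tau> (t + s) z = translation_semigroup lam \<tau> t (translation_semigroup lam \<tau> s z)"
proof -
  let ?y = "translation_semigroup lam \<tau> s z"
  \<comment> \<open>To the left of \<open>-\<tau>\<close> the state has forgotten the history that
    \<open>extend lam z\<close> still carries. The restriction is harmless: for \<open>t\<close>
    nonnegative the translated window stays to the right of \<open>-\<tau>\<close>.\<close>
  have "AE r in lborel. r \<ge> -\<tau> \<longrightarrow> extend lam ?y r = extend lam z (s + r)"
    using rep_seg[of "\<lambda>r. extend lam z (s + r)" \<tau>, simplified]
  proof eventually_elim
    case (elim r)
    show ?case
    proof (cases "r < 0")
      case True
      then have "extend lam ?y r = rep_l2 (seg \<tau> (\<lambda>r. extend lam z (s + r))) r"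
        unfolding extend_def[of lam ?y] by (simp add: translation_semigroup_def)
      then show ?thesis using elim True by auto
    next
      case False
      then show ?thesis using assms
        by (auto simp: extend_def translation_semigroup_def algebra_simps simp flip: exp_add)
    qed
  qed
  from AE_translate[OF this, of t]
  have "AE r in lborel. r \<in> {-\<tau>..0} \<longrightarrow> extend lam z (t + s + r) = extend lam ?y (t + r)"
    by (rule eventually_mono) (use assms in \<open>auto simp: add.assoc add.left_commute\<close>)
  then have "seg \<tau> (\<lambda>r. extend lam z (t + s + r)) = seg \<tau> (\<lambda>r. extend lam ?y (t + r))"
    by (intro seg_cong) auto
  then show ?thesis
    by (simp add: translation_semigroup_def[of lam \<tau> "t + s"] translation_semigroup_def[of lam \<tau> t])
       (simp add: translation_semigroup_def algebra_simps flip: exp_add)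
qed

text \<open>The window [t - \<open>\<tau>\<close>, t] meets the old history and at most the piece
  [0, t] of the exponential, which adds at most \<open>x\<^sup>2 * t\<close> to the squared norm.
  The bound is uniform for bounded times, as needed in
  \<open>generator_determines_semigroup\<close>.\<close>

lemma translation_semigroup_bound:
  assumes lam: "lam \<ge> 0" and t: "t \<ge> 0"
  shows "norm (translation_semigroup lam \<tau> t z) \<le> (1 + t) * norm z"
proof -
  define x where "x = fst z"
  define \<phi> where "\<phi> = rep_l2 (snd z)"
  have sq: "square_integrable \<phi>" and [measurable]: "\<phi> \<in> borel_measurable borel" by (auto simp: \<phi>_def)
  have e1: "\<bar>exp (- lam * s)\<bar> \<le> 1" if "s \<ge> 0" for s using lam that by simp
  have xe: "(x * exp (- lam * s))\<^sup>2 \<le> x\<^sup>2" if "s \<ge> 0" for s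
    using mult_left_mono[OF power_mono[OF e1[OF that], of 2], of "x\<^sup>2"] by (simp add: power_mult_distrib)
  have int: "integrable lborel (\<lambda>s. (\<phi> s)\<^sup>2)" "integrable lborel (\<lambda>s. x\<^sup>2 * indicator {0..t} s)"
    using sq by (auto simp: square_integrable_def intro!: integrable_real_indicator simp: emeasure_lborel_Icc_eq)
  have L: "locally_L2 (extend lam z)" by simp
  have [measurable]: "extend lam z \<in> borel_measurable borel" by (rule locally_L2_measurable[OF L])
  have "(norm (seg \<tau> (\<lambda>s. extend lam z (t + s))))\<^sup>2
      = (\<integral>s. indicator {-\<tau>..0} s * (extend lam z (t + s))\<^sup>2 \<partial>lborel)"
    by (simp add: norm_seg_sq)
  also have "\<dots> = (\<integral>s. indicator {t-\<tau>..t} (t + s) * (extend lam z (t + s))\<^sup>2 \<partial>lborel)"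
    by (auto intro!: Bochner_Integration.integral_cong simp: indicator_def)
  also have "\<dots> = (\<integral>s. indicator {t-\<tau>..t} s * (extend lam z s)\<^sup>2 \<partial>lborel)"
    by (rule integral_translate[of "\<lambda>s. indicator {t-\<tau>..t} s * (extend lam z s)\<^sup>2"])
  also have "\<dots> \<le> (\<integral>s. (\<phi> s)\<^sup>2 + x\<^sup>2 * indicator {0..t} s \<partial>lborel)"
  proof (rule integral_mono)
    show "integrable lborel (\<lambda>s. indicator {t-\<tau>..t} s * (extend lam z s)\<^sup>2)"
    proof -
      have "(\<lambda>s. (indicator {t-\<tau>..t} s * (extend lam z s))\<^sup>2) = (\<lambda>s. indicator {t-\<tau>..t} s * (extend lam z s)\<^sup>2)"
        by (auto simp: indicator_def fun_eq_iff)
      then show ?thesis using locally_L2_cut[OF L, of "t-\<tau>" t] by (simp add: square_integrable_def)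
    qed
    show "indicator {t-\<tau>..t} s * (extend lam z s)\<^sup>2 \<le> (\<phi> s)\<^sup>2 + x\<^sup>2 * indicator {0..t} s" for s
      using xe[of s] by (auto simp: indicator_def extend_def x_def \<phi>_def intro: add_increasing)
  qed (use int in auto)
  also have "\<dots> = (norm (snd z))\<^sup>2 + x\<^sup>2 * t"
    using int t by (simp add: norm_l2_sq \<phi>_def)
  finally have n2: "(norm (seg \<tau> (\<lambda>s. extend lam z (t + s))))\<^sup>2 \<le> (norm (snd z))\<^sup>2 + x\<^sup>2 * t" .
  have nz: "(norm z)\<^sup>2 = x\<^sup>2 + (norm (snd z))\<^sup>2" by (cases z) (simp add: norm_Pair x_def)
  have "(norm (translation_semigroup lam \<tau> t z))\<^sup>2
      = (x * exp (- lam * t))\<^sup>2 + (norm (seg \<tau> (\<lambda>s. extend lam z (t + s))))\<^sup>2"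
    by (simp add: translation_semigroup_def norm_Pair x_def)
  also have "\<dots> \<le> x\<^sup>2 + ((norm (snd z))\<^sup>2 + x\<^sup>2 * t)" using xe[OF t] n2 by (rule add_mono)
  also have "\<dots> \<le> (1 + t) * (norm z)\<^sup>2" unfolding nz using t by (simp add: algebra_simps)
  also have "\<dots> \<le> (1 + t)\<^sup>2 * (norm z)\<^sup>2"
    using t by (intro mult_right_mono) (auto simp: power2_eq_square algebra_simps)
  also have "\<dots> = ((1 + t) * norm z)\<^sup>2" by (simp add: power_mult_distrib)
  finally show ?thesis by (rule power2_le_imp_le) (use t in auto)
qed

lemma eventually_at_right_less: "d > 0 \<Longrightarrow> \<forall>\<^sub>F h in at_right 0. 0 < h \<and> h < (d::real)"
  by (auto simp: eventually_at_right intro!: exI[of _ d])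

lemma seg_extend_tendsto:
  "((\<lambda>h. seg \<tau> (\<lambda>s. extend lam z (h + s) - extend lam z s)) \<longlongrightarrow> 0) (at_right 0)"
proof -
  \<comment> \<open>For h < 1 the window and its translate by h lie in [-\<open>\<tau>\<close>, 1],
    so the continuity of translation in L2 can be applied to this cut-off.\<close>
  define E where "E s = indicator {-\<tau>..1} s * extend lam z s" for s
  have E: "square_integrable E" unfolding E_def by (rule locally_L2_cut) simp
  have "((\<lambda>t. abs_l2 (\<lambda>s. E (t + s) - E s)) \<longlongrightarrow> 0) (at_right 0)"
    using translate_tendsto[OF E] by (rule filterlim_mono) (auto simp: at_within_le_at)
  then have lim: "((\<lambda>t. norm (abs_l2 (\<lambda>s. E (t + s) - E s))) \<longlongrightarrow> 0) (at_right 0)"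
    by (rule tendsto_norm_zero)
  have "\<forall>\<^sub>F h in at_right 0. 0 < h \<and> h < (1::real)" by (rule eventually_at_right_less) simp
  then have "\<forall>\<^sub>F h in at_right 0. norm (seg \<tau> (\<lambda>s. extend lam z (h + s) - extend lam z s))
      \<le> norm (abs_l2 (\<lambda>s. E (h + s) - E s))"
  proof eventually_elim
    case (elim h)
    show ?case
      by (rule norm_seg_mono)
         (use elim in \<open>auto intro!: locally_L2_diff square_integrable_diff square_integrable_translate[OF E] E\<close>,
          auto simp: E_def)
  qed
  then have "((\<lambda>h. norm (seg \<tau> (\<lambda>s. extend lam z (h + s) - extend lam z s))) \<longlongrightarrow> 0) (at_right 0)"
    by (intro tendsto_sandwich[OF _ _ tendsto_const lim]) auto
  then show ?thesis by (rule tendsto_norm_zero_cancel)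
qed

lemma translation_semigroup_tendsto:
  assumes "z \<in> H \<tau>"
  shows "((\<lambda>t. translation_semigroup lam \<tau> t z) \<longlongrightarrow> z) (at_right 0)"
proof -
  have "((\<lambda>t. fst z * exp (- lam * t)) \<longlongrightarrow> fst z * exp (- lam * 0)) (at_right 0)"
    by (intro tendsto_intros)
  moreover have "((\<lambda>h. seg \<tau> (\<lambda>s. extend lam z (h + s))) \<longlongrightarrow> snd z) (at_right 0)"
  proof (rule Lim_transform[OF tendsto_const])
    show "((\<lambda>h. seg \<tau> (\<lambda>s. extend lam z (h + s)) - snd z) \<longlongrightarrow> 0) (at_right 0)"
      using seg_extend_tendsto[of \<tau> lam z] by (simp add: seg_extend[OF assms, of lam, symmetric] seg_diff)
  qed
  ultimately show ?thesis
    unfolding translation_semigroup_def by (cases z) (auto intro!: tendsto_Pair)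
qed

lemma C0_translation_semigroup:
  assumes "lam \<ge> 0"
  shows "C0_semigroup_on (H \<tau>) (translation_semigroup lam \<tau>)"
proof -
  have "\<exists>K. \<forall>z\<in>H \<tau>. norm (translation_semigroup lam \<tau> t z) \<le> K * norm z" if "t \<ge> 0" for t
    using translation_semigroup_bound[OF assms that] by blast
  then show ?thesis
    unfolding C0_semigroup_on_def
    by (auto simp: translation_semigroup_0 translation_semigroup_add translation_semigroup_linear
        intro: translation_semigroup_tendsto)
qed

section \<open>A generator determines its semigroup\<close>

text \<open>A Baire type argument: right continuity yields, inside every interval, a closed
  subinterval on which \<open>u\<close> oscillates little. Nested intervals with oscillation below
  1/(n+1) shrink to a point of continuity.\<close>

lemma right_continuous_imp_continuity_point:
  fixes u :: "real \<Rightarrow> 'a::metric_space"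
  assumes rc: "\<And>t. a < t \<Longrightarrow> t < b \<Longrightarrow> (u \<longlongrightarrow> u t) (at_right t)" and ab: "a < b"
  shows "\<exists>c. a < c \<and> c < b \<and> isCont u c"
proof -
  have step: "\<exists>I'. fst I' < snd I' \<and> fst I < fst I' \<and> snd I' < snd I
      \<and> (\<forall>s\<in>{fst I'..snd I'}. \<forall>s'\<in>{fst I'..snd I'}. dist (u s) (u s') < e)"
    if I: "a \<le> fst I" "snd I \<le> b" "fst I < snd I" and e: "e > 0" for I :: "real \<times> real" and e :: real
  proof -
    define m where "m = (fst I + snd I) / 2"
    have m: "fst I < m" "m < snd I" using I(3) by (auto simp: m_def)
    then have "\<forall>\<^sub>F s in at_right m. dist (u s) (u m) < e/2"
      using rc[of m] I e by (auto simp: tendsto_iff dest!: spec[of _ "e/2"])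
    then obtain d where d: "d > m" "\<And>s. m < s \<Longrightarrow> s < d \<Longrightarrow> dist (u s) (u m) < e/2"
      unfolding eventually_at_right_field by auto
    \<comment> \<open>On (m, r) all values are within \<open>e/2\<close> of \<open>u m\<close>. The
      interval chosen from it avoids the endpoints of \<open>I\<close>, so that the nesting is
      strict.\<close>
    define r where "r = min d (snd I)"
    have r: "m < r" "r \<le> d" "r \<le> snd I" using d(1) m by (auto simp: r_def)
    show ?thesis
    proof (intro exI[of _ "(m + (r - m)/3, m + (r - m)/2)"] conjI ballI)
      fix s s' assume "s \<in> {fst (m + (r - m)/3, m + (r - m)/2)..snd (m + (r - m)/3, m + (r - m)/2)}"
        "s' \<in> {fst (m + (r - m)/3, m + (r - m)/2)..snd (m + (r - m)/3, m + (r - m)/2)}"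
      then have "m < s" "s < d" "m < s'" "s' < d" using r by (auto simp: field_simps)
      then show "dist (u s) (u s') < e"
        by (intro dist_triangle_half_l[of "u s" "u m" e "u s'"] d(2))
    qed (use r m in \<open>auto simp: field_simps\<close>)
  qed
  have "\<exists>I. \<forall>n. (a \<le> fst (I n) \<and> snd (I n) \<le> b \<and> fst (I n) < snd (I n)) \<and>
      (fst (I n) < fst (I (Suc n)) \<and> snd (I (Suc n)) < snd (I n) \<and>
       (\<forall>s\<in>{fst (I (Suc n))..snd (I (Suc n))}. \<forall>s'\<in>{fst (I (Suc n))..snd (I (Suc n))}. dist (u s) (u s') < inverse (real (Suc n))))"
  proof (rule dependent_nat_choice[where P="\<lambda>n I. a \<le> fst I \<and> snd I \<le> b \<and> fst I < snd I"
       and Q="\<lambda>n I I'. fst I < fst I' \<and> snd I' < snd I \<and> (\<forall>s\<in>{fst I'..snd I'}. \<forall>s'\<in>{fst I'..snd I'}. dist (u s) (u s') < inverse (real (Suc n)))"])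
    show "\<exists>I. a \<le> fst I \<and> snd I \<le> b \<and> fst I < snd I"
      using ab by (intro exI[of _ "(a, b)"]) simp
  next
    fix I :: "real \<times> real" and n :: nat
    assume I: "a \<le> fst I \<and> snd I \<le> b \<and> fst I < snd I"
    have "inverse (real (Suc n)) > 0" by simp
    from step[of I, OF _ _ _ this] I obtain I' where
      "fst I' < snd I'" "fst I < fst I'" "snd I' < snd I"
      "\<forall>s\<in>{fst I'..snd I'}. \<forall>s'\<in>{fst I'..snd I'}. dist (u s) (u s') < inverse (real (Suc n))"
      by blast
    with I show "\<exists>I'. (a \<le> fst I' \<and> snd I' \<le> b \<and> fst I' < snd I') \<and>
        fst I < fst I' \<and> snd I' < snd I \<and>
        (\<forall>s\<in>{fst I'..snd I'}. \<forall>s'\<in>{fst I'..snd I'}. dist (u s) (u s') < inverse (real (Suc n)))"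
      by (intro exI[of _ I']) auto
  qed
  then obtain I where I: "\<And>n. a \<le> fst (I n)" "\<And>n. snd (I n) \<le> b" "\<And>n. fst (I n) < snd (I n)"
     "\<And>n. fst (I n) < fst (I (Suc n))" "\<And>n. snd (I (Suc n)) < snd (I n)"
     "\<And>n. \<forall>s\<in>{fst (I (Suc n))..snd (I (Suc n))}. \<forall>s'\<in>{fst (I (Suc n))..snd (I (Suc n))}.
        dist (u s) (u s') < inverse (real (Suc n))" by blast
  have inc: "incseq (\<lambda>n. fst (I n))" and dec: "decseq (\<lambda>n. snd (I n))"
    using I(4,5) by (auto intro!: incseq_SucI decseq_SucI less_imp_le)
  have le: "fst (I n) \<le> snd (I m)" for n m
    using incseqD[OF inc, of n "max n m"] decseqD[OF dec, of m "max n m"] I(3)[of "max n m"] by simp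
  define c where "c = (SUP n. fst (I n))"
  have bdd: "bdd_above (range (\<lambda>n. fst (I n)))" using le[of _ 0] by (auto intro!: bdd_aboveI2)
  have c: "fst (I n) \<le> c" "c \<le> snd (I n)" for n
    unfolding c_def using le by (auto intro!: cSUP_upper bdd cSUP_least)
  \<comment> \<open>Strict nesting places \<open>c\<close> in the interior of every interval, hence
    small oscillation on them is continuity at \<open>c\<close>.\<close>
  have c': "fst (I n) < c" "c < snd (I n)" for n
    using c[of "Suc n"] I(4,5)[of n] by auto
  have "isCont u c"
    unfolding isCont_def
  proof (rule tendstoI)
    fix e :: real assume "e > 0"
    then obtain n where n: "inverse (real (Suc n)) < e" using reals_Archimedean by blast
    have "\<forall>\<^sub>F s in nhds c. s \<in> {fst (I (Suc n))<..<snd (I (Suc n))}"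
      using c'[of "Suc n"] by (intro eventually_nhds_in_open) auto
    then have "\<forall>\<^sub>F s in at c. s \<in> {fst (I (Suc n))<..<snd (I (Suc n))}"
      by (auto simp: eventually_at_filter elim: eventually_mono)
    then show "\<forall>\<^sub>F s in at c. dist (u s) (u c) < e"
    proof eventually_elim
      case (elim s)
      then have "s \<in> {fst (I (Suc n))..snd (I (Suc n))}" by simp
      moreover have "c \<in> {fst (I (Suc n))..snd (I (Suc n))}" using c[of "Suc n"] by simp
      ultimately have "dist (u s) (u c) < inverse (real (Suc n))" using I(6)[of n] by blast
      then show ?case using n by linarith
    qed
  qed
  moreover have "a < c" "c < b" using c'[of 0] I(1)[of 0] I(2)[of 0] by auto
  ultimately show ?thesis by blast
qed

text \<open>For every slope \<open>e\<close> > 0 the set where the increment stays below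
  \<open>e * (s - a)\<close> is closed. If it missed \<open>b\<close>, its largest element could
  still be moved to the right by the derivative condition.\<close>

lemma right_derivative_zero_imp_constant:
  fixes G :: "real \<Rightarrow> 'a::real_normed_vector"
  assumes ab: "a \<le> b" and cont: "continuous_on {a..b} G"
    and der: "\<And>s. a \<le> s \<Longrightarrow> s < b \<Longrightarrow> ((\<lambda>h. (G (s + h) - G s) /\<^sub>R h) \<longlongrightarrow> 0) (at_right 0)"
  shows "G b = G a"
proof -
  have *: "norm (G b - G a) \<le> e * (b - a)" if e: "e > 0" for e
  proof (rule ccontr)
    assume nb: "\<not> norm (G b - G a) \<le> e * (b - a)"
    define C where "C = {s\<in>{a..b}. norm (G s - G a) \<le> e * (s - a)}"
    have "closed C" unfolding C_def
      by (intro continuous_on_closed_Collect_le continuous_intros cont)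
    then have "compact C" unfolding C_def
      by (simp add: compact_eq_bounded_closed bounded_subset[OF bounded_closed_interval[of a b]] subset_iff)
    moreover have aC: "a \<in> C" using ab by (simp add: C_def)
    ultimately obtain m where m: "m \<in> C" "\<And>s. s \<in> C \<Longrightarrow> s \<le> m"
      using compact_attains_sup[of C] by blast
    have mb: "m < b" using m(1) nb by (auto simp: C_def less_le)
    have "\<forall>\<^sub>F h in at_right 0. norm ((G (m + h) - G m) /\<^sub>R h) < e"
      using der[of m] mb m(1) e by (auto simp: tendsto_iff C_def dest!: spec[of _ e])
    moreover have "\<forall>\<^sub>F h in at_right 0. 0 < h \<and> h < b - m" using mb by (intro eventually_at_right_less) simp
    ultimately have "\<forall>\<^sub>F h in at_right 0. m + h \<in> C \<and> 0 < h"
    proof eventually_elim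
      case (elim h)
      have "norm ((G (m + h) - G m) /\<^sub>R h) = norm (G (m + h) - G m) / h"
        using elim unfolding norm_scaleR by (simp add: divide_inverse)
      then have "norm (G (m + h) - G m) < e * h" using elim by (simp add: pos_divide_less_eq)
      moreover have "norm (G (m + h) - G a) \<le> norm (G (m + h) - G m) + norm (G m - G a)"
        using norm_triangle_ineq[of "G (m + h) - G m" "G m - G a"] by simp
      ultimately show ?case using elim m(1) by (auto simp: C_def algebra_simps)
    qed
    then obtain h where "m + h \<in> C" "0 < h" using eventually_happens trivial_limit_at_right_real by blast
    then show False using m(2)[of "m + h"] by simp
  qed
  have "norm (G b - G a) \<le> 0"
  proof (rule field_le_epsilon)
    fix e :: real assume "e > 0"
    have "norm (G b - G a) \<le> e / (b - a + 1) * (b - a)" using \<open>e > 0\<close> ab by (intro *) auto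
    also have "\<dots> \<le> e" using ab \<open>e > 0\<close> by (simp add: field_simps)
    finally show "norm (G b - G a) \<le> 0 + e" by simp
  qed
  then show ?thesis by simp
qed

section \<open>Orbits of an abstract C0-semigroup\<close>

context
  fixes X :: "'a::real_normed_vector set" and S :: "real \<Rightarrow> 'a \<Rightarrow> 'a"
  assumes S: "C0_semigroup_on X S"
begin

lemma semigroup_in: "t \<ge> 0 \<Longrightarrow> x \<in> X \<Longrightarrow> S t x \<in> X"
  using S unfolding C0_semigroup_on_def by blast

lemma semigroup_diff: "t \<ge> 0 \<Longrightarrow> x \<in> X \<Longrightarrow> y \<in> X \<Longrightarrow> S t (x - y) = S t x - S t y"
proof -
  assume "t \<ge> 0" "x \<in> X" "y \<in> X"
  then have "S t (1 *\<^sub>R x + (-1) *\<^sub>R y) = 1 *\<^sub>R S t x + (-1) *\<^sub>R S t y"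
    using S unfolding C0_semigroup_on_def by blast
  then show ?thesis by simp
qed

lemma semigroup_scaleR: "t \<ge> 0 \<Longrightarrow> x \<in> X \<Longrightarrow> S t (c *\<^sub>R x) = c *\<^sub>R S t x"
proof -
  assume "t \<ge> 0" "x \<in> X"
  then have "S t (c *\<^sub>R x + 0 *\<^sub>R x) = c *\<^sub>R S t x + 0 *\<^sub>R S t x"
    using S unfolding C0_semigroup_on_def by blast
  then show ?thesis by simp
qed

lemma semigroup_bound: "t \<ge> 0 \<Longrightarrow> \<exists>K. \<forall>x\<in>X. norm (S t x) \<le> K * norm x"
  using S unfolding C0_semigroup_on_def by blast

lemma semigroup_add: "t \<ge> 0 \<Longrightarrow> s \<ge> 0 \<Longrightarrow> x \<in> X \<Longrightarrow> S (t + s) x = S t (S s x)"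
  using S unfolding C0_semigroup_on_def by blast

lemma semigroup_zero: "x \<in> X \<Longrightarrow> S 0 x = x"
  using S unfolding C0_semigroup_on_def by blast

lemma semigroup_right_continuous:
  assumes "t \<ge> 0" "x \<in> X"
  shows "((\<lambda>t. S t x) \<longlongrightarrow> S t x) (at_right t)"
proof -
  have "((\<lambda>h. S h (S t x)) \<longlongrightarrow> S t x) (at_right 0)"
    using S semigroup_in[OF assms] unfolding C0_semigroup_on_def by blast
  moreover have "\<forall>\<^sub>F h in at_right 0. S h (S t x) = S (h + t) x"
    using eventually_at_right_less[of 1] by (auto elim!: eventually_mono simp: semigroup_add assms)
  ultimately have "((\<lambda>h. S (h + t) x) \<longlongrightarrow> S t x) (at_right 0)"
    using tendsto_cong by fastforce
  then show ?thesis by (subst at_right_to_0) (simp add: filterlim_filtermap)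
qed

text \<open>Left continuity without the uniform boundedness principle: the orbit has a continuity point
  \<open>c < s\<close>, and the single bounded operator \<open>S (s - c)\<close> carries continuity from \<open>c\<close> to \<open>s\<close>.\<close>

lemma semigroup_continuous:
  assumes X: "subspace X" and x: "x \<in> X"
  shows "continuous_on {0..} (\<lambda>t. S t x)"
  unfolding continuous_on_def
proof
  fix s :: real assume "s \<in> {0..}"
  show "((\<lambda>t. S t x) \<longlongrightarrow> S s x) (at s within {0..})"
  proof (cases "s = 0")
    case True
    then show ?thesis using semigroup_right_continuous[of 0 x] x
      by (simp add: at_within_Ici_at_right)
  next
    case False
    then have s: "s > 0" using \<open>s \<in> {0..}\<close> by simp
    obtain c where c: "0 < c" "c < s" "isCont (\<lambda>t. S t x) c"
      using right_continuous_imp_continuity_point[of 0 s "\<lambda>t. S t x"] semigroup_right_continuous x s by auto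
    obtain K where K: "\<And>y. y \<in> X \<Longrightarrow> norm (S (s - c) y) \<le> K * norm y"
      using semigroup_bound[of "s - c"] c by auto
    have "((\<lambda>t. t - (s - c)) \<longlongrightarrow> s - (s - c)) (at s)" by (intro tendsto_intros)
    then have "((\<lambda>t. S (t - (s - c)) x) \<longlongrightarrow> S c x) (at s)"
      using isCont_tendsto_compose[OF c(3), of "\<lambda>t. t - (s - c)" "at s"] by simp
    then have "((\<lambda>t. S (t - (s - c)) x - S c x) \<longlongrightarrow> 0) (at s)" by (simp add: LIM_zero_iff)
    then have lim: "((\<lambda>t. K * norm (S (t - (s - c)) x - S c x)) \<longlongrightarrow> 0) (at s)"
      by (intro tendsto_mult_right_zero tendsto_norm_zero)
    have "\<forall>\<^sub>F t in nhds s. t \<in> {s-c<..}"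
      using c by (intro eventually_nhds_in_open) auto
    then have "\<forall>\<^sub>F t in at s. t \<in> {s-c<..}"
      by (auto simp: eventually_at_filter elim: eventually_mono)
    then have "\<forall>\<^sub>F t in at s. norm (S t x - S s x) \<le> K * norm (S (t - (s - c)) x - S c x)"
    proof eventually_elim
      case (elim t)
      then have "S t x = S (s - c) (S (t - (s - c)) x)" "S s x = S (s - c) (S c x)"
        using c x by (subst semigroup_add[symmetric]; simp)+
      then have "S t x - S s x = S (s - c) (S (t - (s - c)) x - S c x)"
        using c x elim by (simp add: semigroup_diff semigroup_in)
      then show ?case using c x elim
        by (auto intro!: K subspace_diff[OF X] semigroup_in)
    qed
    then have "((\<lambda>t. S t x - S s x) \<longlongrightarrow> 0) (at s)"
      by (rule Lim_null_comparison[OF _ lim])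
    then have "((\<lambda>t. S t x) \<longlongrightarrow> S s x) (at s)" by (simp add: LIM_zero_iff)
    then show ?thesis by (rule filterlim_mono) (auto simp: at_within_le_at)
  qed
qed

end

lemma generates_semigroup: "generates X D A S \<Longrightarrow> C0_semigroup_on X S"
  by (simp add: generates_def)

text \<open>\<open>S h\<close> and \<open>S t\<close> commute, so the difference quotient of
  \<open>S t x\<close> is \<open>S t\<close> applied to the one of \<open>x\<close>, and the bounded
  operator \<open>S t\<close> can be taken through the limit.\<close>

lemma generates_invariant:
  assumes X: "subspace X" and g: "generates X D A S" and x: "x \<in> D" and t: "t \<ge> 0"
  shows "S t x \<in> D"
proof -
  note C0 = generates_semigroup[OF g]
  have xX: "x \<in> X" using g x by (auto simp: generates_def)
  obtain y where y: "y \<in> X" "((\<lambda>h. (S h x - x) /\<^sub>R h) \<longlongrightarrow> y) (at_right 0)"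
    using g x by (auto simp: generates_def)
  obtain K where K: "\<And>y. y \<in> X \<Longrightarrow> norm (S t y) \<le> K * norm y"
    using semigroup_bound[OF C0 t] by auto
  have lim: "((\<lambda>h. K * norm ((S h x - x) /\<^sub>R h - y)) \<longlongrightarrow> 0) (at_right 0)"
    using y(2) by (intro tendsto_mult_right_zero tendsto_norm_zero) (simp add: LIM_zero_iff)
  have "\<forall>\<^sub>F h in at_right 0. norm ((S h (S t x) - S t x) /\<^sub>R h - S t y) \<le> K * norm ((S h x - x) /\<^sub>R h - y)"
    using eventually_at_right_less[of 1, OF zero_less_one]
  proof eventually_elim
    case (elim h)
    have "S h (S t x) = S t (S h x)"
      using elim t xX semigroup_add[OF C0, of h t x] semigroup_add[OF C0, of t h x] by (simp add: add.commute)
    then have "(S h (S t x) - S t x) /\<^sub>R h - S t y = S t ((S h x - x) /\<^sub>R h - y)"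
      using elim t xX y(1)
      by (simp add: semigroup_diff[OF C0] semigroup_scaleR[OF C0] semigroup_in[OF C0] subspace_diff[OF X] subspace_scale[OF X])
    then show ?case using elim t xX y(1)
      by (auto intro!: K subspace_diff[OF X] subspace_scale[OF X] semigroup_in[OF C0])
  qed
  then have "((\<lambda>h. (S h (S t x) - S t x) /\<^sub>R h - S t y) \<longlongrightarrow> 0) (at_right 0)"
    by (rule Lim_null_comparison[OF _ lim])
  then have "((\<lambda>h. (S h (S t x) - S t x) /\<^sub>R h) \<longlongrightarrow> S t y) (at_right 0)" by (simp add: LIM_zero_iff)
  then show ?thesis using g semigroup_in[OF C0 t] xX y(1) by (auto simp: generates_def)
qed

text \<open>For \<open>y\<close> in the domain, s |-> \<open>T (t - s) (S s y)\<close> joins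
  \<open>T t y\<close> to \<open>S t y\<close> and has right derivative zero, because both
  semigroups have the same generator at \<open>S s y\<close>. Density then covers \<open>X\<close>.
  The locally uniform bound is asked of \<open>T\<close> alone, the operator whose time varies
  outside; in the application \<open>T\<close> is the explicit semigroup and \<open>S\<close> the
  chosen one.\<close>

theorem generator_determines_semigroup:
  assumes X: "subspace X" and gS: "generates X D A S" and gT: "generates X D A T"
    and Tb: "\<And>t. t \<ge> 0 \<Longrightarrow> \<exists>K. \<forall>s\<in>{0..t}. \<forall>x\<in>X. norm (T s x) \<le> K * norm x"
    and dense: "\<And>x e. x \<in> X \<Longrightarrow> e > 0 \<Longrightarrow> \<exists>y\<in>D. norm (x - y) < e"
    and t: "t \<ge> 0" and x: "x \<in> X"
  shows "S t x = T t x"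
proof -
  note S = generates_semigroup[OF gS] and T = generates_semigroup[OF gT]
  obtain K where "\<forall>s\<in>{0..t}. \<forall>x\<in>X. norm (T s x) \<le> K * norm x"
    using Tb[OF t] by blast
  then have K: "norm (T s x) \<le> K * norm x" if "0 \<le> s" "s \<le> t" "x \<in> X" for s x
    using that by simp
  have D: "S t y = T t y" if y: "y \<in> D" for y
  proof -
    have yX: "y \<in> X" using gS y by (auto simp: generates_def)
    define F where "F s = T (t - s) (S s y)" for s
    have "F t = F 0"
    proof (rule right_derivative_zero_imp_constant[OF t])
      show "continuous_on {0..t} F"
        unfolding continuous_on_def
      proof
        fix s assume s: "s \<in> {0..t}"
        define z where "z = S s y"
        have z: "z \<in> X" using s yX by (simp add: z_def semigroup_in[OF S])
        have "((\<lambda>r. S r y) \<longlongrightarrow> z) (at s within {0..t})"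
          using semigroup_continuous[OF S X yX] s unfolding z_def
          by (meson Icc_subset_Ici_iff continuous_on_def continuous_on_subset order_refl)
        then have "((\<lambda>r. S r y - z) \<longlongrightarrow> 0) (at s within {0..t})" by (simp add: LIM_zero_iff)
        then have lim: "((\<lambda>r. K * norm (S r y - z)) \<longlongrightarrow> 0) (at s within {0..t})"
          by (intro tendsto_mult_right_zero tendsto_norm_zero)
        have "\<forall>\<^sub>F r in at s within {0..t}. norm (T (t - r) (S r y - z)) \<le> K * norm (S r y - z)"
          using yX z by (auto simp: eventually_at_filter intro!: always_eventually K subspace_diff[OF X] semigroup_in[OF S])
        then have "((\<lambda>r. T (t - r) (S r y - z)) \<longlongrightarrow> 0) (at s within {0..t})"
          by (rule Lim_null_comparison[OF _ lim])
        moreover have "continuous_on {0..t} (\<lambda>r. T (t - r) z)"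
          by (rule continuous_on_compose2[OF semigroup_continuous[OF T X z]]) (auto intro!: continuous_intros)
        then have "((\<lambda>r. T (t - r) z) \<longlongrightarrow> T (t - s) z) (at s within {0..t})"
          using s by (auto simp: continuous_on_def)
        ultimately have "((\<lambda>r. T (t - r) (S r y - z) + T (t - r) z) \<longlongrightarrow> 0 + T (t - s) z) (at s within {0..t})"
          by (rule tendsto_add)
        moreover have "\<forall>\<^sub>F r in at s within {0..t}. T (t - r) (S r y - z) + T (t - r) z = F r"
          using yX z by (auto simp: eventually_at_filter F_def semigroup_diff[OF T] semigroup_in[OF S] intro!: always_eventually)
        ultimately have "(F \<longlongrightarrow> 0 + T (t - s) z) (at s within {0..t})"
          using tendsto_cong by fastforce
        then show "(F \<longlongrightarrow> F s) (at s within {0..t})" by (simp add: F_def z_def)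
      qed
    next
      fix s assume s: "0 \<le> s" "s < t"
      define z where "z = S s y"
      have zD: "z \<in> D" unfolding z_def by (rule generates_invariant[OF X gS y s(1)])
      have z: "z \<in> X" using zD gS by (auto simp: generates_def)
      have "((\<lambda>h. (S h z - z) /\<^sub>R h - (T h z - z) /\<^sub>R h) \<longlongrightarrow> A z - A z) (at_right 0)"
        using gS gT zD by (intro tendsto_diff) (auto simp: generates_def)
      then have lim: "((\<lambda>h. K * norm ((S h z - z) /\<^sub>R h - (T h z - z) /\<^sub>R h)) \<longlongrightarrow> 0) (at_right 0)"
        by (intro tendsto_mult_right_zero tendsto_norm_zero) simp
      \<comment> \<open>Splitting \<open>T (t - s)\<close> as \<open>T (t - s - h)\<close> after
        \<open>T h\<close> gives both terms of the increment the common outer factor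
        \<open>T (t - s - h)\<close>, which \<open>K\<close> bounds for every h.\<close>
      have "\<forall>\<^sub>F h in at_right 0. norm ((F (s + h) - F s) /\<^sub>R h) \<le> K * norm ((S h z - z) /\<^sub>R h - (T h z - z) /\<^sub>R h)"
      proof (rule eventually_mono[OF eventually_at_right_less[of "t - s"]])
        show "t - s > 0" using s by simp
        fix h assume h: "0 < h \<and> h < t - s"
        have 1: "S (s + h) y = S h z" using h s yX semigroup_add[OF S, of h s y] by (simp add: z_def add.commute)
        have 2: "T (t - s) z = T (t - s - h) (T h z)" using h z semigroup_add[OF T, of "t - s - h" h z] by simp
        have "(F (s + h) - F s) /\<^sub>R h = T (t - s - h) ((S h z - T h z) /\<^sub>R h)"
          using h z unfolding F_def 1 z_def[symmetric] 2
          by (simp add: semigroup_diff[OF T] semigroup_scaleR[OF T] semigroup_in[OF T] semigroup_in[OF S] subspace_diff[OF X] diff_diff_add)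
        moreover have "(S h z - T h z) /\<^sub>R h = (S h z - z) /\<^sub>R h - (T h z - z) /\<^sub>R h"
          by (simp add: scaleR_diff_right)
        moreover have "(S h z - T h z) /\<^sub>R h \<in> X"
          using h z by (intro subspace_scale[OF X] subspace_diff[OF X] semigroup_in[OF S] semigroup_in[OF T]) auto
        ultimately show "norm ((F (s + h) - F s) /\<^sub>R h) \<le> K * norm ((S h z - z) /\<^sub>R h - (T h z - z) /\<^sub>R h)"
          using K[of "t - s - h" "(S h z - T h z) /\<^sub>R h"] h s by simp
      qed
      then show "((\<lambda>h. (F (s + h) - F s) /\<^sub>R h) \<longlongrightarrow> 0) (at_right 0)"
        by (rule Lim_null_comparison[OF _ lim])
    qed
    then show ?thesis using yX t by (simp add: F_def semigroup_zero[OF S] semigroup_zero[OF T] semigroup_in[OF S])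
  qed
  obtain L where L: "\<And>y. y \<in> X \<Longrightarrow> norm (S t y) \<le> L * norm y"
    using semigroup_bound[OF S t] by auto
  have "norm (S t x - T t x) \<le> 0"
  proof (rule field_le_epsilon)
    fix e :: real assume e: "e > 0"
    have M: "\<bar>L\<bar> + \<bar>K\<bar> + 1 > 0" by linarith
    then obtain y where y: "y \<in> D" "norm (x - y) < e / (\<bar>L\<bar> + \<bar>K\<bar> + 1)"
      using dense[OF x, of "e / (\<bar>L\<bar> + \<bar>K\<bar> + 1)"] e by auto
    have yX: "y \<in> X" using gS y by (auto simp: generates_def)
    have xy: "x - y \<in> X" using x yX by (rule subspace_diff[OF X])
    have eq: "S t x - T t x = S t (x - y) - T t (x - y)"
      using D[OF y(1)] x yX t by (simp add: semigroup_diff[OF S] semigroup_diff[OF T])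
    have "norm (S t x - T t x) \<le> L * norm (x - y) + K * norm (x - y)"
      unfolding eq using L[OF xy] K[OF t order_refl xy] norm_triangle_ineq4[of "S t (x - y)" "T t (x - y)"] by linarith
    also have "\<dots> \<le> (\<bar>L\<bar> + \<bar>K\<bar> + 1) * norm (x - y)"
      unfolding distrib_right[symmetric] by (intro mult_right_mono) auto
    also have "\<dots> \<le> e" using y(2) M by (simp add: field_simps less_imp_le)
    finally show "norm (S t x - T t x) \<le> 0 + e" by simp
  qed
  then show ?thesis by simp
qed

section \<open>Weak derivatives and primitives\<close>

text \<open>The bound on \<open>k\<close> makes \<open>B\<close> times the product of the norms of
  \<open>f\<close> and \<open>g\<close> a majorant. This form serves integration by parts, the
  Duhamel integral, the Gaussian kernel and convolutions alike.\<close>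

lemma Fubini_kernel:
  fixes f g :: "real \<Rightarrow> 'a::{real_normed_field, banach, second_countable_topology}"
  assumes f: "integrable lborel f" and g: "integrable lborel g"
    and k[measurable]: "case_prod k \<in> borel_measurable (lborel \<Otimes>\<^sub>M lborel)"
    and B: "\<And>s r. norm (k s r) \<le> B"
  shows "(\<integral>s. f s * (\<integral>r. g r * k s r \<partial>lborel) \<partial>lborel) = (\<integral>r. g r * (\<integral>s. f s * k s r \<partial>lborel) \<partial>lborel)"
    and "integrable lborel (\<lambda>s. f s * (\<integral>r. g r * k s r \<partial>lborel))"
proof -
  have [measurable]: "f \<in> borel_measurable lborel" "g \<in> borel_measurable lborel" using f g by auto
  have B': "norm (k s r) \<le> \<bar>B\<bar>" for s r using B[of s r] by linarith
  have ig: "integrable lborel (\<lambda>r. g r * k s r)" for s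
  proof (rule Bochner_Integration.integrable_bound)
    show "integrable lborel (\<lambda>r. B * norm (g r))" using g by simp
    show "AE r in lborel. norm (g r * k s r) \<le> norm (B * norm (g r))"
      using mult_left_mono[OF B' norm_ge_zero] by (intro AE_I2) (simp add: norm_mult abs_mult mult.commute)
  qed simp
  have int: "integrable (lborel \<Otimes>\<^sub>M lborel) (\<lambda>(s, r). f s * (g r * k s r))"
  proof (rule lborel_pair.Fubini_integrable)
    show "integrable lborel (\<lambda>s. \<integral>r. norm (case (s, r) of (s, r) \<Rightarrow> f s * (g r * k s r)) \<partial>lborel)"
    proof (rule Bochner_Integration.integrable_bound)
      show "integrable lborel (\<lambda>s. (B * (\<integral>r. norm (g r) \<partial>lborel)) * norm (f s))" using f by simp
      show "AE s in lborel. norm (\<integral>r. norm (case (s, r) of (s, r) \<Rightarrow> f s * (g r * k s r)) \<partial>lborel)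
          \<le> norm ((B * (\<integral>r. norm (g r) \<partial>lborel)) * norm (f s))"
      proof (rule AE_I2)
        fix s
        have "(\<integral>r. norm (g r * k s r) \<partial>lborel) \<le> (\<integral>r. B * norm (g r) \<partial>lborel)"
        proof (rule integral_mono)
          show "integrable lborel (\<lambda>r. norm (g r * k s r))" by (rule integrable_norm[OF ig])
          show "norm (g r * k s r) \<le> B * norm (g r)" for r
            using mult_left_mono[OF B[of s r] norm_ge_zero[of "g r"]] by (simp add: norm_mult mult.commute)
        qed (use g in simp)
        then have "norm (f s) * (\<integral>r. norm (g r * k s r) \<partial>lborel) \<le> norm (f s) * (B * (\<integral>r. norm (g r) \<partial>lborel))"
          by (intro mult_left_mono) auto
        then show "norm (\<integral>r. norm (case (s, r) of (s, r) \<Rightarrow> f s * (g r * k s r)) \<partial>lborel)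
          \<le> norm ((B * (\<integral>r. norm (g r) \<partial>lborel)) * norm (f s))"
          by (auto simp: norm_mult mult.assoc intro!: order_trans[OF _ abs_ge_self]) (simp add: ac_simps)
      qed
    qed simp
    show "AE s in lborel. integrable lborel (\<lambda>r. case (s, r) of (s, r) \<Rightarrow> f s * (g r * k s r))"
      using ig by simp
  qed simp
  have "(\<integral>s. f s * (\<integral>r. g r * k s r \<partial>lborel) \<partial>lborel) = (\<integral>s. \<integral>r. f s * (g r * k s r) \<partial>lborel \<partial>lborel)"
    by simp
  also have "\<dots> = (\<integral>r. \<integral>s. f s * (g r * k s r) \<partial>lborel \<partial>lborel)"
    using lborel_pair.Fubini_integral[OF int] by simp
  also have "\<dots> = (\<integral>r. \<integral>s. g r * (f s * k s r) \<partial>lborel \<partial>lborel)" by (simp add: mult.left_commute)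
  also have "\<dots> = (\<integral>r. g r * (\<integral>s. f s * k s r \<partial>lborel) \<partial>lborel)" by simp
  finally show "(\<integral>s. f s * (\<integral>r. g r * k s r \<partial>lborel) \<partial>lborel) = (\<integral>r. g r * (\<integral>s. f s * k s r \<partial>lborel) \<partial>lborel)" .
  show "integrable lborel (\<lambda>s. f s * (\<integral>r. g r * k s r \<partial>lborel))"
    using lborel_pair.integrable_fst[OF int] by simp
qed

text \<open>For b < a the value is 0 and not minus the reversed integral. The functions
  \<open>primitive\<close> and \<open>duhamel\<close> rely on this: they are constant beyond one
  endpoint.\<close>

definition itg :: "(real \<Rightarrow> real) \<Rightarrow> real \<Rightarrow> real \<Rightarrow> real" where
  "itg y a b = (\<integral>r. indicator {a..b} r * y r \<partial>lborel)"

lemma itg_split: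
  assumes y: "locally_L2 y" and "a \<le> b" "b \<le> c"
  shows "itg y a c = itg y a b + itg y b c"
proof -
  have "itg y a c = (\<integral>r. indicator {a..b} r * y r + indicator {b..c} r * y r \<partial>lborel)"
    unfolding itg_def
  proof (rule integral_cong_AE)
    show "AE r in lborel. indicator {a..c} r * y r = indicator {a..b} r * y r + indicator {b..c} r * y r"
      by (rule eventually_mono[OF AE_neq[of b]]) (use assms in \<open>auto simp: indicator_def\<close>)
  qed (use locally_L2_measurable[OF y] in simp_all)
  then show ?thesis unfolding itg_def by (simp add: locally_L2_integrable[OF y])
qed

lemma itg_empty: "b < a \<Longrightarrow> itg y a b = 0"
  by (simp add: itg_def)

lemma itg_same: "itg y a a = 0"
proof -
  have "AE r in lborel. indicator {a..a} r * y r = 0"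
    using AE_neq[of a] by (rule eventually_mono) auto
  then show ?thesis unfolding itg_def by (rule integral_eq_zero_AE)
qed

lemma itg_cong_AE:
  assumes "y \<in> borel_measurable borel" "z \<in> borel_measurable borel"
    "AE r in lborel. r \<in> {a..b} \<longrightarrow> y r = z r"
  shows "itg y a b = itg z a b"
  unfolding itg_def
  by (rule integral_cong_AE) (use assms in \<open>auto elim!: eventually_mono simp: indicator_def\<close>)

lemma itg_translate: "itg (\<lambda>r. y (h + r)) a b = itg y (h + a) (h + b)"
proof -
  have "itg (\<lambda>r. y (h + r)) a b = (\<integral>r. indicator {h+a..h+b} (h + r) * y (h + r) \<partial>lborel)"
    unfolding itg_def by (auto intro!: Bochner_Integration.integral_cong simp: indicator_def)
  also have "\<dots> = itg y (h + a) (h + b)"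
    unfolding itg_def by (rule integral_translate[of "\<lambda>r. indicator {h+a..h+b} r * y r"])
  finally show ?thesis .
qed

lemma itg_diff: "locally_L2 y \<Longrightarrow> locally_L2 z \<Longrightarrow> itg (\<lambda>r. y r - z r) a b = itg y a b - itg z a b"
  unfolding itg_def by (simp add: right_diff_distrib locally_L2_integrable)

lemma itg_scale: "itg (\<lambda>r. c * y r) a b = c * itg y a b"
  unfolding itg_def by (simp add: mult.left_commute)

lemma itg_bound:
  assumes y: "square_integrable y" and ab: "a \<le> b"
  shows "\<bar>itg y a b\<bar> \<le> sqrt (b - a) * norm (abs_l2 y)"
proof -
  have i: "square_integrable (indicator {a..b} :: real \<Rightarrow> real)"
    using square_integrable_indicator_Icc[of 1 a b] by simp
  have "(norm (abs_l2 (indicator {a..b} :: real \<Rightarrow> real)))\<^sup>2 = (\<integral>r. indicator {a..b} r \<partial>lborel)"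
    unfolding norm_abs_l2_sq[OF i]
    by (auto intro!: Bochner_Integration.integral_cong simp: indicator_def)
  then have "(norm (abs_l2 (indicator {a..b} :: real \<Rightarrow> real)))\<^sup>2 = b - a" using ab by simp
  then have n: "sqrt (b - a) = norm (abs_l2 (indicator {a..b} :: real \<Rightarrow> real))"
    by (rule real_sqrt_unique) simp
  have "\<bar>itg y a b\<bar> = \<bar>inner (abs_l2 (indicator {a..b})) (abs_l2 y)\<bar>"
    by (simp add: inner_abs_l2[OF i y] itg_def)
  also have "\<dots> \<le> sqrt (b - a) * norm (abs_l2 y)" unfolding n by (rule Cauchy_Schwarz_ineq2)
  finally show ?thesis .
qed

lemma itg_continuous_FTC:
  assumes "a \<le> b" "\<And>x. a \<le> x \<Longrightarrow> x \<le> b \<Longrightarrow> (F has_real_derivative y x) (at x within {a..b})"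
    "continuous_on {a..b} y"
  shows "itg y a b = F b - F a"
  using integral_FTC_atLeastAtMost[of a b F y] assms
  by (simp add: itg_def has_real_derivative_iff_has_vector_derivative)

text \<open>The antiderivative of \<open>\<psi>\<close> with value \<open>x\<close> at 0, continued
  by the constant \<open>x\<close> to the right of 0; it is the continuous representative of a W12
  function with boundary value \<open>x\<close>.\<close>

definition primitive :: "real \<Rightarrow> l2 \<Rightarrow> real \<Rightarrow> real" where
  "primitive x \<psi> s = x - itg (rep_l2 \<psi>) s 0"

lemma primitive_0 [simp]: "primitive x \<psi> 0 = x"
  by (simp add: primitive_def itg_same)

lemma primitive_Hoelder:
  assumes "s \<le> s'" shows "\<bar>primitive x \<psi> s - primitive x \<psi> s'\<bar> \<le> sqrt (s' - s) * norm \<psi>"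
proof -
  consider "s' \<le> 0" | "s \<le> 0" "0 < s'" | "0 < s" by linarith
  then show ?thesis
  proof cases
    case 1
    then have "primitive x \<psi> s - primitive x \<psi> s' = - itg (rep_l2 \<psi>) s s'"
      using itg_split[of "rep_l2 \<psi>" s s' 0] assms by (simp add: primitive_def)
    then show ?thesis using itg_bound[of "rep_l2 \<psi>" s s'] assms by simp
  next
    case 2
    then have "primitive x \<psi> s - primitive x \<psi> s' = - itg (rep_l2 \<psi>) s 0"
      by (simp add: primitive_def itg_empty)
    then have "\<bar>primitive x \<psi> s - primitive x \<psi> s'\<bar> \<le> sqrt (0 - s) * norm \<psi>"
      using itg_bound[of "rep_l2 \<psi>" s 0] 2 by simp
    also have "\<dots> \<le> sqrt (s' - s) * norm \<psi>" using 2 by (intro mult_right_mono) auto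
    finally show ?thesis .
  next
    case 3
    then show ?thesis using assms by (simp add: primitive_def itg_empty)
  qed
qed

lemma primitive_continuous: "continuous_on UNIV (primitive x \<psi>)"
proof (rule continuous_at_imp_continuous_on, rule ballI)
  fix s
  have "((\<lambda>r. sqrt \<bar>r - s\<bar> * norm \<psi>) \<longlongrightarrow> sqrt \<bar>s - s\<bar> * norm \<psi>) (at s)" by (intro tendsto_intros)
  then have lim: "((\<lambda>r. sqrt \<bar>r - s\<bar> * norm \<psi>) \<longlongrightarrow> 0) (at s)" by simp
  have "norm (primitive x \<psi> r - primitive x \<psi> s) \<le> sqrt \<bar>r - s\<bar> * norm \<psi>" for r
    using primitive_Hoelder[of r s x \<psi>] primitive_Hoelder[of s r x \<psi>] by (cases "r \<le> s") (auto simp: abs_minus_commute)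
  then have "((\<lambda>r. primitive x \<psi> r - primitive x \<psi> s) \<longlongrightarrow> 0) (at s)"
    by (intro Lim_null_comparison[OF _ lim]) simp
  then show "isCont (primitive x \<psi>) s" by (simp add: isCont_def LIM_zero_iff)
qed

lemma locally_L2_primitive [simp]: "locally_L2 (primitive x \<psi>)"
  by (rule locally_L2_continuous[OF primitive_continuous])

section \<open>Test functions on (-\<open>\<tau>\<close>, 0)\<close>

lemma test_function_bounds:
  assumes "test_function \<tau> \<eta> \<eta>'"
  shows "continuous_on UNIV \<eta>" "continuous_on UNIV \<eta>'" "s \<notin> {-\<tau><..<0} \<Longrightarrow> \<eta> s = 0"
  using assms unfolding test_function_def
  by (auto intro!: DERIV_isCont continuous_at_imp_continuous_on)

text \<open>Fubini's theorem for the kernel that is 1 where s is at most r; differentiability of the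
  primitive does not enter. The constant \<open>x\<close> drops out because \<open>\<eta>'\<close>
  has integral zero.\<close>

lemma primitive_by_parts:
  assumes \<tau>: "\<tau> > 0" and t: "test_function \<tau> \<eta> \<eta>'"
  shows "itg (\<lambda>s. primitive x \<psi> s * \<eta>' s) (-\<tau>) 0 = - itg (\<lambda>s. rep_l2 \<psi> s * \<eta> s) (-\<tau>) 0"
proof -
  note tb = test_function_bounds[OF t]
  have der: "\<And>s. (\<eta> has_real_derivative \<eta>' s) (at s)" using t by (simp add: test_function_def)
  have FTC: "itg \<eta>' a b = \<eta> b - \<eta> a" if "a \<le> b" for a b
    using that by (intro itg_continuous_FTC continuous_on_subset[OF tb(2)] DERIV_subset[OF der]) auto
  have L: "locally_L2 \<eta>'" by (rule locally_L2_continuous[OF tb(2)])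
  define f where "f s = indicator {-\<tau>..0} s * \<eta>' s" for s
  define g where "g r = indicator {-\<tau>..0} r * rep_l2 \<psi> r" for r
  define k :: "real \<Rightarrow> real \<Rightarrow> real" where "k s r = (if s \<le> r then 1 else 0)" for s r
  have f: "integrable lborel f" and g: "integrable lborel g"
    unfolding f_def g_def by (intro locally_L2_integrable L locally_L2_rep)+
  have k: "case_prod k \<in> borel_measurable (lborel \<Otimes>\<^sub>M lborel)" unfolding k_def by measurable
  have kb: "norm (k s r) \<le> 1" for s r by (simp add: k_def)
  have 1: "f s * primitive x \<psi> s = x * f s - f s * (\<integral>r. g r * k s r \<partial>lborel)" for s
  proof (cases "s \<in> {-\<tau>..0}")
    case True
    then have "itg (rep_l2 \<psi>) s 0 = (\<integral>r. g r * k s r \<partial>lborel)"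
      unfolding itg_def g_def k_def
      by (auto intro!: Bochner_Integration.integral_cong simp: indicator_def)
    then show ?thesis by (simp add: primitive_def algebra_simps)
  qed (simp add: f_def)
  have 2: "g r * (\<integral>s. f s * k s r \<partial>lborel) = indicator {-\<tau>..0} r * (rep_l2 \<psi> r * \<eta> r)" for r
  proof (cases "r \<in> {-\<tau>..0}")
    case True
    then have "(\<integral>s. f s * k s r \<partial>lborel) = itg \<eta>' (-\<tau>) r"
      unfolding itg_def f_def k_def
      by (auto intro!: Bochner_Integration.integral_cong simp: indicator_def)
    also have "\<dots> = \<eta> r" using True FTC[of "-\<tau>" r] tb(3)[of "-\<tau>"] by simp
    finally show ?thesis by (simp add: g_def)
  qed (simp add: g_def)
  have "itg (\<lambda>s. primitive x \<psi> s * \<eta>' s) (-\<tau>) 0 = (\<integral>s. f s * primitive x \<psi> s \<partial>lborel)"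
    unfolding itg_def f_def by (simp add: ac_simps)
  also have "\<dots> = (\<integral>s. x * f s - f s * (\<integral>r. g r * k s r \<partial>lborel) \<partial>lborel)" by (simp only: 1)
  also have "\<dots> = x * (\<integral>s. f s \<partial>lborel) - (\<integral>s. f s * (\<integral>r. g r * k s r \<partial>lborel) \<partial>lborel)"
    using f Fubini_kernel(2)[OF f g k kb] by simp
  also have "(\<integral>s. f s \<partial>lborel) = 0"
    using FTC[of "-\<tau>" 0] \<tau> tb(3)[of 0] tb(3)[of "-\<tau>"] by (simp add: itg_def f_def)
  also have "(\<integral>s. f s * (\<integral>r. g r * k s r \<partial>lborel) \<partial>lborel) = itg (\<lambda>s. rep_l2 \<psi> s * \<eta> s) (-\<tau>) 0"
    unfolding Fubini_kernel(1)[OF f g k kb] 2 itg_def ..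
  finally show ?thesis by simp
qed

text \<open>Squaring removes the kink of the positive part at 0; this makes \<open>bump\<close>
  continuously differentiable.\<close>

lemma has_real_derivative_pos_part_sq:
  "((\<lambda>u. (max 0 u)\<^sup>2) has_real_derivative 2 * max 0 u) (at (u::real))"
proof -
  consider "u > 0" | "u < 0" | "u = 0" by linarith
  then show ?thesis
  proof cases
    case 1
    have "((\<lambda>u. u\<^sup>2) has_real_derivative 2 * max 0 u) (at u)"
      using 1 by (auto intro!: derivative_eq_intros)
    then show ?thesis
      by (rule has_field_derivative_transform_within_open[of _ _ _ "{0<..}"]) (use 1 in auto)
  next
    case 2
    have "((\<lambda>u. 0) has_real_derivative 2 * max 0 u) (at u)"
      using 2 by (auto intro!: derivative_eq_intros)
    then show ?thesis
      by (rule has_field_derivative_transform_within_open[of _ _ _ "{..<0}"]) (use 2 in auto)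
  next
    case 3
    have "norm ((max 0 h)\<^sup>2 / h) \<le> \<bar>h\<bar>" for h :: real
      by (cases "h > 0") (simp_all add: power2_eq_square)
    then have "((\<lambda>h. (max 0 h)\<^sup>2 / h) \<longlongrightarrow> 0) (at (0::real))"
      by (intro Lim_null_comparison[OF always_eventually tendsto_rabs_zero[OF tendsto_ident_at]]) blast
    then show ?thesis using 3 by (simp add: DERIV_def)
  qed
qed

text \<open>A \<open>C\<^sup>1\<close> function that increases to the indicator function of \<open>(a, b)\<close> as \<open>n\<close> grows.\<close>

definition bump :: "real \<Rightarrow> real \<Rightarrow> real \<Rightarrow> real \<Rightarrow> real" where
  "bump n a b s = (let w = (max 0 ((s - a) * (b - s)))\<^sup>2 in n * w / (1 + n * w))"

lemma bump_bounds:
  assumes "n > 0" shows "0 \<le> bump n a b s" "bump n a b s \<le> 1" "s \<notin> {a..b} \<Longrightarrow> a < b \<Longrightarrow> bump n a b s = 0"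
    "a < s \<Longrightarrow> s < b \<Longrightarrow> bump n a b s > 0"
proof -
  define w where "w = (max 0 ((s - a) * (b - s)))\<^sup>2"
  have w: "w \<ge> 0" by (simp add: w_def)
  have b: "bump n a b s = n * w / (1 + n * w)" by (simp add: bump_def w_def Let_def)
  have nw: "n * w \<ge> 0" using assms w by simp
  show "0 \<le> bump n a b s" unfolding b using nw by simp
  show "bump n a b s \<le> 1" unfolding b using nw by (simp add: divide_le_eq)
  show "bump n a b s = 0" if "s \<notin> {a..b}" "a < b"
  proof -
    have "(s - a) * (b - s) \<le> 0" using that by (auto simp: mult_le_0_iff)
    then show ?thesis by (simp add: bump_def Let_def)
  qed
  show "bump n a b s > 0" if "a < s" "s < b"
  proof -
    have "w > 0" using that by (simp add: w_def)
    then show ?thesis unfolding b using assms by (simp add: add_pos_pos)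
  qed
qed

lemma test_function_bump:
  assumes n: "n > 0" and ab: "-\<tau> < a" "a < b" "b < 0"
  shows "\<exists>\<kappa>'. test_function \<tau> (bump n a b) \<kappa>'"
proof -
  define w where "w s = (max 0 ((s - a) * (b - s)))\<^sup>2" for s
  define w' where "w' s = 2 * max 0 ((s - a) * (b - s)) * (b - s - (s - a))" for s
  have w0: "w s \<ge> 0" for s by (simp add: w_def)
  have wd: "(w has_real_derivative w' s) (at s)" for s
    unfolding w_def[abs_def] w'_def
    by (rule DERIV_chain'[OF _ has_real_derivative_pos_part_sq]) (auto intro!: derivative_eq_intros)
  have nz: "1 + n * w s \<noteq> 0" for s using n w0[of s] by (smt (verit) mult_nonneg_nonneg)
  have b: "bump n a b = (\<lambda>s. n * w s / (1 + n * w s))" by (simp add: bump_def w_def fun_eq_iff Let_def)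
  define \<kappa>' where "\<kappa>' s = n * w' s / (1 + n * w s)\<^sup>2" for s
  have "(bump n a b has_real_derivative \<kappa>' s) (at s)" for s
    unfolding b \<kappa>'_def using nz[of s]
    by (auto intro!: derivative_eq_intros wd simp: field_simps power2_eq_square)
  moreover have "continuous_on UNIV w" unfolding w_def by (intro continuous_intros)
  then have "continuous_on UNIV \<kappa>'" unfolding \<kappa>'_def using nz
    by (auto intro!: continuous_intros simp: w'_def)
  ultimately have "test_function \<tau> (bump n a b) \<kappa>'"
    unfolding test_function_def using bump_bounds(3)[OF n] ab by (auto intro!: exI[of _ "{a..b}"])
  then show ?thesis by blast
qed

text \<open>The bumps are admissible test functions and tend to the indicator of (a, b) with values
  in [0, 1], so dominated convergence with majorant the modulus of \<open>\<zeta>\<close>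
  applies.\<close>

lemma itg_eq_0_of_test_functions:
  assumes \<zeta>: "locally_L2 \<zeta>"
    and z: "\<And>\<eta> \<eta>'. test_function \<tau> \<eta> \<eta>' \<Longrightarrow> itg (\<lambda>s. \<zeta> s * \<eta> s) (-\<tau>) 0 = 0"
    and ab: "-\<tau> < a" "a < b" "b < 0"
  shows "itg \<zeta> a b = 0"
proof -
  have [measurable]: "\<zeta> \<in> borel_measurable borel" by (rule locally_L2_measurable[OF \<zeta>])
  have "(\<lambda>n. itg (\<lambda>s. \<zeta> s * bump (real (Suc n)) a b s) (-\<tau>) 0) \<longlonglongrightarrow> itg \<zeta> a b"
    unfolding itg_def
  proof (rule integral_dominated_convergence[where w="\<lambda>s. \<bar>indicator {-\<tau>..0} s * \<zeta> s\<bar>"])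
    show "integrable lborel (\<lambda>s. \<bar>indicator {-\<tau>..0} s * \<zeta> s\<bar>)"
      by (intro integrable_abs locally_L2_integrable \<zeta>)
    show "AE s in lborel. (\<lambda>n. indicator {-\<tau>..0} s * (\<zeta> s * bump (real (Suc n)) a b s)) \<longlonglongrightarrow> indicator {a..b} s * \<zeta> s"
      using AE_neq[of a] AE_neq[of b]
    proof eventually_elim
      case (elim s)
      show ?case
      proof (cases "s \<in> {a<..<b}")
        case False
        then have "s \<notin> {a..b}" using elim by auto
        then show ?thesis using bump_bounds(3)[of _ s a b] ab by simp
      next
        case True
        define w where "w = (max 0 ((s - a) * (b - s)))\<^sup>2"
        have w: "w > 0" using True by (simp add: w_def)
        have lim: "(\<lambda>n. 1 / w * inverse (real (Suc n))) \<longlonglongrightarrow> 0"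
          by (intro tendsto_mult_right_zero LIMSEQ_inverse_real_of_nat)
        have bd: "norm (1 / (1 + real (Suc n) * w)) \<le> 1 / w * inverse (real (Suc n))" for n
        proof -
          have "real (Suc n) * w > 0" using w by simp
          then show ?thesis using frac_le[of 1 1 "real (Suc n) * w" "1 + real (Suc n) * w"]
            by (simp add: field_simps)
        qed
        have "((\<lambda>n. 1 / (1 + real (Suc n) * w)) \<longlonglongrightarrow> 0)"
          by (rule Lim_null_comparison[OF _ lim]) (intro always_eventually allI bd)
        then have "((\<lambda>n. 1 - 1 / (1 + real (Suc n) * w)) \<longlonglongrightarrow> 1 - 0)" by (intro tendsto_intros)
        moreover have "1 - 1 / (1 + real (Suc n) * w) = bump (real (Suc n)) a b s" for n
        proof -
          have "1 + real (Suc n) * w > 0" using w by (simp add: add_pos_pos)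
          moreover have "bump (real (Suc n)) a b s = real (Suc n) * w / (1 + real (Suc n) * w)"
            by (simp add: bump_def w_def Let_def)
          ultimately show ?thesis by (simp add: diff_divide_eq_iff)
        qed
        ultimately have "(\<lambda>n. bump (real (Suc n)) a b s) \<longlonglongrightarrow> 1" by simp
        then have "(\<lambda>n. indicator {-\<tau>..0} s * (\<zeta> s * bump (real (Suc n)) a b s)) \<longlonglongrightarrow> indicator {-\<tau>..0} s * (\<zeta> s * 1)"
          by (intro tendsto_intros)
        then show ?thesis using True ab by simp
      qed
    qed
    show "AE s in lborel. norm (indicator {-\<tau>..0} s * (\<zeta> s * bump (real (Suc n)) a b s)) \<le> \<bar>indicator {-\<tau>..0} s * \<zeta> s\<bar>" for n
      using bump_bounds(1,2)[of "real (Suc n)" a b] by (intro AE_I2) (auto simp: abs_mult indicator_def intro!: mult_right_le_one_le)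
    have "continuous_on UNIV (bump (real (Suc n)) a b)" for n
      using test_function_bump[of "real (Suc n)" \<tau> a b] ab test_function_bounds(1) by fastforce
    then have [measurable]: "bump (real (Suc n)) a b \<in> borel_measurable borel" for n
      by (rule borel_measurable_continuous_onI)
    show "(\<lambda>s. indicator {-\<tau>..0} s * (\<zeta> s * bump (real (Suc n)) a b s)) \<in> borel_measurable lborel" for n
      by measurable
  qed simp
  moreover have "itg (\<lambda>s. \<zeta> s * bump (real (Suc n)) a b s) (-\<tau>) 0 = 0" for n
    using test_function_bump[of "real (Suc n)" \<tau> a b] ab z by fastforce
  ultimately show ?thesis using LIMSEQ_unique[OF _ tendsto_const] by fastforce
qed

lemma average_eq_itg: "(\<integral>r. indicator {0..h} r * f (s + r) \<partial>lborel) = itg f s (s + h)"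
  using itg_translate[of f s 0 h] by (simp add: itg_def)

lemma itg_cong: "(\<And>r. a \<le> r \<Longrightarrow> r \<le> b \<Longrightarrow> y r = z r) \<Longrightarrow> itg y a b = itg z a b"
  unfolding itg_def by (rule Bochner_Integration.integral_cong) (auto simp: indicator_def)

lemma itg_eq_0: "(\<And>r. a \<le> r \<Longrightarrow> r \<le> b \<Longrightarrow> y r = 0) \<Longrightarrow> itg y a b = 0"
  using itg_cong[of a b y "\<lambda>_. 0"] by (simp add: itg_def)

text \<open>The averages of \<open>Z\<close> vanish and converge to \<open>Z\<close> in \<open>L\<^sub>2\<close>.\<close>

lemma eq_0_of_itg:
  assumes Z: "square_integrable Z" and z: "\<And>s h. h > 0 \<Longrightarrow> itg Z s (s + h) = 0"
  shows "AE s in lborel. Z s = 0"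
proof -
  have "norm (abs_l2 Z) < e" if e: "e > 0" for e
  proof -
    have "\<forall>\<^sub>F h in at_right 0. 0 < h \<and> norm (abs_l2 (\<lambda>s. 1/h * (\<integral>r. indicator {0..h} r * Z (s + r) \<partial>lborel) - Z s)) < e"
      using average_tendsto[OF Z e] eventually_at_right_less[of 1, OF zero_less_one]
      by eventually_elim auto
    then obtain h :: real where h: "h > 0" "norm (abs_l2 (\<lambda>s. 1/h * (\<integral>r. indicator {0..h} r * Z (s + r) \<partial>lborel) - Z s)) < e"
      using eventually_happens trivial_limit_at_right_real by blast
    have "abs_l2 (\<lambda>s. - Z s) = - abs_l2 Z"
      using abs_l2_scaleR[OF Z, of "-1"] by simp
    then show ?thesis using h(2) by (simp add: average_eq_itg z[OF h(1)])
  qed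
  then have "abs_l2 Z = 0" by (metis less_irrefl zero_less_norm_iff)
  then have "AE s in lborel. rep_l2 (0::l2) s = Z s" using rep_abs_l2[OF Z] by simp
  moreover have "AE s in lborel. rep_l2 (0::l2) s = 0"
    using rep_abs_l2[of "\<lambda>_. 0"] by (simp add: abs_l2_0 square_integrable_zero)
  ultimately show ?thesis by eventually_elim simp
qed

text \<open>Everything is reduced to integrals over intervals. Those compactly inside come from the
  bumps, those touching an endpoint by shrinking, and the remaining ones by clipping; then
  \<open>eq_0_of_itg\<close> applies.\<close>

lemma fundamental_lemma:
  assumes \<zeta>: "locally_L2 \<zeta>"
    and z: "\<And>\<eta> \<eta>'. test_function \<tau> \<eta> \<eta>' \<Longrightarrow> itg (\<lambda>s. \<zeta> s * \<eta> s) (-\<tau>) 0 = 0"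
  shows "AE s in lborel. s \<in> {-\<tau>..0} \<longrightarrow> \<zeta> s = 0"
proof -
  define Z where "Z s = indicator {-\<tau>..0} s * \<zeta> s" for s
  have Z: "square_integrable Z" unfolding Z_def by (rule locally_L2_cut[OF \<zeta>])
  have LZ: "locally_L2 Z" by (rule square_integrable_imp_locally_L2[OF Z])
  have sub: "itg Z a b = 0" if "-\<tau> < a" "a < b" "b < 0" for a b
  proof -
    have "itg Z a b = itg \<zeta> a b" unfolding itg_def Z_def
      using that by (auto intro!: Bochner_Integration.integral_cong simp: indicator_def)
    then show ?thesis using itg_eq_0_of_test_functions[OF \<zeta> z that] by simp
  qed
  \<comment> \<open>The middle part has integral zero by \<open>sub\<close>; each of the two end
    pieces has length \<open>d\<close> and contributes at most \<open>sqrt d\<close> times the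
    norm.\<close>
  have small: "\<bar>itg Z a b\<bar> \<le> 2 * sqrt d * norm (abs_l2 Z)"
    if ab: "-\<tau> \<le> a" "b \<le> 0" and d: "d > 0" "2 * d < b - a" for a b d
  proof -
    have "itg Z a b = itg Z a (a + d) + (itg Z (a + d) (b - d) + itg Z (b - d) b)"
      using d itg_split[OF LZ, of a "a + d" b] itg_split[OF LZ, of "a + d" "b - d" b] by simp
    also have "itg Z (a + d) (b - d) = 0" using ab d by (intro sub) auto
    finally show ?thesis
      using itg_bound[OF Z, of a "a + d"] itg_bound[OF Z, of "b - d" b] d by simp
  qed
  have main: "itg Z a b = 0" if ab: "-\<tau> \<le> a" "a < b" "b \<le> 0" for a b
  proof -
    have "((\<lambda>d. 2 * sqrt d * norm (abs_l2 Z)) \<longlongrightarrow> 2 * sqrt 0 * norm (abs_l2 Z)) (at_right 0)"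
      by (intro tendsto_intros)
    then have lim: "((\<lambda>d. 2 * sqrt d * norm (abs_l2 Z)) \<longlongrightarrow> 0) (at_right 0)" by simp
    have ev: "\<forall>\<^sub>F d in at_right 0. \<bar>itg Z a b\<bar> \<le> 2 * sqrt d * norm (abs_l2 Z)"
      using eventually_at_right_less[of "(b - a) / 2"] ab by (auto elim!: eventually_mono intro!: small)
    have "\<bar>itg Z a b\<bar> \<le> 0"
      by (rule tendsto_lowerbound[OF lim ev]) simp
    then show ?thesis by simp
  qed
  have "AE s in lborel. Z s = 0"
  proof (rule eq_0_of_itg[OF Z])
    fix s h :: real assume h: "h > 0"
    have "itg Z s (s + h) = itg Z (max s (-\<tau>)) (min (s + h) 0)"
      unfolding itg_def Z_def by (auto intro!: Bochner_Integration.integral_cong simp: indicator_def)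
    also have "\<dots> = 0"
    proof (cases "max s (-\<tau>)" "min (s + h) 0" rule: linorder_cases)
      case less then show ?thesis by (intro main) auto
    next
      case equal then show ?thesis by (simp add: itg_same)
    next
      case greater then show ?thesis by (rule itg_empty)
    qed
    finally show "itg Z s (s + h) = 0" .
  qed
  then show ?thesis by (rule eventually_mono) (auto simp: Z_def indicator_def split: if_splits)
qed

section \<open>The domain of \<open>op_A\<close> in terms of primitives\<close>

lemma has_weak_derivative_iff_itg:
  "has_weak_derivative \<tau> \<phi> \<psi> \<longleftrightarrow> (\<forall>\<eta> \<eta>'. test_function \<tau> \<eta> \<eta>' \<longrightarrow>
     itg (\<lambda>s. rep_l2 \<phi> s * \<eta>' s) (-\<tau>) 0 = - itg (\<lambda>s. rep_l2 \<psi> s * \<eta> s) (-\<tau>) 0)"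
  by (simp add: has_weak_derivative_def itg_def set_lebesgue_integral_def)

text \<open>The integral of \<open>\<kappa>\<close> from \<open>-\<tau>\<close> vanishes to the
  right of \<open>b\<close> precisely because the mean is zero, so it has compact support.\<close>

lemma test_function_of_mean_zero:
  assumes c: "continuous_on UNIV \<kappa>" and ab: "-\<tau> < a" "a < b" "b < 0"
    and supp: "\<And>s. s \<notin> {a..b} \<Longrightarrow> \<kappa> s = 0" and mean: "itg \<kappa> (-\<tau>) 0 = 0"
  shows "\<exists>\<eta>. test_function \<tau> \<eta> \<kappa>"
proof -
  have cI: "continuous_on {-\<tau>..s} \<kappa>" for s using c continuous_on_subset by blast
  have L: "locally_L2 \<kappa>" by (rule locally_L2_continuous[OF c])
  define \<eta> where "\<eta> s = itg \<kappa> (-\<tau>) s" for s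
  have eq: "itg \<kappa> (-\<tau>) s = integral {-\<tau>..s} \<kappa>" for s
    using set_borel_integral_eq_integral(2)[OF borel_integrable_atLeastAtMost'[OF cI]]
    by (simp add: itg_def set_lebesgue_integral_def)
  have z: "\<eta> s = 0" if "s \<notin> {a..b}" for s
  proof (cases "s < a")
    case True
    then show ?thesis unfolding \<eta>_def by (intro itg_eq_0 supp) auto
  next
    case False
    then have s: "s > b" using that by auto
    have tail: "itg \<kappa> u v = 0" if "u \<ge> s" for u v
      using that s by (intro itg_eq_0 supp) auto
    define m where "m = max s 0"
    have "itg \<kappa> (-\<tau>) m = itg \<kappa> (-\<tau>) s + itg \<kappa> s m"
      using s ab by (intro itg_split[OF L]) (auto simp: m_def)
    moreover have "itg \<kappa> (-\<tau>) m = itg \<kappa> (-\<tau>) 0 + itg \<kappa> 0 m"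
      using s ab by (intro itg_split[OF L]) (auto simp: m_def)
    moreover have "itg \<kappa> 0 m = 0" using ab by (intro itg_eq_0 supp) auto
    ultimately show ?thesis using mean tail[of s m] by (simp add: \<eta>_def)
  qed
  \<comment> \<open>Inside the interval this is the fundamental theorem of calculus; elsewhere both
    functions vanish near \<open>s\<close>.\<close>
  have "(\<eta> has_real_derivative \<kappa> s) (at s)" for s
  proof (cases "s \<in> {-\<tau><..<0}")
    case True
    have "((\<lambda>x. integral {-\<tau>..x} \<kappa>) has_real_derivative \<kappa> s) (at s within {-\<tau>..0})"
      by (rule integral_has_real_derivative[OF cI]) (use True in auto)
    then have "(\<eta> has_real_derivative \<kappa> s) (at s within {-\<tau>..0})"
      by (simp add: \<eta>_def[abs_def] eq)
    then show ?thesis using True at_within_interior[of s "{-\<tau>..0}"] by simp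
  next
    case False
    have "((\<lambda>_. 0) has_real_derivative \<kappa> s) (at s)" using supp[of s] False ab by auto
    then show ?thesis
      by (rule has_field_derivative_transform_within_open[of _ _ _ "- {a..b}"]) (use False ab z in auto)
  qed
  then have "test_function \<tau> \<eta> \<kappa>"
    unfolding test_function_def using c z ab by (auto intro!: exI[of _ "{a..b}"])
  then show ?thesis by blast
qed

lemma compact_subset_interval:
  assumes "compact K" "K \<subseteq> {u<..<v::real}" "u < v"
  shows "\<exists>a b. u < a \<and> a < b \<and> b < v \<and> K \<subseteq> {a..b}"
proof (cases "K = {}")
  case True
  then show ?thesis using assms by (intro exI[of _ "u + (v - u)/3"] exI[of _ "u + (v - u)/2"]) (auto simp: field_simps)
next
  case False
  obtain m where m: "m \<in> K" "\<And>x. x \<in> K \<Longrightarrow> m \<le> x" using compact_attains_inf[OF assms(1) False] by blast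
  obtain M where M: "M \<in> K" "\<And>x. x \<in> K \<Longrightarrow> x \<le> M" using compact_attains_sup[OF assms(1) False] by blast
  have "u < m" "M < v" "m \<le> M" using m M assms(2) by auto
  then show ?thesis using m M
    by (intro exI[of _ "(u + m)/2"] exI[of _ "(v + M)/2"]) (force simp: field_simps)
qed

text \<open>The du Bois-Reymond lemma. The difference \<open>\<zeta>\<close> of
  \<open>\<phi>\<close> and a primitive annihilates all derivatives of test functions. Every test
  function minus a multiple of the fixed bump \<open>\<kappa>0\<close> is such a derivative, so
  \<open>\<zeta>\<close> acts on test functions like a constant.\<close>

lemma weak_derivative_imp_primitive:
  assumes \<tau>: "\<tau> > 0" and w: "has_weak_derivative \<tau> \<phi> \<psi>"
  shows "\<exists>k. AE s in lborel. s \<in> {-\<tau>..0} \<longrightarrow> rep_l2 \<phi> s = primitive k \<psi> s"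
proof -
  define \<zeta> where "\<zeta> s = rep_l2 \<phi> s - primitive 0 \<psi> s" for s
  have \<zeta>: "locally_L2 \<zeta>" unfolding \<zeta>_def by (intro locally_L2_diff) auto
  have int: "integrable lborel (\<lambda>s. indicator {-\<tau>..0} s * (\<xi> s * \<kappa> s))"
    if "locally_L2 \<xi>" "continuous_on UNIV \<kappa>" for \<xi> \<kappa> :: "real \<Rightarrow> real"
    using square_integrable_mult[OF locally_L2_cut[OF that(1), of "-\<tau>" 0] locally_L2_cut[OF locally_L2_continuous[OF that(2)], of "-\<tau>" 0]]
    by (rule back_subst[of "integrable lborel"]) (auto simp: indicator_def fun_eq_iff)
  have z: "itg (\<lambda>s. \<zeta> s * \<eta>' s) (-\<tau>) 0 = 0" if t: "test_function \<tau> \<eta> \<eta>'" for \<eta> \<eta>'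
  proof -
    have "itg (\<lambda>s. \<zeta> s * \<eta>' s) (-\<tau>) 0 = itg (\<lambda>s. rep_l2 \<phi> s * \<eta>' s) (-\<tau>) 0 - itg (\<lambda>s. primitive 0 \<psi> s * \<eta>' s) (-\<tau>) 0"
      unfolding itg_def \<zeta>_def left_diff_distrib right_diff_distrib
      by (intro Bochner_Integration.integral_diff int test_function_bounds(2)[OF t]) auto
    then show ?thesis using w t primitive_by_parts[OF \<tau> t, of 0 \<psi>]
      by (simp add: has_weak_derivative_iff_itg)
  qed
  \<comment> \<open>The middle third of the interval carries the reference bump; all that matters is
    that its integral is nonzero.\<close>
  define a0 b0 where "a0 = -2 * \<tau> / 3" and "b0 = - \<tau> / 3"
  have ab0: "-\<tau> < a0" "a0 < b0" "b0 < 0" using \<tau> by (auto simp: a0_def b0_def)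
  define \<kappa>0 where "\<kappa>0 = bump 1 a0 b0"
  obtain \<kappa>0' where t0: "test_function \<tau> \<kappa>0 \<kappa>0'"
    using test_function_bump[of 1, OF _ ab0] unfolding \<kappa>0_def by auto
  have c0: "continuous_on UNIV \<kappa>0" by (rule test_function_bounds(1)[OF t0])
  have int1: "integrable lborel (\<lambda>s. indicator {-\<tau>..0} s * \<kappa> s)" if "continuous_on UNIV \<kappa>" for \<kappa> :: "real \<Rightarrow> real"
    by (rule locally_L2_integrable[OF locally_L2_continuous[OF that]])
  have nn: "\<kappa>0 s \<ge> 0" for s by (simp add: \<kappa>0_def bump_bounds)
  have I0: "itg \<kappa>0 (-\<tau>) 0 \<noteq> 0"
  proof
    assume "itg \<kappa>0 (-\<tau>) 0 = 0"
    then have "AE s in lborel. indicator {-\<tau>..0} s * \<kappa>0 s = 0"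
      unfolding itg_def
      by (subst (asm) integral_nonneg_eq_0_iff_AE) (auto intro!: int1 c0 nn AE_I2 mult_nonneg_nonneg)
    then have "AE s in lborel. s \<notin> {a0<..<b0}"
      by (rule eventually_mono) (use ab0 bump_bounds(4)[of 1 a0 _ b0] in \<open>force simp: \<kappa>0_def indicator_def split: if_splits\<close>)
    then have "emeasure lborel {a0<..<b0} = 0"
      by (subst (asm) AE_iff_measurable[where N="{a0<..<b0}"]) auto
    then show False using ab0 by simp
  qed
  \<comment> \<open>The mean of \<open>\<zeta>\<close> with weight \<open>\<kappa>0\<close>, the
    only possible value of the constant.\<close>
  define k where "k = itg (\<lambda>s. \<zeta> s * \<kappa>0 s) (-\<tau>) 0 / itg \<kappa>0 (-\<tau>) 0"
  have "AE s in lborel. s \<in> {-\<tau>..0} \<longrightarrow> \<zeta> s - k = 0"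
  proof (rule fundamental_lemma)
    show "locally_L2 (\<lambda>s. \<zeta> s - k)" by (intro locally_L2_diff \<zeta> locally_L2_continuous) simp
  next
    fix \<kappa> \<kappa>' assume t: "test_function \<tau> \<kappa> \<kappa>'"
    \<comment> \<open>The multiple of \<open>\<kappa>0\<close> whose subtraction leaves mean
      zero.\<close>
    define c where "c = itg \<kappa> (-\<tau>) 0 / itg \<kappa>0 (-\<tau>) 0"
    have ck: "continuous_on UNIV \<kappa>" by (rule test_function_bounds(1)[OF t])
    obtain K where K: "compact K" "K \<subseteq> {-\<tau><..<0}" "\<And>s. s \<notin> K \<Longrightarrow> \<kappa> s = 0"
      using t unfolding test_function_def by blast
    have "compact (K \<union> {a0..b0})" "K \<union> {a0..b0} \<subseteq> {-\<tau><..<0}" using K ab0 by auto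
    then obtain a b where ab: "-\<tau> < a" "a < b" "b < 0" "K \<union> {a0..b0} \<subseteq> {a..b}"
      using compact_subset_interval[of "K \<union> {a0..b0}" "-\<tau>" 0] \<tau> by auto
    have "itg (\<lambda>s. \<kappa> s - c * \<kappa>0 s) (-\<tau>) 0 = itg \<kappa> (-\<tau>) 0 - c * itg \<kappa>0 (-\<tau>) 0"
      by (subst itg_diff) (auto intro!: locally_L2_continuous continuous_intros ck c0 simp: itg_scale)
    also have "\<dots> = 0" using I0 by (simp add: c_def)
    finally have mean: "itg (\<lambda>s. \<kappa> s - c * \<kappa>0 s) (-\<tau>) 0 = 0" .
    have supp: "\<kappa> s - c * \<kappa>0 s = 0" if "s \<notin> {a..b}" for s
    proof -
      have "s \<notin> K" "s \<notin> {a0..b0}" using that ab(4) by auto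
      then show ?thesis using K(3)[of s] bump_bounds(3)[of 1 s a0 b0] ab0 by (auto simp: \<kappa>0_def)
    qed
    have cc: "continuous_on UNIV (\<lambda>s. \<kappa> s - c * \<kappa>0 s)" by (intro continuous_intros ck c0)
    obtain \<eta> where "test_function \<tau> \<eta> (\<lambda>s. \<kappa> s - c * \<kappa>0 s)"
      using test_function_of_mean_zero[OF cc ab(1-3) supp mean] by blast
    from z[OF this] have "0 = itg (\<lambda>s. \<zeta> s * (\<kappa> s - c * \<kappa>0 s)) (-\<tau>) 0" by simp
    also have "\<dots> = itg (\<lambda>s. \<zeta> s * \<kappa> s) (-\<tau>) 0 - c * itg (\<lambda>s. \<zeta> s * \<kappa>0 s) (-\<tau>) 0"
    proof -
      have "itg (\<lambda>s. \<zeta> s * (\<kappa> s - c * \<kappa>0 s)) (-\<tau>) 0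
          = (\<integral>s. indicator {-\<tau>..0} s * (\<zeta> s * \<kappa> s) - c * (indicator {-\<tau>..0} s * (\<zeta> s * \<kappa>0 s)) \<partial>lborel)"
        unfolding itg_def by (auto intro!: Bochner_Integration.integral_cong simp: algebra_simps)
      then show ?thesis using int[OF \<zeta> ck] int[OF \<zeta> c0] by (simp add: itg_def)
    qed
    also have "c * itg (\<lambda>s. \<zeta> s * \<kappa>0 s) (-\<tau>) 0 = k * itg \<kappa> (-\<tau>) 0"
      by (simp add: c_def k_def)
    also have "itg (\<lambda>s. \<zeta> s * \<kappa> s) (-\<tau>) 0 - k * itg \<kappa> (-\<tau>) 0 = itg (\<lambda>s. (\<zeta> s - k) * \<kappa> s) (-\<tau>) 0"
    proof -
      have "itg (\<lambda>s. (\<zeta> s - k) * \<kappa> s) (-\<tau>) 0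
          = (\<integral>s. indicator {-\<tau>..0} s * (\<zeta> s * \<kappa> s) - k * (indicator {-\<tau>..0} s * \<kappa> s) \<partial>lborel)"
        unfolding itg_def by (auto intro!: Bochner_Integration.integral_cong simp: algebra_simps)
      then show ?thesis using int[OF \<zeta> ck] int1[OF ck] by (simp add: itg_def)
    qed
    finally show "itg (\<lambda>s. (\<zeta> s - k) * \<kappa> s) (-\<tau>) 0 = 0" by simp
  qed
  then show ?thesis
    by (intro exI[of _ k]) (auto elim!: eventually_mono simp: \<zeta>_def primitive_def)
qed

text \<open>Continuous functions that differ at 0 differ on a whole interval to the left of 0, which
  has positive measure. Hence the boundary value in \<open>has_value_at_0\<close> is unique.\<close>

lemma continuous_AE_eq_at_0:
  fixes c d :: "real \<Rightarrow> real"
  assumes \<tau>: "\<tau> > 0" and c: "continuous_on {-\<tau>..0} c" "continuous_on {-\<tau>..0} d"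
    and AE: "AE s in lborel. s \<in> {-\<tau>..0} \<longrightarrow> c s = (d s :: real)"
  shows "c 0 = d 0"
proof (rule ccontr)
  assume ne: "c 0 \<noteq> d 0"
  have "((\<lambda>s. c s - d s) \<longlongrightarrow> c 0 - d 0) (at 0 within {-\<tau>..0})"
    by (intro tendsto_diff c[unfolded continuous_on_def, rule_format]) (use \<tau> in auto)
  then have "\<forall>\<^sub>F s in at 0 within {-\<tau>..0}. c s - d s \<noteq> 0"
    using ne by (intro tendsto_imp_eventually_ne) auto
  then obtain e where e: "e > 0" "\<And>s. s \<in> {-\<tau>..0} \<Longrightarrow> s \<noteq> 0 \<Longrightarrow> dist s 0 < e \<Longrightarrow> c s \<noteq> d s"
    unfolding eventually_at by auto
  define m where "m = min e \<tau>"
  have m: "m > 0" "m \<le> e" "m \<le> \<tau>" using e \<tau> by (auto simp: m_def)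
  have "AE s in lborel. s \<notin> {-m<..<0}"
    using AE by (rule eventually_mono) (use e(2) m in \<open>force simp: dist_real_def\<close>)
  then have "emeasure lborel {-m<..<0} = 0"
    by (subst (asm) AE_iff_measurable[where N="{-m<..<0}"]) auto
  then show False using m by simp
qed

lemma AE_eq_seg:
  assumes "\<phi> \<in> L2_on {-\<tau>..0}" "locally_L2 y" "AE s in lborel. s \<in> {-\<tau>..0} \<longrightarrow> rep_l2 \<phi> s = y s"
  shows "\<phi> = seg \<tau> y"
  using seg_rep[OF assms(1)] seg_cong[OF locally_L2_rep assms(2,3)] by simp

text \<open>Together with \<open>dom_A_imp_primitive\<close> this parametrizes the domain by pairs
  of a boundary value and a derivative. The \<open>THE\<close> in \<open>weak_derivative\<close> is
  resolved by \<open>fundamental_lemma\<close>.\<close>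

lemma seg_primitive_in_dom_A:
  assumes \<tau>: "\<tau> > 0" and \<psi>: "\<psi> \<in> L2_on {-\<tau>..0}"
  shows "(x, seg \<tau> (primitive x \<psi>)) \<in> dom_A \<tau>" "op_A lam \<tau> (x, seg \<tau> (primitive x \<psi>)) = (- lam * x, \<psi>)"
proof -
  let ?\<phi> = "seg \<tau> (primitive x \<psi>)"
  have mem: "?\<phi> \<in> L2_on {-\<tau>..0}" by (simp add: seg_in_L2_on)
  have AE: "AE s in lborel. s \<in> {-\<tau>..0} \<longrightarrow> rep_l2 ?\<phi> s = primitive x \<psi> s"
    using rep_seg[of "primitive x \<psi>" \<tau>] by (auto elim: eventually_mono)
  have w: "has_weak_derivative \<tau> ?\<phi> \<psi>"
    unfolding has_weak_derivative_iff_itg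
  proof (intro allI impI)
    fix \<eta> \<eta>' assume t: "test_function \<tau> \<eta> \<eta>'"
    have [measurable]: "\<eta>' \<in> borel_measurable borel"
      by (rule borel_measurable_continuous_onI[OF test_function_bounds(2)[OF t]])
    have "itg (\<lambda>s. rep_l2 ?\<phi> s * \<eta>' s) (-\<tau>) 0 = itg (\<lambda>s. primitive x \<psi> s * \<eta>' s) (-\<tau>) 0"
      by (rule itg_cong_AE)
         (use AE locally_L2_measurable[OF locally_L2_primitive, of x \<psi>] in \<open>auto elim!: eventually_mono\<close>)
    then show "itg (\<lambda>s. rep_l2 ?\<phi> s * \<eta>' s) (-\<tau>) 0 = - itg (\<lambda>s. rep_l2 \<psi> s * \<eta> s) (-\<tau>) 0"
      using primitive_by_parts[OF \<tau> t] by simp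
  qed
  show "(x, ?\<phi>) \<in> dom_A \<tau>"
    unfolding dom_A_def W12_def has_value_at_0_def H_def
    using mem w \<psi> AE continuous_on_subset[OF primitive_continuous]
    by (auto intro!: exI[of _ "primitive x \<psi>"])
  have "weak_derivative \<tau> ?\<phi> = \<psi>"
    unfolding weak_derivative_def
  proof (rule the_equality)
    fix \<psi>' assume p: "\<psi>' \<in> L2_on {-\<tau>..0} \<and> has_weak_derivative \<tau> ?\<phi> \<psi>'"
    have "AE s in lborel. s \<in> {-\<tau>..0} \<longrightarrow> rep_l2 \<psi>' s - rep_l2 \<psi> s = 0"
    proof (rule fundamental_lemma)
      show "locally_L2 (\<lambda>s. rep_l2 \<psi>' s - rep_l2 \<psi> s)" by (intro locally_L2_diff) auto
    next
      fix \<eta> \<eta>' assume t: "test_function \<tau> \<eta> \<eta>'"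
      have int: "integrable lborel (\<lambda>s. indicator {-\<tau>..0} s * (rep_l2 \<xi> s * \<eta> s))" for \<xi>
        using square_integrable_mult[OF square_integrable_rep locally_L2_cut[OF locally_L2_continuous[OF test_function_bounds(1)[OF t]], of "-\<tau>" 0]]
        by (simp add: mult.left_commute)
      have "itg (\<lambda>s. (rep_l2 \<psi>' s - rep_l2 \<psi> s) * \<eta> s) (-\<tau>) 0
          = itg (\<lambda>s. rep_l2 \<psi>' s * \<eta> s) (-\<tau>) 0 - itg (\<lambda>s. rep_l2 \<psi> s * \<eta> s) (-\<tau>) 0"
        unfolding itg_def left_diff_distrib right_diff_distrib by (intro Bochner_Integration.integral_diff int)
      also have "\<dots> = 0" using p w t by (auto simp: has_weak_derivative_iff_itg)
      finally show "itg (\<lambda>s. (rep_l2 \<psi>' s - rep_l2 \<psi> s) * \<eta> s) (-\<tau>) 0 = 0" .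
    qed
    then have "AE s in lborel. s \<in> {-\<tau>..0} \<longrightarrow> rep_l2 \<psi>' s = rep_l2 \<psi> s" by (rule eventually_mono) auto
    then show "\<psi>' = \<psi>" using AE_eq_seg[of \<psi>' \<tau> "rep_l2 \<psi>"] p \<psi> by (simp add: seg_rep)
  qed (use \<psi> w in auto)
  then show "op_A lam \<tau> (x, ?\<phi>) = (- lam * x, \<psi>)" by (simp add: op_A_def)
qed

text \<open>The weak derivative determines \<open>\<phi>\<close> up to a constant, and the condition
  at 0 fixes the constant as \<open>x\<close>.\<close>

lemma dom_A_imp_primitive:
  assumes \<tau>: "\<tau> > 0" and z: "(x, \<phi>) \<in> dom_A \<tau>"
  shows "\<exists>\<psi>\<in>L2_on {-\<tau>..0}. \<phi> = seg \<tau> (primitive x \<psi>)"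
proof -
  obtain \<psi> where \<psi>: "\<psi> \<in> L2_on {-\<tau>..0}" "has_weak_derivative \<tau> \<phi> \<psi>" and \<phi>: "\<phi> \<in> L2_on {-\<tau>..0}"
    using z by (auto simp: dom_A_def W12_def)
  obtain c where c: "continuous_on {-\<tau>..0} c" "AE s in lborel. s \<in> {-\<tau>..0} \<longrightarrow> rep_l2 \<phi> s = c s" "c 0 = x"
    using z by (auto simp: dom_A_def has_value_at_0_def)
  obtain k where k: "AE s in lborel. s \<in> {-\<tau>..0} \<longrightarrow> rep_l2 \<phi> s = primitive k \<psi> s"
    using weak_derivative_imp_primitive[OF \<tau> \<psi>(2)] by blast
  have "AE s in lborel. s \<in> {-\<tau>..0} \<longrightarrow> c s = primitive k \<psi> s"
    using AE_conjI[OF c(2) k] by (rule eventually_mono) auto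
  then have "k = x" using continuous_AE_eq_at_0[OF \<tau> c(1) continuous_on_subset[OF primitive_continuous]] c(3) by force
  then show ?thesis using AE_eq_seg[OF \<phi> locally_L2_primitive k] \<psi>(1) by blast
qed

section \<open>The generator of the translation semigroup\<close>

definition quot :: "real \<Rightarrow> real \<Rightarrow> real \<Rightarrow> real \<times> l2 \<Rightarrow> l2" where
  "quot lam \<tau> h z = seg \<tau> (\<lambda>r. 1 / h * (extend lam z (h + r) - extend lam z r))"

text \<open>The value at s = 0 of the averages over [s, s + h], hence the boundary value in
  \<open>itg_extend_eq_primitive\<close>.\<close>

definition mean :: "real \<Rightarrow> real \<Rightarrow> real \<times> l2 \<Rightarrow> real" where
  "mean lam h z = 1 / h * itg (extend lam z) 0 h"

lemma quot_in_L2_on: "quot lam \<tau> h z \<in> L2_on {-\<tau>..0}"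
  unfolding quot_def by (intro seg_in_L2_on locally_L2_scale locally_L2_diff) auto

lemma difference_quotient:
  assumes z: "z \<in> H \<tau>" and h: "h > 0"
  shows "(translation_semigroup lam \<tau> h z - z) /\<^sub>R h = ((fst z * exp (- lam * h) - fst z) / h, quot lam \<tau> h z)"
proof -
  have "translation_semigroup lam \<tau> h z - z
      = (fst z * exp (- lam * h) - fst z, seg \<tau> (\<lambda>r. extend lam z (h + r)) - seg \<tau> (extend lam z))"
    using seg_extend[OF z, of lam] by (simp add: prod_eq_iff translation_semigroup_def)
  then show ?thesis
    by (simp add: quot_def seg_diff seg_scale locally_L2_diff divide_inverse mult.commute)
qed

text \<open>The averages of the extended history are primitives of the difference quotients of the
  semigroup. As they converge to the history, this identity yields both inclusions for the domain of
  the generator, and its density.\<close>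

lemma itg_extend_eq_primitive:
  assumes h: "h > 0" and s: "s \<in> {-\<tau>..0}"
  shows "1 / h * itg (extend lam z) s (s + h) = primitive (mean lam h z) (quot lam \<tau> h z) s"
proof -
  let ?E = "extend lam z"
  let ?q = "\<lambda>r. 1 / h * (?E (h + r) - ?E r)"
  have L: "locally_L2 ?q" by (intro locally_L2_scale locally_L2_diff) auto
  have "AE r in lborel. r \<in> {s..0} \<longrightarrow> rep_l2 (quot lam \<tau> h z) r = ?q r"
    unfolding quot_def by (rule eventually_mono[OF rep_seg[OF L, of \<tau>]]) (use s in auto)
  then have "itg (rep_l2 (quot lam \<tau> h z)) s 0 = itg ?q s 0"
    by (intro itg_cong_AE) (use locally_L2_measurable[OF L] in auto)
  also have "\<dots> = 1 / h * (itg ?E (h + s) h - itg ?E s 0)"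
    by (simp only: itg_scale itg_diff locally_L2_extend locally_L2_extend_shift itg_translate add_0_right)
  also have "itg ?E (h + s) h - itg ?E s 0 = itg ?E 0 h - itg ?E s (s + h)"
    using itg_split[of ?E s 0 h] itg_split[of ?E s "s + h" h] h s by (simp add: add.commute)
  finally show ?thesis by (simp add: primitive_def mean_def right_diff_distrib)
qed

text \<open>By \<open>itg_extend_eq_primitive\<close> the primitives are averages of the extended
  history, so \<open>average_tendsto\<close> applies after a cut-off to [-\<open>\<tau>\<close>, 1],
  which contains all averaging intervals for h < 1.\<close>

lemma seg_primitive_quot_tendsto:
  assumes \<tau>: "\<tau> > 0"
  shows "((\<lambda>h. seg \<tau> (primitive (mean lam h z) (quot lam \<tau> h z))) \<longlongrightarrow> seg \<tau> (extend lam z)) (at_right 0)"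
proof (rule tendstoI)
  fix e :: real assume e: "e > 0"
  define E where "E s = indicator {-\<tau>..1} s * extend lam z s" for s
  have E: "square_integrable E" unfolding E_def by (rule locally_L2_cut) simp
  show "\<forall>\<^sub>F h in at_right 0. dist (seg \<tau> (primitive (mean lam h z) (quot lam \<tau> h z))) (seg \<tau> (extend lam z)) < e"
    using average_tendsto[OF E e] eventually_at_right_less[of 1, OF zero_less_one]
  proof eventually_elim
    case (elim h)
    define A where "A s = 1/h * (\<integral>r. indicator {0..h} r * E (s + r) \<partial>lborel) - E s" for s
    have "norm (seg \<tau> (\<lambda>s. primitive (mean lam h z) (quot lam \<tau> h z) s - extend lam z s)) \<le> norm (abs_l2 A)"
    proof (rule norm_seg_mono)
      show "locally_L2 (\<lambda>s. primitive (mean lam h z) (quot lam \<tau> h z) s - extend lam z s)"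
        by (intro locally_L2_diff) auto
      show "square_integrable A" using elim by (simp add: A_def[abs_def])
      fix s assume s: "s \<in> {-\<tau>..0}"
      have "itg E s (s + h) = itg (extend lam z) s (s + h)"
        unfolding E_def using s elim by (intro itg_cong) auto
      moreover have "A s = 1 / h * itg E s (s + h) - E s" unfolding A_def average_eq_itg ..
      moreover have "E s = extend lam z s" using s by (simp add: E_def)
      ultimately have "A s = primitive (mean lam h z) (quot lam \<tau> h z) s - extend lam z s"
        using itg_extend_eq_primitive[of h s \<tau> lam z] s elim by simp
      then show "\<bar>primitive (mean lam h z) (quot lam \<tau> h z) s - extend lam z s\<bar> \<le> \<bar>A s\<bar>" by simp
    qed
    also have "\<dots> < e" using elim by (simp add: A_def[abs_def])
    finally show ?case by (simp add: dist_norm seg_diff)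
  qed
qed

lemma itg_extend_right:
  assumes "lam > 0" "b \<ge> 0"
  shows "itg (extend lam z) 0 b = fst z * (1 - exp (- lam * b)) / lam"
proof -
  have "itg (extend lam z) 0 b = itg (\<lambda>r. fst z * exp (- lam * r)) 0 b"
    by (rule itg_cong) (simp add: extend_def)
  also have "\<dots> = (- fst z * exp (- lam * b) / lam) - (- fst z * exp (- lam * 0) / lam)"
    by (rule itg_continuous_FTC)
       (use assms in \<open>auto intro!: derivative_eq_intros continuous_intros\<close>)
  finally show ?thesis by (simp add: diff_divide_distrib right_diff_distrib)
qed

lemma exp_quotient_tendsto:
  "((\<lambda>h. (x * exp (- lam * h) - x) / h) \<longlongrightarrow> - lam * x) (at_right (0::real))"
proof -
  have "((\<lambda>h. x * exp (- lam * h)) has_real_derivative - lam * x) (at 0)"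
    by (auto intro!: derivative_eq_intros)
  then have "((\<lambda>h. (x * exp (- lam * (0 + h)) - x * exp (- lam * 0)) / h) \<longlongrightarrow> - lam * x) (at 0)"
    by (simp only: DERIV_def)
  then have "((\<lambda>h. (x * exp (- lam * h) - x) / h) \<longlongrightarrow> - lam * x) (at 0)" by simp
  then show ?thesis by (rule filterlim_mono) (auto simp: at_within_le_at)
qed

text \<open>The integral of an exponential is again a difference of exponentials: for positive h,
  \<open>mean lam h z\<close> is -1/\<open>lam\<close> times the quotient in
  \<open>exp_quotient_tendsto\<close>.\<close>

lemma mean_tendsto:
  fixes lam :: real
  assumes lam: "lam > 0"
  shows "((\<lambda>h. mean lam h z) \<longlongrightarrow> fst z) (at_right 0)"
proof -
  have "((\<lambda>h. - 1 / lam * ((fst z * exp (- lam * h) - fst z) / h)) \<longlongrightarrow> - 1 / lam * (- lam * fst z)) (at_right 0)"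
    by (intro tendsto_intros exp_quotient_tendsto)
  moreover have "- 1 / lam * (- lam * fst z) = fst z" using lam by simp
  moreover have "\<forall>\<^sub>F h in at_right 0. - 1 / lam * ((fst z * exp (- lam * h) - fst z) / h) = mean lam h z"
    using eventually_at_right_less[of 1, OF zero_less_one]
  proof eventually_elim
    case (elim h)
    then show ?case using lam by (simp add: mean_def itg_extend_right field_simps)
  qed
  ultimately show ?thesis using tendsto_cong by fastforce
qed

text \<open>With w = \<open>op_A lam \<tau> z\<close>, the extended history of \<open>z\<close> is
  an antiderivative of the extended history of \<open>w\<close>, also across 0. The difference
  quotient of \<open>z\<close> is thus an average for \<open>w\<close>, and averages
  converge.\<close>

lemma generator_on_dom_A:
  assumes \<tau>: "\<tau> > 0" and lam: "lam > 0" and z: "z \<in> dom_A \<tau>"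
  shows "z \<in> H \<tau>" "op_A lam \<tau> z \<in> H \<tau>"
    "((\<lambda>h. (translation_semigroup lam \<tau> h z - z) /\<^sub>R h) \<longlongrightarrow> op_A lam \<tau> z) (at_right 0)"
proof -
  obtain x \<psi> where zx: "z = (x, seg \<tau> (primitive x \<psi>))" and \<psi>: "\<psi> \<in> L2_on {-\<tau>..0}"
    using dom_A_imp_primitive[OF \<tau>] z by (metis prod.exhaust_sel)
  show zH: "z \<in> H \<tau>" using z by (auto simp: dom_A_def)
  define w where "w = (- lam * x, \<psi>)"
  have opA: "op_A lam \<tau> z = w" unfolding zx w_def by (rule seg_primitive_in_dom_A[OF \<tau> \<psi>])
  show wH: "op_A lam \<tau> z \<in> H \<tau>" unfolding opA using \<psi> by (simp add: w_def H_iff)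
  \<comment> \<open>A representative of the extended history on [-\<open>\<tau>\<close>,
    \<infinity>) that is continuous at 0; this is where the condition that the history ends at
    \<open>x\<close> enters.\<close>
  define P where "P s = (if s < 0 then primitive x \<psi> s else x * exp (- lam * s))" for s
  have EP: "AE s in lborel. -\<tau> \<le> s \<longrightarrow> extend lam z s = P s"
    by (rule eventually_mono[OF rep_seg[OF locally_L2_primitive, of \<tau> x \<psi>]])
       (auto simp: extend_def zx P_def)
  have Ew: "extend lam w r = rep_l2 \<psi> r" if "r < 0" for r using that by (simp add: extend_def w_def)
  have W: "itg (extend lam w) s b = itg (rep_l2 \<psi>) s b" if "b \<le> 0" for s b
    by (rule itg_cong_AE)
       (use that AE_neq[of 0] locally_L2_measurable[OF locally_L2_extend] in
         \<open>auto simp: Ew elim!: eventually_mono\<close>)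
  have PW: "P (h + s) - P s = itg (extend lam w) s (s + h)" if h: "h > 0" and s: "s < 0" for s h
  proof (cases "s + h \<le> 0")
    case True
    then have "P (h + s) = primitive x \<psi> (s + h)" by (auto simp: P_def add.commute)
    then show ?thesis using W[OF True, of s] itg_split[of "rep_l2 \<psi>" s "s + h" 0] True h s
      by (simp add: P_def primitive_def)
  next
    case False
    then have "itg (extend lam w) s (s + h) = itg (rep_l2 \<psi>) s 0 + itg (extend lam w) 0 (s + h)"
      using itg_split[of "extend lam w" s 0 "s + h"] s W[of 0 s] by simp
    also have "itg (extend lam w) 0 (s + h) = x * exp (- lam * (s + h)) - x"
      by (subst itg_extend_right[OF lam]) (use False lam in \<open>auto simp: w_def field_simps\<close>)
    finally show ?thesis using False s by (simp add: P_def primitive_def add.commute)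
  qed
  have q: "quot lam \<tau> h z = seg \<tau> (primitive (mean lam h w) (quot lam \<tau> h w))" if h: "h > 0" for h
    unfolding quot_def[of lam \<tau> h z]
  proof (rule seg_cong)
    show "locally_L2 (\<lambda>r. 1 / h * (extend lam z (h + r) - extend lam z r))"
      by (intro locally_L2_scale locally_L2_diff) auto
    show "AE s in lborel. s \<in> {-\<tau>..0} \<longrightarrow> 1 / h * (extend lam z (h + s) - extend lam z s) = primitive (mean lam h w) (quot lam \<tau> h w) s"
      using AE_conjI[OF AE_conjI[OF EP AE_translate[OF EP, of h]] AE_neq[of 0]]
    proof (rule eventually_mono, intro impI)
      fix s assume a: "((- \<tau> \<le> s \<longrightarrow> extend lam z s = P s) \<and> (- \<tau> \<le> h + s \<longrightarrow> extend lam z (h + s) = P (h + s))) \<and> s \<noteq> 0"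
        and s: "s \<in> {-\<tau>..0}"
      then have "extend lam z (h + s) - extend lam z s = itg (extend lam w) s (s + h)"
        using PW[OF h, of s] h by auto
      then show "1 / h * (extend lam z (h + s) - extend lam z s) = primitive (mean lam h w) (quot lam \<tau> h w) s"
        using itg_extend_eq_primitive[OF h s, of lam w] by simp
    qed
  qed simp
  have "((\<lambda>h. ((x * exp (- lam * h) - x) / h, seg \<tau> (primitive (mean lam h w) (quot lam \<tau> h w))))
      \<longlongrightarrow> (- lam * x, seg \<tau> (extend lam w))) (at_right 0)"
    by (intro tendsto_Pair exp_quotient_tendsto seg_primitive_quot_tendsto \<tau>)
  moreover have "(- lam * x, seg \<tau> (extend lam w)) = w"
    using seg_extend[of w \<tau> lam] wH opA by (simp add: w_def)
  moreover have "\<forall>\<^sub>F h in at_right 0. ((x * exp (- lam * h) - x) / h, seg \<tau> (primitive (mean lam h w) (quot lam \<tau> h w)))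
      = (translation_semigroup lam \<tau> h z - z) /\<^sub>R h"
    using eventually_at_right_less[of 1, OF zero_less_one]
  proof eventually_elim
    case (elim h)
    then show ?case using difference_quotient[OF zH, of h lam] q[of h] by (simp add: zx)
  qed
  ultimately show "((\<lambda>h. (translation_semigroup lam \<tau> h z - z) /\<^sub>R h) \<longlongrightarrow> op_A lam \<tau> z) (at_right 0)"
    unfolding opA using tendsto_cong by fastforce
qed

text \<open>A primitive depends continuously on its boundary value and its derivative; this plays
  the part of the closedness of \<open>op_A\<close>.\<close>

lemma seg_primitive_diff_bound:
  assumes \<tau>: "\<tau> > 0"
  shows "norm (seg \<tau> (primitive x \<phi>) - seg \<tau> (primitive y \<psi>)) \<le> (\<bar>x - y\<bar> + sqrt \<tau> * norm (\<phi> - \<psi>)) * sqrt \<tau>"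
proof -
  have pt: "\<bar>primitive x \<phi> s - primitive y \<psi> s\<bar> \<le> \<bar>x - y\<bar> + sqrt \<tau> * norm (\<phi> - \<psi>)" if s: "s \<in> {-\<tau>..0}" for s
  proof -
    have sq: "square_integrable (\<lambda>r. rep_l2 \<phi> r - rep_l2 \<psi> r)" by (intro square_integrable_diff) auto
    have n: "abs_l2 (\<lambda>r. rep_l2 \<phi> r - rep_l2 \<psi> r) = \<phi> - \<psi>" using abs_l2_diff[of "rep_l2 \<phi>" "rep_l2 \<psi>"] by simp
    have "\<bar>itg (rep_l2 \<phi>) s 0 - itg (rep_l2 \<psi>) s 0\<bar> \<le> sqrt (0 - s) * norm (\<phi> - \<psi>)"
      using itg_bound[OF sq, of s 0] s by (simp add: itg_diff n)
    also have "\<dots> \<le> sqrt \<tau> * norm (\<phi> - \<psi>)" using s by (intro mult_right_mono) auto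
    finally show ?thesis by (simp add: primitive_def)
  qed
  have "norm (seg \<tau> (\<lambda>s. primitive x \<phi> s - primitive y \<psi> s)) \<le> (\<bar>x - y\<bar> + sqrt \<tau> * norm (\<phi> - \<psi>)) * sqrt \<tau>"
    by (rule norm_seg_le)
       (use \<tau> pt locally_L2_measurable[OF locally_L2_diff[OF locally_L2_primitive locally_L2_primitive]] in auto)
  then show ?thesis by (simp add: seg_diff)
qed

text \<open>Let h tend to 0 in \<open>itg_extend_eq_primitive\<close>: the averages tend to the
  history, \<open>quot\<close> tends to \<open>snd y\<close> by assumption and \<open>mean\<close>
  to \<open>fst z\<close>. So the history is the primitive with these data.\<close>

lemma dom_A_if_differentiable:
  assumes \<tau>: "\<tau> > 0" and lam: "lam > 0" and z: "z \<in> H \<tau>" and y: "y \<in> H \<tau>"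
    and lim: "((\<lambda>h. (translation_semigroup lam \<tau> h z - z) /\<^sub>R h) \<longlongrightarrow> y) (at_right 0)"
  shows "z \<in> dom_A \<tau>"
proof -
  have "((\<lambda>h. snd ((translation_semigroup lam \<tau> h z - z) /\<^sub>R h)) \<longlongrightarrow> snd y) (at_right 0)"
    by (intro tendsto_snd lim)
  moreover have "\<forall>\<^sub>F h in at_right 0. snd ((translation_semigroup lam \<tau> h z - z) /\<^sub>R h) = quot lam \<tau> h z"
    using eventually_at_right_less[of 1, OF zero_less_one]
    by eventually_elim (simp only: difference_quotient[OF z] snd_conv)
  ultimately have q: "((\<lambda>h. quot lam \<tau> h z) \<longlongrightarrow> snd y) (at_right 0)" using tendsto_cong by fastforce
  have "((\<lambda>h. (\<bar>mean lam h z - fst z\<bar> + sqrt \<tau> * norm (quot lam \<tau> h z - snd y)) * sqrt \<tau>)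
      \<longlongrightarrow> (\<bar>fst z - fst z\<bar> + sqrt \<tau> * norm (snd y - snd y)) * sqrt \<tau>) (at_right 0)"
    by (intro tendsto_intros mean_tendsto lam q)
  then have l0: "((\<lambda>h. (\<bar>mean lam h z - fst z\<bar> + sqrt \<tau> * norm (quot lam \<tau> h z - snd y)) * sqrt \<tau>) \<longlongrightarrow> 0) (at_right 0)"
    by simp
  have "((\<lambda>h. seg \<tau> (primitive (mean lam h z) (quot lam \<tau> h z)) - seg \<tau> (primitive (fst z) (snd y))) \<longlongrightarrow> 0) (at_right 0)"
    by (rule Lim_null_comparison[OF _ l0]) (intro always_eventually allI seg_primitive_diff_bound \<tau>)
  then have "((\<lambda>h. seg \<tau> (primitive (mean lam h z) (quot lam \<tau> h z))) \<longlongrightarrow> seg \<tau> (primitive (fst z) (snd y))) (at_right 0)"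
    by (simp add: LIM_zero_iff)
  then have "seg \<tau> (primitive (fst z) (snd y)) = seg \<tau> (extend lam z)"
    using seg_primitive_quot_tendsto[OF \<tau>] by (rule tendsto_unique[OF trivial_limit_at_right_real])
  then have "z = (fst z, seg \<tau> (primitive (fst z) (snd y)))" by (simp add: seg_extend[OF z])
  then show ?thesis using seg_primitive_in_dom_A(1)[OF \<tau>, of "snd y" "fst z"] y by (simp add: H_iff)
qed

theorem generates_translation_semigroup:
  assumes \<tau>: "\<tau> > 0" and lam: "lam > 0"
  shows "generates (H \<tau>) (dom_A \<tau>) (op_A lam \<tau>) (translation_semigroup lam \<tau>)"
  unfolding generates_def
proof (intro conjI ballI)
  show "C0_semigroup_on (H \<tau>) (translation_semigroup lam \<tau>)"
    using lam by (intro C0_translation_semigroup) simp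
  show "dom_A \<tau> = {z \<in> H \<tau>. \<exists>y\<in>H \<tau>. ((\<lambda>h. (translation_semigroup lam \<tau> h z - z) /\<^sub>R h) \<longlongrightarrow> y) (at_right 0)}"
    using generator_on_dom_A[OF \<tau> lam] dom_A_if_differentiable[OF \<tau> lam] by blast
  show "((\<lambda>h. (translation_semigroup lam \<tau> h z - z) /\<^sub>R h) \<longlongrightarrow> op_A lam \<tau> z) (at_right 0)" if "z \<in> dom_A \<tau>" for z
    by (rule generator_on_dom_A[OF \<tau> lam that])
qed

text \<open>The averaged states are primitives of elements of L2 with matching boundary value, hence
  in the domain, and they converge to \<open>z\<close>.\<close>

lemma dom_A_dense:
  fixes lam :: real
  assumes \<tau>: "\<tau> > 0" and lam: "lam > 0" and z: "z \<in> H \<tau>" and e: "e > 0"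
  shows "\<exists>y\<in>dom_A \<tau>. norm (z - y) < e"
proof -
  let ?y = "\<lambda>h. (mean lam h z, seg \<tau> (primitive (mean lam h z) (quot lam \<tau> h z)))"
  have "(?y \<longlongrightarrow> (fst z, seg \<tau> (extend lam z))) (at_right 0)"
    by (intro tendsto_Pair mean_tendsto lam seg_primitive_quot_tendsto \<tau>)
  moreover have "(fst z, seg \<tau> (extend lam z)) = z" by (simp add: seg_extend[OF z])
  ultimately have "\<forall>\<^sub>F h in at_right 0. dist (?y h) z < e" using e tendstoD by fastforce
  then obtain h where "dist (?y h) z < e" using eventually_happens trivial_limit_at_right_real by blast
  moreover have "?y h \<in> dom_A \<tau>" by (rule seg_primitive_in_dom_A(1)[OF \<tau> quot_in_L2_on])
  ultimately show ?thesis by (metis dist_norm norm_minus_commute)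
qed

lemma subspace_H: "subspace (H \<tau>)"
proof -
  have 1: "(0::l2) \<in> L2_on {-\<tau>..0}"
    using seg_in_L2_on[of "\<lambda>_. 0" \<tau>] locally_L2_continuous[of "\<lambda>_. 0"] by (simp add: seg_def abs_l2_0)
  have 2: "\<phi> + \<psi> \<in> L2_on {-\<tau>..0}" if "\<phi> \<in> L2_on {-\<tau>..0}" "\<psi> \<in> L2_on {-\<tau>..0}" for \<phi> \<psi>
  proof -
    have "seg \<tau> (rep_l2 \<phi>) + seg \<tau> (rep_l2 \<psi>) \<in> L2_on {-\<tau>..0}"
      by (simp add: seg_add seg_in_L2_on locally_L2_add)
    then show ?thesis by (simp add: seg_rep that)
  qed
  have 3: "c *\<^sub>R \<phi> \<in> L2_on {-\<tau>..0}" if "\<phi> \<in> L2_on {-\<tau>..0}" for \<phi> c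
  proof -
    have "c *\<^sub>R seg \<tau> (rep_l2 \<phi>) \<in> L2_on {-\<tau>..0}"
      by (simp add: seg_scale seg_in_L2_on locally_L2_scale)
    then show ?thesis by (simp add: seg_rep that)
  qed
  show ?thesis unfolding subspace_def using 1 2 3 by (auto simp: H_iff)
qed

text \<open>\<open>delay_semigroup\<close> is a choice among all semigroups with the given
  generator. The translation semigroup shows that there is one, and uniqueness identifies the choice
  with it.\<close>

theorem delay_semigroup_eq:
  assumes \<tau>: "\<tau> > 0" and lam: "lam > 0" and t: "t \<ge> 0" and z: "z \<in> H \<tau>"
  shows "delay_semigroup lam \<tau> t z = translation_semigroup lam \<tau> t z"
proof (rule generator_determines_semigroup[OF subspace_H _ generates_translation_semigroup[OF \<tau> lam] _ _ t z])
  show "generates (H \<tau>) (dom_A \<tau>) (op_A lam \<tau>) (delay_semigroup lam \<tau>)"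
    using someI[of "generates (H \<tau>) (dom_A \<tau>) (op_A lam \<tau>)", OF generates_translation_semigroup[OF \<tau> lam]]
    by (simp add: delay_semigroup_def semigroup_generated_by_def)
  show "\<exists>K. \<forall>s\<in>{0..t}. \<forall>x\<in>H \<tau>. norm (translation_semigroup lam \<tau> s x) \<le> K * norm x" for t
  proof (intro exI[of _ "1 + t"] ballI)
    fix s x assume "s \<in> {0..t}"
    then have "norm (translation_semigroup lam \<tau> s x) \<le> (1 + s) * norm x"
      using lam by (intro translation_semigroup_bound) auto
    also have "\<dots> \<le> (1 + t) * norm x" using \<open>s \<in> {0..t}\<close> by (intro mult_right_mono) auto
    finally show "norm (translation_semigroup lam \<tau> s x) \<le> (1 + t) * norm x" .
  qed
  show "\<exists>y\<in>dom_A \<tau>. norm (x - y) < e" if "x \<in> H \<tau>" "e > 0" for x e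
    by (rule dom_A_dense[OF \<tau> lam that])
qed

section \<open>Mild solutions\<close>

text \<open>The type \<open>l2\<close> is not known to be complete, so continuity alone does not provide
  integrability; the candidate for the integral has to be supplied.\<close>

lemma has_integral_weakI:
  fixes G :: "real \<Rightarrow> 'a::real_inner"
  assumes ab: "a \<le> b" and G: "continuous_on {a..b} G"
    and weak: "\<And>\<zeta>. ((\<lambda>s. inner (G s) \<zeta>) has_integral inner J \<zeta>) {a..b}"
  shows "(G has_integral J) {a..b}"
  unfolding box_real(2)[symmetric] has_integral
proof (intro allI impI)
  fix e :: real assume e: "e > 0"
  \<comment> \<open>The added 1 covers the case a = b.\<close>
  define e' where "e' = e / (b - a + 1)"
  have e': "e' > 0" "e' * (b - a) < e" using e ab by (auto simp: e'_def field_simps)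
  have "uniformly_continuous_on {a..b} G" by (rule compact_uniformly_continuous[OF G]) simp
  then obtain d where d: "d > 0" "\<And>x y. x \<in> {a..b} \<Longrightarrow> y \<in> {a..b} \<Longrightarrow> dist y x < d \<Longrightarrow> dist (G y) (G x) < e'"
    using e' unfolding uniformly_continuous_on_def by metis
  show "\<exists>\<gamma>. gauge \<gamma> \<and> (\<forall>D. D tagged_division_of cbox a b \<and> \<gamma> fine D \<longrightarrow> norm ((\<Sum>(x, K)\<in>D. measure lborel K *\<^sub>R G x) - J) < e)"
  proof (intro exI conjI allI impI)
    show "gauge (\<lambda>x. ball x d)" using d(1) by (rule gauge_ball)
    fix D assume D: "D tagged_division_of cbox a b \<and> (\<lambda>x. ball x d) fine D"
    \<comment> \<open>The error of the Riemann sum is itself taken as the test vector, so its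
      squared norm is a scalar quantity. The mesh \<open>d\<close> was fixed before \<open>v\<close>
      and works for all test vectors, by uniform continuity of \<open>G\<close>.\<close>
    define v where "v = (\<Sum>(x, K)\<in>D. measure lborel K *\<^sub>R G x) - J"
    define F where "F s = inner (G s) v" for s
    have Fi: "F integrable_on cbox a b" using weak[of v] by (auto simp: F_def[abs_def] integrable_on_def)
    have JF: "inner J v = (\<Sum>(x, K)\<in>D. integral K F)"
      using integral_combine_tagged_division_topdown[OF Fi] D weak[of v]
      by (simp add: F_def[abs_def] integral_unique)
    have loc: "measure lborel K * F x - integral K F \<le> measure lborel K * (e' * norm v)" if xK: "(x, K) \<in> D" for x K
    proof -
      obtain u w where K: "K = cbox u w" using D xK by blast
      have sub: "K \<subseteq> cbox a b" "x \<in> K" using D xK by blast+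
      have ball: "K \<subseteq> ball x d" using D xK by (auto simp: fine_def)
      have Ki: "F integrable_on cbox u w" using sub(1) unfolding K by (rule integrable_on_subcbox[OF Fi])
      have "((\<lambda>s. F x - F s) has_integral (measure lborel (cbox u w) *\<^sub>R F x - integral (cbox u w) F)) (cbox u w)"
        using Ki by (intro has_integral_diff has_integral_const integrable_integral)
      moreover have "norm (F x - F s) \<le> e' * norm v" if s: "s \<in> cbox u w" for s
      proof -
        have "dist (G s) (G x) < e'"
          using s K sub ball by (intro d(2)) (auto simp: subset_iff dist_commute)
        then have "norm (G x - G s) * norm v \<le> e' * norm v"
          by (intro mult_right_mono) (auto simp: dist_norm norm_minus_commute)
        moreover have "\<bar>F x - F s\<bar> \<le> norm (G x - G s) * norm v"
          unfolding F_def inner_diff_left[symmetric] by (rule Cauchy_Schwarz_ineq2)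
        ultimately show ?thesis by simp
      qed
      ultimately have "norm (measure lborel (cbox u w) *\<^sub>R F x - integral (cbox u w) F) \<le> e' * norm v * measure lborel (cbox u w)"
        using e' by (intro has_integral_bound) auto
      then show ?thesis unfolding K by (simp add: ac_simps)
    qed
    have "norm v * norm v = inner v v" by (simp add: power2_norm_eq_inner flip: power2_eq_square)
    also have "\<dots> = (\<Sum>(x, K)\<in>D. measure lborel K * F x) - (\<Sum>(x, K)\<in>D. integral K F)"
      unfolding JF[symmetric] F_def
      by (subst (1) v_def) (simp add: inner_diff_left inner_sum_left case_prod_unfold)
    also have "\<dots> = (\<Sum>(x, K)\<in>D. measure lborel K * F x - integral K F)"
      by (simp add: sum_subtractf case_prod_unfold)
    also have "\<dots> \<le> (\<Sum>(x, K)\<in>D. measure lborel K * (e' * norm v))"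
      by (intro sum_mono) (use loc in auto)
    also have "\<dots> = (\<Sum>(x, K)\<in>D. measure lborel K) * (e' * norm v)"
      by (simp add: sum_distrib_right case_prod_unfold)
    also have "(\<Sum>(x, K)\<in>D. measure lborel K) = measure lborel (cbox a b)"
      using D additive_content_tagged_division by blast
    finally have "norm v * norm v \<le> (e' * (b - a)) * norm v" using ab by (simp add: ac_simps)
    then have "norm v \<le> e' * (b - a)"
      using e' ab by (cases "norm v = 0") (auto simp: mult_le_cancel_right)
    then show "norm ((\<Sum>(x, K)\<in>D. measure lborel K *\<^sub>R G x) - J) < e"
      using e' by (simp add: v_def)
  qed
qed

text \<open>Near \<open>t\<close> all windows lie in [t - \<open>\<tau>\<close> - 1, t + 1], so
  \<open>y\<close> may be cut off there. Translating both functions by \<open>t\<close> leaves the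
  norm unchanged and reduces the claim to continuity of translation at 0.\<close>

lemma seg_shift_continuous:
  assumes y: "locally_L2 y"
  shows "continuous_on UNIV (\<lambda>t. seg \<tau> (\<lambda>s. y (t + s)))"
proof (rule continuous_at_imp_continuous_on, rule ballI)
  fix t :: real
  define E where "E s = indicator {t - \<tau> - 1..t + 1} s * y s" for s
  have E: "square_integrable E" unfolding E_def by (rule locally_L2_cut[OF y])
  have "((\<lambda>h. norm (abs_l2 (\<lambda>s. E (h + s) - E s))) \<longlongrightarrow> 0) (at 0)"
    by (rule tendsto_norm_zero[OF translate_tendsto[OF E]])
  then have lim: "((\<lambda>r. norm (abs_l2 (\<lambda>s. E ((r - t) + s) - E s))) \<longlongrightarrow> 0) (at t)"
    by (subst at_to_0) (simp add: filterlim_filtermap)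
  have "\<forall>\<^sub>F r in at t. dist r t < 1" unfolding eventually_at by (auto intro!: exI[of _ 1])
  then have "\<forall>\<^sub>F r in at t. norm (seg \<tau> (\<lambda>s. y (r + s)) - seg \<tau> (\<lambda>s. y (t + s)))
      \<le> norm (abs_l2 (\<lambda>s. E ((r - t) + s) - E s))"
  proof eventually_elim
    case (elim r)
    have sq: "square_integrable (\<lambda>s. E ((r - t) + s) - E s)"
      by (intro square_integrable_diff square_integrable_translate[OF E] E)
    have "norm (seg \<tau> (\<lambda>s. y (r + s) - y (t + s))) \<le> norm (abs_l2 (\<lambda>s. E ((r - t) + (t + s)) - E (t + s)))"
      by (rule norm_seg_mono[OF _ square_integrable_translate[OF sq, of t]])
         (use elim in \<open>auto intro!: locally_L2_diff locally_L2_translate y simp: E_def indicator_def dist_real_def\<close>)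
    also have "\<dots> = norm (abs_l2 (\<lambda>s. E ((r - t) + s) - E s))"
    proof -
      have "(norm (abs_l2 (\<lambda>s. E ((r - t) + (t + s)) - E (t + s))))\<^sup>2 = (norm (abs_l2 (\<lambda>s. E ((r - t) + s) - E s)))\<^sup>2"
        unfolding norm_abs_l2_sq[OF sq] norm_abs_l2_sq[OF square_integrable_translate[OF sq]]
        by (rule integral_translate[of "\<lambda>s. (E ((r - t) + s) - E s)\<^sup>2"])
      then show ?thesis by simp
    qed
    finally show ?case by (simp add: seg_diff locally_L2_translate y)
  qed
  then have "((\<lambda>r. seg \<tau> (\<lambda>s. y (r + s)) - seg \<tau> (\<lambda>s. y (t + s))) \<longlongrightarrow> 0) (at t)"
    by (rule Lim_null_comparison[OF _ lim])
  then show "isCont (\<lambda>t. seg \<tau> (\<lambda>s. y (t + s))) t" by (simp add: isCont_def LIM_zero_iff)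
qed

section \<open>The delayed term and the scalar Duhamel formula\<close>

definition delayed :: "real \<Rightarrow> (real \<Rightarrow> real) \<Rightarrow> (real \<Rightarrow> real) \<Rightarrow> real \<Rightarrow> real" where
  "delayed \<tau> \<rho> y t = itg (\<lambda>r. \<rho> r * y (t + r)) (-\<tau>) 0"

lemma square_integrable_cut_continuous:
  assumes "continuous_on {a..b} \<rho>"
  shows "square_integrable (\<lambda>r. indicator {a..b} r * \<rho> r)"
proof -
  have m: "(\<lambda>r. indicator {a..b} r * \<rho> r) \<in> borel_measurable borel"
    using borel_measurable_continuous_on_indicator[OF _ assms] by simp
  have "bounded (\<rho> ` {a..b})" by (intro compact_imp_bounded compact_continuous_image assms) auto
  then obtain K where K: "\<And>r. r \<in> {a..b} \<Longrightarrow> \<bar>\<rho> r\<bar> \<le> K"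
    by (metis bounded_iff imageI real_norm_def)
  show ?thesis
    by (rule square_integrable_bounded_support[where c="max K 0" and a=a and b=b, OF m])
       (use K in \<open>auto simp: indicator_def le_max_iff_disj\<close>)
qed

lemma inner_cut_seg:
  assumes \<rho>: "continuous_on {-\<tau>..0} \<rho>" and y: "locally_L2 y"
  shows "inner (abs_l2 (\<lambda>r. indicator {-\<tau>..0} r * \<rho> r)) (seg \<tau> y) = itg (\<lambda>r. \<rho> r * y r) (-\<tau>) 0"
  unfolding seg_def
  by (subst inner_abs_l2[OF square_integrable_cut_continuous[OF \<rho>] locally_L2_cut[OF y]])
     (auto simp: itg_def indicator_def intro!: Bochner_Integration.integral_cong)

text \<open>Written as the inner product with a fixed element, \<open>C\<close> is visibly
  continuous along continuous curves in the phase space.\<close>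

lemma op_C_inner:
  assumes \<rho>: "continuous_on {-\<tau>..0} \<rho>"
  shows "op_C \<tau> \<rho> z = inner (abs_l2 (\<lambda>r. indicator {-\<tau>..0} r * \<rho> r)) (snd z)"
proof -
  have "inner (abs_l2 (\<lambda>r. indicator {-\<tau>..0} r * \<rho> r)) (abs_l2 (rep_l2 (snd z)))
      = (\<integral>r. (indicator {-\<tau>..0} r * \<rho> r) * rep_l2 (snd z) r \<partial>lborel)"
    by (rule inner_abs_l2[OF square_integrable_cut_continuous[OF \<rho>]]) simp
  then show ?thesis by (cases z) (simp add: op_C_def set_lebesgue_integral_def mult.assoc)
qed

lemma op_C_seg:
  assumes "continuous_on {-\<tau>..0} \<rho>" "locally_L2 y"
  shows "op_C \<tau> \<rho> (a, seg \<tau> (\<lambda>s. y (t + s))) = delayed \<tau> \<rho> y t"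
  using assms by (simp add: op_C_inner inner_cut_seg locally_L2_translate delayed_def)

lemma delayed_continuous:
  assumes "continuous_on {-\<tau>..0} \<rho>" "locally_L2 y"
  shows "continuous_on UNIV (delayed \<tau> \<rho> y)"
proof -
  have "continuous_on UNIV (\<lambda>t. inner (abs_l2 (\<lambda>r. indicator {-\<tau>..0} r * \<rho> r)) (seg \<tau> (\<lambda>s. y (t + s))))"
    by (intro continuous_intros seg_shift_continuous assms)
  then show ?thesis by (simp add: inner_cut_seg assms locally_L2_translate delayed_def[abs_def])
qed

text \<open>The forced part of the solution of x' = -\<open>lam\<close> x + \<open>\<xi>\<close>
  started at time \<open>p\<close>; by the convention in \<open>itg\<close> it is zero before
  \<open>p\<close>.\<close>

definition duhamel :: "real \<Rightarrow> real \<Rightarrow> (real \<Rightarrow> real) \<Rightarrow> real \<Rightarrow> real" where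
  "duhamel lam p \<xi> t = itg (\<lambda>s. exp (- lam * (t - s)) * \<xi> s) p t"

lemma duhamel_eq:
  assumes \<xi>: "continuous_on {p..} \<xi>" and t: "p \<le> t"
  shows "duhamel lam p \<xi> t = exp (- lam * t) * integral {p..t} (\<lambda>s. exp (lam * s) * \<xi> s)"
proof -
  have c: "continuous_on {p..t} (\<lambda>s. exp (lam * s) * \<xi> s)"
    by (intro continuous_intros continuous_on_subset[OF \<xi>]) auto
  have 1: "itg (\<lambda>s. exp (lam * s) * \<xi> s) p t = integral {p..t} (\<lambda>s. exp (lam * s) * \<xi> s)"
    using set_borel_integral_eq_integral(2)[OF borel_integrable_atLeastAtMost'[OF c]]
    by (simp add: itg_def set_lebesgue_integral_def)
  have 2: "exp (- lam * (t - s)) * \<xi> s = exp (- lam * t) * (exp (lam * s) * \<xi> s)" for s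
  proof -
    have "- lam * (t - s) = - lam * t + lam * s" by (simp add: algebra_simps)
    then show ?thesis by (simp only: exp_add mult.assoc)
  qed
  have "duhamel lam p \<xi> t = itg (\<lambda>s. exp (- lam * t) * (exp (lam * s) * \<xi> s)) p t"
    unfolding duhamel_def by (rule itg_cong) (rule 2)
  also have "\<dots> = exp (- lam * t) * itg (\<lambda>s. exp (lam * s) * \<xi> s) p t" by (rule itg_scale)
  finally show ?thesis by (simp only: 1)
qed

lemma duhamel_continuous:
  assumes \<xi>: "continuous_on {p..} \<xi>"
  shows "continuous_on {p..} (duhamel lam p \<xi>)"
proof -
  have "continuous_on {p..b} (\<lambda>t. exp (- lam * t) * integral {p..t} (\<lambda>s. exp (lam * s) * \<xi> s))" for b
    by (intro continuous_intros indefinite_integral_continuous_1 integrable_continuous_real continuous_on_subset[OF \<xi>]) auto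
  then have "continuous_on {p..b} (duhamel lam p \<xi>)" for b
    by (rule continuous_on_eq) (use duhamel_eq[OF \<xi>] in auto)
  then show ?thesis
    unfolding continuous_on_def
  proof (intro ballI)
    fix t assume *: "\<And>b. \<forall>x\<in>{p..b}. (duhamel lam p \<xi> \<longlongrightarrow> duhamel lam p \<xi> x) (at x within {p..b})" and t: "t \<in> {p..}"
    have "at t within {p..} = at t within {p..t+1}"
      by (rule at_within_nhd[of _ "{..<t+1}"]) auto
    then show "(duhamel lam p \<xi> \<longlongrightarrow> duhamel lam p \<xi> t) (at t within {p..})" using * t by simp
  qed
qed

lemma duhamel_empty: "t \<le> p \<Longrightarrow> duhamel lam p \<xi> t = 0"
  unfolding duhamel_def by (cases "t = p") (auto simp: itg_same itg_empty)

lemma duhamel_cong: "(\<And>s. p \<le> s \<Longrightarrow> s \<le> t \<Longrightarrow> \<xi> s = \<xi>' s) \<Longrightarrow> duhamel lam p \<xi> t = duhamel lam p \<xi>' t"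
  unfolding duhamel_def by (rule itg_cong) auto

lemma translation_semigroup_scaleR_one:
  "translation_semigroup lam \<tau> t (c, 0) = c *\<^sub>R translation_semigroup lam \<tau> t (1, 0)"
  using translation_semigroup_linear[of lam \<tau> t c "(1, 0)" 0 "(1, 0)"] by simp

lemma locally_L2_duhamel:
  assumes \<xi>: "continuous_on {p..} \<xi>"
  shows "locally_L2 (duhamel lam p \<xi>)"
proof -
  have "locally_L2 (\<lambda>r. if r < p then 0 else duhamel lam p \<xi> r)"
    by (intro locally_L2_if duhamel_continuous[OF \<xi>] locally_L2_continuous) simp
  then show ?thesis by (rule back_subst[of locally_L2]) (auto simp: fun_eq_iff duhamel_empty)
qed

text \<open>By \<open>has_integral_weakI\<close> it suffices to test against vectors
  \<open>w\<close>. The history component becomes a double integral over the input time s and the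
  position r in the window, and Fubini's theorem turns the inner integral into
  \<open>duhamel\<close> at time t + r.\<close>

lemma has_integral_duhamel:
  assumes lam: "lam > 0" and \<tau>: "\<tau> > 0" and \<xi>: "continuous_on {p..} \<xi>" and t: "p \<le> t"
  shows "((\<lambda>s. translation_semigroup lam \<tau> (t - s) (\<xi> s, 0)) has_integral
     (duhamel lam p \<xi> t, seg \<tau> (\<lambda>r. duhamel lam p \<xi> (t + r)))) {p..t}"
proof (rule has_integral_weakI[OF t])
  have "(1, 0) \<in> H \<tau>" using subspace_0[OF subspace_H, of \<tau>] by (simp add: H_iff zero_prod_def)
  then have "continuous_on {0..} (\<lambda>s. translation_semigroup lam \<tau> s (1, 0))"
    using lam by (intro semigroup_continuous[OF C0_translation_semigroup subspace_H]) auto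
  then have "continuous_on {p..t} (\<lambda>s. translation_semigroup lam \<tau> (t - s) (1, 0))"
    by (rule continuous_on_compose2) (auto intro!: continuous_intros)
  then have "continuous_on {p..t} (\<lambda>s. \<xi> s *\<^sub>R translation_semigroup lam \<tau> (t - s) (1, 0))"
    by (intro continuous_intros continuous_on_subset[OF \<xi>]) auto
  then show "continuous_on {p..t} (\<lambda>s. translation_semigroup lam \<tau> (t - s) (\<xi> s, 0))"
    by (simp add: translation_semigroup_scaleR_one[symmetric])
next
  fix w :: "real \<times> l2"
  define c \<zeta> where "c = fst w" and "\<zeta> = snd w"
  have w: "w = (c, \<zeta>)" by (simp add: c_def \<zeta>_def)
  define f where "f s = indicator {p..t} s * \<xi> s" for s
  define g where "g r = indicator {-\<tau>..0} r * rep_l2 \<zeta> r" for r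
  define k where "k s r = (if s \<le> t + r then exp (- lam * (max 0 (t + r - s))) else 0)" for s r
  have cI: "continuous_on {p..t} \<xi>" by (rule continuous_on_subset[OF \<xi>]) auto
  have f: "integrable lborel f" unfolding f_def
    using borel_integrable_atLeastAtMost'[OF cI] by (simp add: set_integrable_def)
  have g: "integrable lborel g" unfolding g_def by (rule locally_L2_integrable) simp
  have k: "case_prod k \<in> borel_measurable (lborel \<Otimes>\<^sub>M lborel)" unfolding k_def by measurable
  have kb: "norm (k s r) \<le> 1" for s r using lam by (simp add: k_def)
  have Dk: "duhamel lam p \<xi> (t + r) = (\<integral>s. f s * k s r \<partial>lborel)" if "r \<le> 0" for r
    unfolding duhamel_def itg_def f_def k_def using that
    by (auto intro!: Bochner_Integration.integral_cong simp: indicator_def)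
  have 1: "indicator {p..t} s *\<^sub>R inner (translation_semigroup lam \<tau> (t - s) (\<xi> s, 0)) w
      = c * (f s * k s 0) + f s * (\<integral>r. g r * k s r \<partial>lborel)" for s
  proof (cases "s \<in> {p..t}")
    case True
    have "inner \<zeta> (seg \<tau> (\<lambda>r. extend lam (\<xi> s, 0) (t - s + r)))
        = (\<integral>r. indicator {-\<tau>..0} r * (rep_l2 \<zeta> r * extend lam (\<xi> s, 0) (t - s + r)) \<partial>lborel)"
      by (rule inner_seg) simp
    also have "\<dots> = (\<integral>r. \<xi> s * (g r * k s r) \<partial>lborel)"
    proof (rule integral_cong_AE)
      \<comment> \<open>The injected state has zero history, but the representative of 0 vanishes
        almost everywhere only.\<close>
      have "AE r in lborel. rep_l2 (0::l2) r = 0"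
        using rep_abs_l2[of "\<lambda>_. 0"] by (simp add: abs_l2_0 square_integrable_zero)
      from AE_translate[OF this, of "t - s"]
      show "AE r in lborel. indicator {-\<tau>..0} r * (rep_l2 \<zeta> r * extend lam (\<xi> s, 0) (t - s + r)) = \<xi> s * (g r * k s r)"
        by (rule eventually_mono) (auto simp: extend_def g_def k_def indicator_def algebra_simps)
      have [measurable]: "extend lam (\<xi> s, 0) \<in> borel_measurable borel" by (rule locally_L2_measurable) simp
      show "(\<lambda>r. indicator {-\<tau>..0} r * (rep_l2 \<zeta> r * extend lam (\<xi> s, 0) (t - s + r))) \<in> borel_measurable lborel"
        by measurable
      show "(\<lambda>r. \<xi> s * (g r * k s r)) \<in> borel_measurable lborel" unfolding g_def k_def by measurable
    qed
    finally have "inner (seg \<tau> (\<lambda>r. extend lam (\<xi> s, 0) (t - s + r))) \<zeta> = \<xi> s * (\<integral>r. g r * k s r \<partial>lborel)"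
      by (simp add: inner_commute)
    then show ?thesis using True by (simp add: w translation_semigroup_def f_def k_def algebra_simps)
  qed (simp add: f_def)
  have i0: "integrable lborel (\<lambda>s. f s * k s 0)"
  proof (rule Bochner_Integration.integrable_bound[OF f])
    show "(\<lambda>s. f s * k s 0) \<in> borel_measurable lborel"
      using f unfolding k_def by measurable
    show "AE s in lborel. norm (f s * k s 0) \<le> norm (f s)"
      using kb by (intro AE_I2) (simp add: abs_mult mult_left_le)
  qed
  have int: "set_integrable lborel {p..t} (\<lambda>s. inner (translation_semigroup lam \<tau> (t - s) (\<xi> s, 0)) w)"
    unfolding set_integrable_def 1 using i0 Fubini_kernel(2)[OF f g k kb] by simp
  have "(LINT s:{p..t}|lborel. inner (translation_semigroup lam \<tau> (t - s) (\<xi> s, 0)) w)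
      = c * (\<integral>s. f s * k s 0 \<partial>lborel) + (\<integral>s. f s * (\<integral>r. g r * k s r \<partial>lborel) \<partial>lborel)"
    unfolding set_lebesgue_integral_def 1 using i0 Fubini_kernel(2)[OF f g k kb] by simp
  also have "\<dots> = c * duhamel lam p \<xi> t + (\<integral>r. g r * (\<integral>s. f s * k s r \<partial>lborel) \<partial>lborel)"
    using Dk[of 0] Fubini_kernel(1)[OF f g k kb] by simp
  also have "(\<integral>r. g r * (\<integral>s. f s * k s r \<partial>lborel) \<partial>lborel)
      = (\<integral>r. indicator {-\<tau>..0} r * (rep_l2 \<zeta> r * duhamel lam p \<xi> (t + r)) \<partial>lborel)"
    by (rule Bochner_Integration.integral_cong) (auto simp: g_def indicator_def Dk)
  also have "\<dots> = inner \<zeta> (seg \<tau> (\<lambda>r. duhamel lam p \<xi> (t + r)))"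
    by (rule inner_seg[symmetric]) (intro locally_L2_translate locally_L2_duhamel[OF \<xi>])
  finally have "integral {p..t} (\<lambda>s. inner (translation_semigroup lam \<tau> (t - s) (\<xi> s, 0)) w)
      = inner (duhamel lam p \<xi> t, seg \<tau> (\<lambda>r. duhamel lam p \<xi> (t + r))) w"
    using set_borel_integral_eq_integral(2)[OF int] by (simp add: w inner_commute)
  then show "((\<lambda>s. inner (translation_semigroup lam \<tau> (t - s) (\<xi> s, 0)) w) has_integral
      inner (duhamel lam p \<xi> t, seg \<tau> (\<lambda>r. duhamel lam p \<xi> (t + r))) w) {p..t}"
    using set_borel_integral_eq_integral(1)[OF int] by (metis integrable_integral)
qed

text \<open>The scalar function whose segments are the histories along the solution:
  \<open>\<phi>\<close> is moved so that it ends at the initial time \<open>p\<close>.\<close>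

definition hist :: "real \<Rightarrow> (real \<Rightarrow> real) \<Rightarrow> l2 \<Rightarrow> real \<Rightarrow> real" where
  "hist p x \<phi> r = (if r < p then rep_l2 \<phi> (r - p) else x r)"

definition state :: "real \<Rightarrow> (real \<Rightarrow> real) \<Rightarrow> real \<Rightarrow> real \<times> l2" where
  "state \<tau> y t = (y t, seg \<tau> (\<lambda>s. y (t + s)))"

lemma locally_L2_hist: "continuous_on {p..} x \<Longrightarrow> locally_L2 (hist p x \<phi>)"
proof -
  assume x: "continuous_on {p..} x"
  have "locally_L2 (\<lambda>r. rep_l2 \<phi> (-p + r))" by (rule locally_L2_translate) simp
  then have "locally_L2 (\<lambda>r. if r < p then rep_l2 \<phi> (-p + r) else x r)" by (rule locally_L2_if[OF _ x])
  then show ?thesis by (rule back_subst[of locally_L2]) (auto simp: hist_def fun_eq_iff)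
qed

lemma delayed_cong_AE:
  assumes "continuous_on {-\<tau>..0} \<rho>" "locally_L2 y" "locally_L2 z"
    and "AE r in lborel. r \<in> {t-\<tau>..t} \<longrightarrow> y r = z r"
  shows "delayed \<tau> \<rho> y t = delayed \<tau> \<rho> z t"
proof -
  have "seg \<tau> (\<lambda>s. y (t + s)) = seg \<tau> (\<lambda>s. z (t + s))"
    by (intro seg_cong locally_L2_translate assms)
       (use AE_translate[OF assms(4), of t] in \<open>auto elim!: eventually_mono\<close>)
  then show ?thesis using op_C_seg[OF assms(1,2), of 0 t] op_C_seg[OF assms(1,3), of 0 t] by simp
qed

lemma delayed_cong: "(\<And>r. t - \<tau> \<le> r \<Longrightarrow> r \<le> t \<Longrightarrow> y r = z r) \<Longrightarrow> delayed \<tau> \<rho> y t = delayed \<tau> \<rho> z t"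
  unfolding delayed_def by (rule itg_cong) auto

lemma delayed_shift: "delayed \<tau> \<rho> (\<lambda>r. y (r + d)) t = delayed \<tau> \<rho> y (t + d)"
  unfolding delayed_def by (rule itg_cong) (simp add: ac_simps)

lemma delayed_diff:
  assumes "continuous_on {-\<tau>..0} \<rho>" "locally_L2 y" "locally_L2 z"
  shows "delayed \<tau> \<rho> (\<lambda>r. y r - z r) t = delayed \<tau> \<rho> y t - delayed \<tau> \<rho> z t"
proof -
  have "seg \<tau> (\<lambda>s. y (t + s)) - seg \<tau> (\<lambda>s. z (t + s)) = seg \<tau> (\<lambda>s. y (t + s) - z (t + s))"
    by (intro seg_diff locally_L2_translate assms)
  then show ?thesis
    using assms by (simp add: delayed_def inner_cut_seg[symmetric] locally_L2_translate locally_L2_diff inner_diff_right[symmetric])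
qed

lemma itg_abs_le:
  assumes "a \<le> b" and le: "\<And>r. a \<le> r \<Longrightarrow> r \<le> b \<Longrightarrow> \<bar>y r\<bar> \<le> z r" and z: "integrable lborel (\<lambda>r. indicator {a..b} r * z r)"
  shows "\<bar>itg y a b\<bar> \<le> itg z a b"
proof -
  have "norm (itg y a b) \<le> (\<integral>r. norm (indicator {a..b} r * y r) \<partial>lborel)"
    unfolding itg_def by (rule integral_norm_bound)
  also have "\<dots> \<le> itg z a b"
    unfolding itg_def
  proof (rule integral_mono_AE')
    show "AE r in lborel. norm (indicator {a..b} r * y r) \<le> indicator {a..b} r * z r"
      using le by (intro AE_I2) (auto simp: indicator_def)
    show "AE r in lborel. 0 \<le> indicator {a..b} r * z r"
      using order_trans[OF abs_ge_zero le] by (intro AE_I2) (auto simp: indicator_def)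
  qed (rule z)
  finally show ?thesis by simp
qed

lemma itg_const: "a \<le> b \<Longrightarrow> itg (\<lambda>_. c) a b = c * (b - a)"
  unfolding itg_def by simp

lemma itg_abs_le_const:
  assumes "a \<le> b" "\<And>r. a \<le> r \<Longrightarrow> r \<le> b \<Longrightarrow> \<bar>y r\<bar> \<le> c"
  shows "\<bar>itg y a b\<bar> \<le> c * (b - a)"
  using itg_abs_le[of a b y "\<lambda>_. c"] assms
  by (simp add: itg_const integrable_indicator_iff emeasure_lborel_Icc_eq)

text \<open>What existence and uniqueness use: a Lipschitz constant \<open>\<mu>\<close> and a bound
  \<open>F0\<close> on the forcing at zero delay value, uniform in time. Periodicity and
  monotonicity are added in \<open>periodic_delay_equation\<close>.\<close>

locale delay_equation =
  fixes lam \<tau> b \<mu> F0 :: real and \<rho> g :: "real \<Rightarrow> real" and f :: "real \<Rightarrow> real \<Rightarrow> real"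
  assumes lam: "lam > 0" and \<tau>: "\<tau> > 0" and \<mu>: "\<mu> > 0" and b: "\<bar>b\<bar> = 1"
    and \<rho>: "continuous_on {-\<tau>..0} \<rho>" and g: "continuous_on UNIV g"
    and f: "continuous_on UNIV (\<lambda>(t, v). f t v)"
    and Lip: "\<And>t v w. \<bar>f t v - f t w\<bar> \<le> \<mu> * \<bar>v - w\<bar>"
    and bounded_forcing: "\<And>t. \<bar>f t 0\<bar> + \<bar>g t\<bar> \<le> F0"
begin

definition forcing :: "(real \<Rightarrow> real) \<Rightarrow> real \<Rightarrow> real" where
  "forcing y t = b * f t (delayed \<tau> \<rho> y t) + g t"

lemma continuous_on_f:
  assumes "continuous_on S v" shows "continuous_on S (\<lambda>t. f t (v t))"
proof -
  have "continuous_on S (\<lambda>t. (t, v t))" using assms by (intro continuous_intros)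
  from continuous_on_compose2[OF f this] show ?thesis by simp
qed

lemma forcing_continuous: "locally_L2 y \<Longrightarrow> continuous_on UNIV (forcing y)"
  unfolding forcing_def
  by (intro continuous_intros continuous_on_f delayed_continuous \<rho> g)

lemma forcing_cong: "(\<And>r. t - \<tau> \<le> r \<Longrightarrow> r \<le> t \<Longrightarrow> y r = z r) \<Longrightarrow> forcing y t = forcing z t"
  unfolding forcing_def using delayed_cong[of t \<tau> y z \<rho>] by simp

lemma forcing_cong_AE:
  "locally_L2 y \<Longrightarrow> locally_L2 z \<Longrightarrow> AE r in lborel. r \<in> {t-\<tau>..t} \<longrightarrow> y r = z r \<Longrightarrow> forcing y t = forcing z t"
  unfolding forcing_def using delayed_cong_AE[OF \<rho>, of y z t] by simp

text \<open>The first component of the mild equation. The second component of a state is then a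
  segment of \<open>hist\<close> and requires no equation of its own.\<close>

definition solution :: "real \<Rightarrow> real \<times> l2 \<Rightarrow> (real \<Rightarrow> real) \<Rightarrow> bool" where
  "solution p u0 x \<longleftrightarrow> continuous_on {p..} x \<and>
     (\<forall>t\<ge>p. x t = fst u0 * exp (- lam * (t - p)) + duhamel lam p (forcing (hist p x (snd u0))) t)"

lemma state_continuous:
  assumes "locally_L2 y" "continuous_on S y" shows "continuous_on S (state \<tau> y)"
  unfolding state_def
  using continuous_on_subset[OF seg_shift_continuous[OF assms(1)]] assms(2)
  by (intro continuous_on_Pair) auto

lemma state_in_H: "locally_L2 y \<Longrightarrow> state \<tau> y t \<in> H \<tau>"
  by (simp add: state_def H_iff seg_in_L2_on locally_L2_translate)

text \<open>Subtract the free evolution of \<open>u0\<close> from \<open>y\<close>. Before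
  \<open>p\<close> the two coincide and \<open>duhamel\<close> is zero; after \<open>p\<close> the
  difference is \<open>duhamel\<close> by the scalar equation. Taking segments gives the equation in
  the phase space.\<close>

lemma mild_solution_of_solution:
  assumes u0: "u0 \<in> H \<tau>" and x: "solution p u0 x"
  shows "mild_solution lam \<tau> b \<rho> f g p u0 (state \<tau> (hist p x (snd u0)))"
proof -
  define y where "y = hist p x (snd u0)"
  have xc: "continuous_on {p..} x" using x by (simp add: solution_def)
  have y: "locally_L2 y" unfolding y_def by (rule locally_L2_hist[OF xc])
  have yc: "continuous_on {p..} y"
    using xc by (rule continuous_on_eq) (simp add: y_def hist_def)
  have \<xi>: "continuous_on {p..} (forcing y)" using forcing_continuous[OF y] continuous_on_subset by blast
  have "((\<lambda>s. delay_semigroup lam \<tau> (t - s) (op_B b (f s (op_C \<tau> \<rho> (state \<tau> y s))) + (g s, 0)))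
        has_integral (state \<tau> y t - delay_semigroup lam \<tau> (t - p) u0)) {p..t}" if t: "p \<le> t" for t
  proof -
    have D: "locally_L2 (\<lambda>r. duhamel lam p (forcing y) (t + r))"
      by (intro locally_L2_translate locally_L2_duhamel \<xi>)
    have "state \<tau> y t - translation_semigroup lam \<tau> (t - p) u0
        = (duhamel lam p (forcing y) t, seg \<tau> (\<lambda>r. duhamel lam p (forcing y) (t + r)))"
    proof -
      have xt: "x r = fst u0 * exp (- lam * (r - p)) + duhamel lam p (forcing y) r" if "p \<le> r" for r
        using x that unfolding y_def by (simp add: solution_def)
      have "y t - fst u0 * exp (- lam * (t - p)) = duhamel lam p (forcing y) t"
        using xt[OF t] t by (simp add: y_def hist_def)
      moreover have "(\<lambda>r. y (t + r) - extend lam u0 (t - p + r)) = (\<lambda>r. duhamel lam p (forcing y) (t + r))"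
      proof
        fix r
        show "y (t + r) - extend lam u0 (t - p + r) = duhamel lam p (forcing y) (t + r)"
        proof (cases "t + r < p")
          case True
          then show ?thesis by (simp add: y_def hist_def extend_def duhamel_empty algebra_simps)
        next
          case False
          then show ?thesis using xt[of "t + r"] by (simp add: y_def hist_def extend_def algebra_simps)
        qed
      qed
      ultimately show ?thesis
        by (simp add: state_def translation_semigroup_def seg_diff locally_L2_translate y)
    qed
    moreover have "((\<lambda>s. translation_semigroup lam \<tau> (t - s) (forcing y s, 0)) has_integral
        (duhamel lam p (forcing y) t, seg \<tau> (\<lambda>r. duhamel lam p (forcing y) (t + r)))) {p..t}"
      by (rule has_integral_duhamel[OF lam \<tau> \<xi> t])
    moreover have "delay_semigroup lam \<tau> (t - s) (op_B b (f s (op_C \<tau> \<rho> (state \<tau> y s))) + (g s, 0))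
        = translation_semigroup lam \<tau> (t - s) (forcing y s, 0)" if "s \<in> {p..t}" for s
    proof -
      have "(forcing y s, 0) \<in> H \<tau>" using subspace_0[OF subspace_H, of \<tau>] by (simp add: H_iff zero_prod_def)
      moreover have "op_B b (f s (op_C \<tau> \<rho> (state \<tau> y s))) + (g s, 0) = (forcing y s, 0)"
        by (simp add: op_B_def state_def op_C_seg[OF \<rho> y] forcing_def)
      ultimately show ?thesis using delay_semigroup_eq[OF \<tau> lam, of "t - s"] that by simp
    qed
    ultimately show ?thesis
      using delay_semigroup_eq[OF \<tau> lam, of "t - p" u0] u0 t
      by (subst has_integral_cong[where g="\<lambda>s. translation_semigroup lam \<tau> (t - s) (forcing y s, 0)"]) simp_all
  qed
  then show ?thesis
    unfolding mild_solution_def y_def[symmetric]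
    using state_continuous[OF y yc] state_in_H[OF y] by blast
qed

text \<open>The input \<open>\<xi>\<close> is first read off from the given \<open>u\<close>, so
  that the Duhamel formula shows that the second component of \<open>u\<close> consists of segments.
  Only then can \<open>op_C\<close> be evaluated as a delayed term and \<open>\<xi>\<close> be
  recognized as the forcing.\<close>

lemma solution_of_mild_solution:
  assumes u0: "u0 \<in> H \<tau>" and u: "mild_solution lam \<tau> b \<rho> f g p u0 u"
  shows "solution p u0 (\<lambda>t. fst (u t))"
    and "\<And>t. t \<ge> p \<Longrightarrow> u t = state \<tau> (hist p (\<lambda>t. fst (u t)) (snd u0)) t"
proof -
  define x where "x t = fst (u t)" for t
  define y where "y = hist p x (snd u0)"
  define \<xi> where "\<xi> s = b * f s (op_C \<tau> \<rho> (u s)) + g s" for s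
  have uc: "continuous_on {p..} u" and uH: "\<And>t. t \<ge> p \<Longrightarrow> u t \<in> H \<tau>"
    and ui: "\<And>t. t \<ge> p \<Longrightarrow> ((\<lambda>s. delay_semigroup lam \<tau> (t - s) (op_B b (f s (op_C \<tau> \<rho> (u s))) + (g s, 0)))
        has_integral (u t - delay_semigroup lam \<tau> (t - p) u0)) {p..t}"
    using u by (auto simp: mild_solution_def)
  have xc: "continuous_on {p..} x" unfolding x_def by (intro continuous_on_fst uc)
  have y: "locally_L2 y" unfolding y_def by (rule locally_L2_hist[OF xc])
  have \<xi>: "continuous_on {p..} \<xi>"
    unfolding \<xi>_def op_C_inner[OF \<rho>]
    by (intro continuous_intros continuous_on_f uc continuous_on_subset[OF g]) auto
  have main: "u t = translation_semigroup lam \<tau> (t - p) u0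
      + (duhamel lam p \<xi> t, seg \<tau> (\<lambda>r. duhamel lam p \<xi> (t + r)))" if t: "t \<ge> p" for t
  proof -
    have "delay_semigroup lam \<tau> (t - s) (op_B b (f s (op_C \<tau> \<rho> (u s))) + (g s, 0))
        = translation_semigroup lam \<tau> (t - s) (\<xi> s, 0)" if "s \<in> {p..t}" for s
    proof -
      have "(\<xi> s, 0) \<in> H \<tau>" using subspace_0[OF subspace_H, of \<tau>] by (simp add: H_iff zero_prod_def)
      then show ?thesis using delay_semigroup_eq[OF \<tau> lam, of "t - s"] that by (simp add: op_B_def \<xi>_def)
    qed
    then have "((\<lambda>s. translation_semigroup lam \<tau> (t - s) (\<xi> s, 0)) has_integral (u t - translation_semigroup lam \<tau> (t - p) u0)) {p..t}"
      using ui[OF t] delay_semigroup_eq[OF \<tau> lam, of "t - p" u0] u0 t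
      by (subst (asm) has_integral_cong[where g="\<lambda>s. translation_semigroup lam \<tau> (t - s) (\<xi> s, 0)"]) simp_all
    from has_integral_unique[OF this has_integral_duhamel[OF lam \<tau> \<xi> t]] show ?thesis by (simp add: algebra_simps)
  qed
  have xt: "x t = fst u0 * exp (- lam * (t - p)) + duhamel lam p \<xi> t" if "t \<ge> p" for t
    using main[OF that] by (simp add: x_def translation_semigroup_def)
  have ut: "u t = state \<tau> y t" if t: "t \<ge> p" for t
  proof -
    have "(\<lambda>r. extend lam u0 (t - p + r) + duhamel lam p \<xi> (t + r)) = (\<lambda>r. y (t + r))"
    proof
      fix r
      show "extend lam u0 (t - p + r) + duhamel lam p \<xi> (t + r) = y (t + r)"
      proof (cases "t + r < p")
        case True
        then show ?thesis by (simp add: y_def hist_def extend_def duhamel_empty algebra_simps)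
      next
        case False
        then show ?thesis using xt[of "t + r"] by (simp add: y_def hist_def extend_def algebra_simps)
      qed
    qed
    then have "snd (u t) = seg \<tau> (\<lambda>r. y (t + r))"
      unfolding main[OF t]
      by (simp add: translation_semigroup_def seg_add locally_L2_translate[OF locally_L2_duhamel[OF \<xi>]])
    then show ?thesis using t by (simp add: state_def prod_eq_iff y_def hist_def x_def)
  qed
  have "\<xi> s = forcing y s" if "s \<ge> p" for s
    unfolding \<xi>_def forcing_def ut[OF that] state_def op_C_seg[OF \<rho> y] ..
  then have "duhamel lam p \<xi> t = duhamel lam p (forcing y) t" for t
    by (intro duhamel_cong) auto
  then show "solution p u0 (\<lambda>t. fst (u t))"
    using xc xt unfolding solution_def x_def[symmetric] y_def by simp
  show "u t = state \<tau> (hist p (\<lambda>t. fst (u t)) (snd u0)) t" if "t \<ge> p" for t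
    using ut[OF that] unfolding y_def x_def .
qed

text \<open>The weight \<open>exp (kap * (t - p))\<close> makes the Duhamel operator a contraction with factor \<open>1/2\<close>.\<close>

definition kap :: real where
  "kap = 2 * \<mu> * (SUP r\<in>{-\<tau>..0}. \<bar>\<rho> r\<bar>) * \<tau> + 1"

lemma \<rho>_bound:
  assumes "r \<in> {-\<tau>..0}" shows "\<bar>\<rho> r\<bar> \<le> (SUP r\<in>{-\<tau>..0}. \<bar>\<rho> r\<bar>)"
proof -
  have "compact ((\<lambda>r. \<bar>\<rho> r\<bar>) ` {-\<tau>..0})" by (intro compact_continuous_image continuous_intros \<rho>) auto
  then have "bdd_above ((\<lambda>r. \<bar>\<rho> r\<bar>) ` {-\<tau>..0})" by (intro bounded_imp_bdd_above compact_imp_bounded)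
  then show ?thesis using assms by (intro cSUP_upper)
qed

lemma \<rho>_bound_nonneg: "(SUP r\<in>{-\<tau>..0}. \<bar>\<rho> r\<bar>) \<ge> 0"
  using \<rho>_bound[of 0] \<tau> by force

lemma kap_ge_1: "kap \<ge> 1"
  using \<rho>_bound_nonneg \<mu> \<tau> by (simp add: kap_def)

text \<open>The damping factor is estimated by 1; the gain 1/\<open>k\<close> comes from integrating
  the growing exponential.\<close>

lemma duhamel_exp_bound:
  assumes t: "p \<le> t" and c: "c \<ge> 0" and k: "k > 0"
    and le: "\<And>s. p \<le> s \<Longrightarrow> s \<le> t \<Longrightarrow> \<bar>\<xi> s\<bar> \<le> c * exp (k * (s - p))"
  shows "\<bar>duhamel lam p \<xi> t\<bar> \<le> c / k * exp (k * (t - p))"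
proof -
  have cc: "continuous_on {p..t} (\<lambda>s. c * exp (k * (s - p)))" by (intro continuous_intros)
  have "\<bar>duhamel lam p \<xi> t\<bar> \<le> itg (\<lambda>s. c * exp (k * (s - p))) p t"
    unfolding duhamel_def
  proof (rule itg_abs_le[OF t])
    fix s assume s: "p \<le> s" "s \<le> t"
    have "\<bar>exp (- lam * (t - s)) * \<xi> s\<bar> \<le> 1 * \<bar>\<xi> s\<bar>"
      unfolding abs_mult using s lam by (intro mult_right_mono) auto
    then show "\<bar>exp (- lam * (t - s)) * \<xi> s\<bar> \<le> c * exp (k * (s - p))" using le[OF s] by simp
  next
    show "integrable lborel (\<lambda>s. indicator {p..t} s * (c * exp (k * (s - p))))"
      using borel_integrable_atLeastAtMost'[OF cc] by (simp add: set_integrable_def)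
  qed
  also have "\<dots> = c / k * exp (k * (t - p)) - c / k * exp (k * (p - p))"
    by (rule itg_continuous_FTC[OF t _ cc]) (use k in \<open>auto intro!: derivative_eq_intros\<close>)
  also have "\<dots> \<le> c / k * exp (k * (t - p))" using c k by simp
  finally show ?thesis .
qed

text \<open>The delayed term at time s sees only values up to s, where the weight is at most
  exp(\<open>kap\<close> (s - p)), so it costs a factor \<open>R * \<tau>\<close> and the Lipschitz
  bound a factor \<open>\<mu>\<close>. The time integral divides by \<open>kap\<close>, which
  exceeds twice this product.\<close>

lemma forcing_contraction:
  assumes y: "locally_L2 y" and z: "locally_L2 z" and t: "p \<le> t" and M: "M \<ge> 0"
    and before: "\<And>r. r < p \<Longrightarrow> y r = z r"
    and after: "\<And>r. p \<le> r \<Longrightarrow> r \<le> t \<Longrightarrow> \<bar>y r - z r\<bar> \<le> M * exp (kap * (r - p))"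
  shows "\<bar>duhamel lam p (forcing y) t - duhamel lam p (forcing z) t\<bar> \<le> M / 2 * exp (kap * (t - p))"
proof -
  define R where "R = (SUP r\<in>{-\<tau>..0}. \<bar>\<rho> r\<bar>)"
  have R: "R \<ge> 0" "\<And>r. r \<in> {-\<tau>..0} \<Longrightarrow> \<bar>\<rho> r\<bar> \<le> R" using \<rho>_bound \<rho>_bound_nonneg by (auto simp: R_def)
  have kap: "kap = 2 * \<mu> * R * \<tau> + 1" "kap > 0" using kap_ge_1 by (simp add: kap_def R_def, linarith)
  have cy: "continuous_on {p..t} (\<lambda>s. exp (- lam * (t - s)) * forcing y s)"
    and cz: "continuous_on {p..t} (\<lambda>s. exp (- lam * (t - s)) * forcing z s)"
    by (intro continuous_intros continuous_on_subset[OF forcing_continuous[OF y]] continuous_on_subset[OF forcing_continuous[OF z]]; simp)+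
  have eq: "duhamel lam p (forcing y) t - duhamel lam p (forcing z) t = duhamel lam p (\<lambda>s. forcing y s - forcing z s) t"
    unfolding duhamel_def itg_def
    using borel_integrable_atLeastAtMost'[OF cy] borel_integrable_atLeastAtMost'[OF cz]
    by (simp add: set_integrable_def right_diff_distrib)
  have "\<bar>duhamel lam p (\<lambda>s. forcing y s - forcing z s) t\<bar> \<le> \<mu> * (R * \<tau> * M) / kap * exp (kap * (t - p))"
  proof (rule duhamel_exp_bound[OF t _ kap(2)])
    fix s assume s: "p \<le> s" "s \<le> t"
    have "\<bar>delayed \<tau> \<rho> (\<lambda>r. y r - z r) s\<bar> \<le> R * (M * exp (kap * (s - p))) * (0 - - \<tau>)"
      unfolding delayed_def
    proof (rule itg_abs_le_const)
      fix r assume r: "-\<tau> \<le> r" "r \<le> 0"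
      have "\<bar>y (s + r) - z (s + r)\<bar> \<le> M * exp (kap * (s - p))"
      proof (cases "s + r < p")
        case True
        then show ?thesis using before M by simp
      next
        case False
        then have "\<bar>y (s + r) - z (s + r)\<bar> \<le> M * exp (kap * (s + r - p))" using after[of "s + r"] s r by simp
        also have "\<dots> \<le> M * exp (kap * (s - p))" using r M kap(2) by (intro mult_left_mono) auto
        finally show ?thesis .
      qed
      then show "\<bar>\<rho> r * (y (s + r) - z (s + r))\<bar> \<le> R * (M * exp (kap * (s - p)))"
        unfolding abs_mult using R r M by (intro mult_mono) auto
    qed (use \<tau> in simp)
    then have d: "\<bar>delayed \<tau> \<rho> y s - delayed \<tau> \<rho> z s\<bar> \<le> R * \<tau> * M * exp (kap * (s - p))"
      unfolding delayed_diff[OF \<rho> y z] by (simp add: ac_simps)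
    have "\<bar>forcing y s - forcing z s\<bar> = \<bar>f s (delayed \<tau> \<rho> y s) - f s (delayed \<tau> \<rho> z s)\<bar>"
      using b by (simp add: forcing_def right_diff_distrib[symmetric] abs_mult)
    also have "\<dots> \<le> \<mu> * \<bar>delayed \<tau> \<rho> y s - delayed \<tau> \<rho> z s\<bar>" by (rule Lip)
    also have "\<dots> \<le> \<mu> * (R * \<tau> * M * exp (kap * (s - p)))" using d \<mu> by (intro mult_left_mono) auto
    finally show "\<bar>forcing y s - forcing z s\<bar> \<le> \<mu> * (R * \<tau> * M) * exp (kap * (s - p))" by (simp add: ac_simps)
  qed (use \<mu> R \<tau> M in auto)
  also have "\<dots> \<le> M / 2 * exp (kap * (t - p))"
  proof (intro mult_right_mono)
    have "2 * (\<mu> * (R * \<tau> * M)) \<le> M * kap" unfolding kap(1) using M by (simp add: algebra_simps)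
    then show "\<mu> * (R * \<tau> * M) / kap \<le> M / 2" using kap(2) by (simp add: field_simps)
  qed simp
  finally show ?thesis unfolding eq .
qed

text \<open>For the maximum \<open>M\<close> of the weighted difference on [p, t] the contraction
  gives \<open>M\<close> at most \<open>M/2\<close>.\<close>

lemma solution_unique:
  assumes x: "solution p u0 x" and x': "solution p u0 x'" and t: "t \<ge> p"
  shows "x t = x' t"
proof -
  have c: "continuous_on {p..t} (\<lambda>s. exp (- kap * (s - p)) * \<bar>x s - x' s\<bar>)"
    using x x' unfolding solution_def
    by (intro continuous_intros) (auto intro: continuous_on_subset)
  obtain m where m: "m \<in> {p..t}" "\<And>s. s \<in> {p..t} \<Longrightarrow> exp (- kap * (s - p)) * \<bar>x s - x' s\<bar> \<le> exp (- kap * (m - p)) * \<bar>x m - x' m\<bar>"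
    using continuous_attains_sup[OF _ _ c] t by auto
  define M where "M = exp (- kap * (m - p)) * \<bar>x m - x' m\<bar>"
  have M0: "M \<ge> 0" by (simp add: M_def)
  have bd: "\<bar>x s - x' s\<bar> \<le> M * exp (kap * (s - p))" if "s \<in> {p..t}" for s
  proof -
    have "\<bar>x s - x' s\<bar> = exp (kap * (s - p)) * (exp (- kap * (s - p)) * \<bar>x s - x' s\<bar>)"
      by (simp add: mult.assoc[symmetric] exp_add[symmetric])
    also have "\<dots> \<le> exp (kap * (s - p)) * M" unfolding M_def using m(2)[OF that] by (intro mult_left_mono) auto
    finally show ?thesis by (simp add: mult.commute)
  qed
  have "\<bar>x m - x' m\<bar> \<le> M / 2 * exp (kap * (m - p))"
  proof -
    have eq: "x m - x' m = duhamel lam p (forcing (hist p x (snd u0))) m - duhamel lam p (forcing (hist p x' (snd u0))) m"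
      using x x' m(1) by (simp add: solution_def)
    show ?thesis unfolding eq
      by (rule forcing_contraction)
         (use x x' m(1) bd M0 in \<open>auto simp: solution_def hist_def intro!: locally_L2_hist\<close>)
  qed
  then have "M \<le> exp (- kap * (m - p)) * (M / 2 * exp (kap * (m - p)))"
    unfolding M_def by (intro mult_left_mono) auto
  also have "\<dots> = M / 2" by (simp add: ac_simps exp_add[symmetric])
  finally have "M = 0" using M0 by simp
  then show ?thesis using bd[of t] t by simp
qed

end

section \<open>Existence of scalar solutions and shifts in time\<close>

context delay_equation
begin

text \<open>A bound on the forcing uniform in time for the zero continuation; it keeps the fixed
  point map within bounded functions although the history is merely in L2.\<close>

lemma forcing_zero_history_bound:
  "\<bar>forcing (hist p (\<lambda>_. 0) \<phi>) t\<bar> \<le> \<mu> * (norm (abs_l2 (\<lambda>r. indicator {-\<tau>..0} r * \<rho> r)) * norm \<phi>) + F0"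
proof -
  define y where "y = hist p (\<lambda>_. 0) \<phi>"
  let ?r = "abs_l2 (\<lambda>r. indicator {-\<tau>..0} r * \<rho> r)"
  have y: "locally_L2 y" unfolding y_def by (rule locally_L2_hist) simp
  have sq: "square_integrable (\<lambda>s. rep_l2 \<phi> ((t - p) + s))" by (rule square_integrable_translate) simp
  have "norm (seg \<tau> (\<lambda>s. y (t + s))) \<le> norm (abs_l2 (\<lambda>s. rep_l2 \<phi> ((t - p) + s)))"
    by (rule norm_seg_mono[OF locally_L2_translate[OF y] sq]) (auto simp: y_def hist_def algebra_simps)
  also have "\<dots> = norm \<phi>"
  proof -
    have "(norm (abs_l2 (\<lambda>s. rep_l2 \<phi> ((t - p) + s))))\<^sup>2 = (norm \<phi>)\<^sup>2"
      unfolding norm_abs_l2_sq[OF sq] norm_l2_sq[of \<phi>] by (rule integral_translate[of "\<lambda>s. (rep_l2 \<phi> s)\<^sup>2"])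
    then show ?thesis by simp
  qed
  finally have n: "norm (seg \<tau> (\<lambda>s. y (t + s))) \<le> norm \<phi>" .
  have "\<bar>delayed \<tau> \<rho> y t\<bar> = \<bar>inner ?r (seg \<tau> (\<lambda>s. y (t + s)))\<bar>"
    using inner_cut_seg[OF \<rho> locally_L2_translate[OF y]] by (simp add: delayed_def)
  also have "\<dots> \<le> norm ?r * norm (seg \<tau> (\<lambda>s. y (t + s)))" by (rule Cauchy_Schwarz_ineq2)
  also have "\<dots> \<le> norm ?r * norm \<phi>" using n by (intro mult_left_mono) auto
  finally have d: "\<bar>delayed \<tau> \<rho> y t\<bar> \<le> norm ?r * norm \<phi>" .
  have "\<bar>forcing y t\<bar> \<le> \<bar>f t (delayed \<tau> \<rho> y t)\<bar> + \<bar>g t\<bar>"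
    unfolding forcing_def using b abs_triangle_ineq[of "b * f t (delayed \<tau> \<rho> y t)" "g t"] by (simp add: abs_mult)
  also have "\<bar>f t (delayed \<tau> \<rho> y t)\<bar> \<le> \<mu> * \<bar>delayed \<tau> \<rho> y t\<bar> + \<bar>f t 0\<bar>"
    using Lip[of t "delayed \<tau> \<rho> y t" 0] unfolding diff_zero by linarith
  also have "\<mu> * \<bar>delayed \<tau> \<rho> y t\<bar> \<le> \<mu> * (norm ?r * norm \<phi>)" using d \<mu> by (intro mult_left_mono) auto
  finally show ?thesis using bounded_forcing[of t] unfolding y_def by linarith
qed

text \<open>Banach's fixed point theorem in the bounded continuous functions, applied to the
  rescaled unknown \<open>w\<close> = exp(-\<open>kap\<close> (t - p)) x. In this scale the Duhamel
  operator has contraction factor 1/2.\<close>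

theorem solution_exists: "\<exists>x. solution p u0 x"
proof -
  define \<phi> where "\<phi> = snd u0"
  define x where "x w t = exp (kap * (t - p)) * apply_bcontfun w t" for w :: "real \<Rightarrow>\<^sub>C real" and t
  define Y where "Y w = hist p (x w) \<phi>" for w
  have xc: "continuous_on S (x w)" for S w
    unfolding x_def using continuous_on_subset[OF continuous_on_apply_bcontfun[of UNIV w]]
    by (intro continuous_intros) auto
  have Y: "locally_L2 (Y w)" for w unfolding Y_def by (rule locally_L2_hist[OF xc])
  have Fc: "continuous_on {p..} (forcing (Y w))" for w
    using forcing_continuous[OF Y] continuous_on_subset by blast
  define D where "D w t = duhamel lam p (forcing (Y w)) t" for w t
  \<comment> \<open>Bounded continuous functions live on the whole line, so times before
    \<open>p\<close> are replaced by \<open>p\<close>; \<open>hist\<close> does not read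
    them.\<close>
  define \<Gamma> where "\<Gamma> w t = exp (- kap * (max p t - p)) * (fst u0 * exp (- lam * (max p t - p)) + D w (max p t))" for w t
  have k: "kap > 0" using kap_ge_1 by simp
  have contr: "\<bar>D w t - D v t\<bar> \<le> dist w v / 2 * exp (kap * (t - p))" if "t \<ge> p" for w v t
    unfolding D_def
  proof (rule forcing_contraction[OF Y Y that])
    show "\<bar>Y w r - Y v r\<bar> \<le> dist w v * exp (kap * (r - p))" if "p \<le> r" for r
    proof -
      have "\<bar>Y w r - Y v r\<bar> = exp (kap * (r - p)) * \<bar>apply_bcontfun w r - apply_bcontfun v r\<bar>"
        using that by (simp add: Y_def hist_def x_def right_diff_distrib[symmetric] abs_mult)
      also have "\<dots> \<le> exp (kap * (r - p)) * dist w v"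
        using dist_bounded[of w r v] by (intro mult_left_mono) (auto simp: dist_real_def)
      finally show ?thesis by (simp add: mult.commute)
    qed
  qed (auto simp: Y_def hist_def)
  obtain C where C: "C \<ge> 0" "\<And>t. \<bar>forcing (Y 0) t\<bar> \<le> C"
  proof
    let ?C = "\<mu> * (norm (abs_l2 (\<lambda>r. indicator {-\<tau>..0} r * \<rho> r)) * norm \<phi>) + F0"
    have "Y 0 = hist p (\<lambda>_. 0) \<phi>" by (simp add: Y_def x_def hist_def fun_eq_iff)
    then show "\<bar>forcing (Y 0) t\<bar> \<le> ?C" for t using forcing_zero_history_bound by simp
    from this[of 0] show "?C \<ge> 0" by linarith
  qed
  have D0: "\<bar>D 0 t\<bar> \<le> C / kap * exp (kap * (t - p))" if "t \<ge> p" for t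
    unfolding D_def
  proof (rule duhamel_exp_bound[OF that C(1) k])
    fix s assume "p \<le> s"
    then have "C * 1 \<le> C * exp (kap * (s - p))" using C(1) k by (intro mult_left_mono) auto
    then show "\<bar>forcing (Y 0) s\<bar> \<le> C * exp (kap * (s - p))" using C(2)[of s] by simp
  qed
  have ee: "exp (- kap * (t - p)) * (c * exp (kap * (t - p))) = c" for t c
  proof -
    have "exp (- kap * (t - p)) * exp (kap * (t - p)) = 1" by (simp add: exp_add[symmetric])
    then show ?thesis by (simp only: mult.left_commute[of _ c] mult_1_right)
  qed
  have \<Gamma>b: "\<Gamma> w \<in> bcontfun" for w
  proof (rule bcontfun_normI)
    have "continuous_on UNIV (\<lambda>t. D w (max p t))"
      unfolding D_def by (rule continuous_on_compose2[OF duhamel_continuous[OF Fc]]) (auto intro!: continuous_intros)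
    then show "continuous_on UNIV (\<Gamma> w)" unfolding \<Gamma>_def by (intro continuous_intros)
    fix t
    define s where "s = max p t"
    have s: "s \<ge> p" by (simp add: s_def)
    have "\<bar>fst u0 * exp (- lam * (s - p))\<bar> \<le> \<bar>fst u0\<bar> * exp (kap * (s - p))"
    proof -
      have "- lam * (s - p) \<le> kap * (s - p)" using s lam k by (intro mult_right_mono) auto
      then show ?thesis by (simp add: abs_mult mult_left_mono)
    qed
    \<comment> \<open>The contraction estimate compares \<open>w\<close> with 0, whose image is
      bounded by \<open>D0\<close>.\<close>
    moreover have "\<bar>D w s\<bar> \<le> (dist w 0 / 2 + C / kap) * exp (kap * (s - p))"
      using contr[OF s, of w 0] D0[OF s] unfolding distrib_right by linarith
    ultimately have "\<bar>fst u0 * exp (- lam * (s - p)) + D w s\<bar> \<le> (\<bar>fst u0\<bar> + (dist w 0 / 2 + C / kap)) * exp (kap * (s - p))"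
      by (simp add: distrib_right)
    then have "exp (- kap * (s - p)) * \<bar>fst u0 * exp (- lam * (s - p)) + D w s\<bar>
        \<le> exp (- kap * (s - p)) * ((\<bar>fst u0\<bar> + (dist w 0 / 2 + C / kap)) * exp (kap * (s - p)))"
      by (intro mult_left_mono) auto
    then show "norm (\<Gamma> w t) \<le> \<bar>fst u0\<bar> + (dist w 0 / 2 + C / kap)"
      unfolding ee \<Gamma>_def s_def[symmetric] by (simp add: abs_mult)
  qed
  define G where "G w = Bcontfun (\<Gamma> w)" for w
  have G: "apply_bcontfun (G w) = \<Gamma> w" for w unfolding G_def by (rule Bcontfun_inverse[OF \<Gamma>b])
  have "dist (G w) (G v) \<le> 1/2 * dist w v" for w v
  proof (rule dist_bound)
    fix t
    define s where "s = max p t"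
    have s: "s \<ge> p" by (simp add: s_def)
    have "dist (\<Gamma> w t) (\<Gamma> v t) = exp (- kap * (s - p)) * \<bar>D w s - D v s\<bar>"
      unfolding \<Gamma>_def s_def[symmetric] dist_real_def right_diff_distrib[symmetric] abs_mult by simp
    also have "\<dots> \<le> exp (- kap * (s - p)) * (dist w v / 2 * exp (kap * (s - p)))"
      using contr[OF s] by (intro mult_left_mono) auto
    finally show "dist (apply_bcontfun (G w) t) (apply_bcontfun (G v) t) \<le> 1/2 * dist w v"
      unfolding ee G by simp
  qed
  then have "\<exists>!w\<in>UNIV. G w = w"
    by (intro Banach_fix[of UNIV "1/2" G]) (auto simp: complete_UNIV)
  then obtain w where w: "G w = w" by blast
  have "x w t = fst u0 * exp (- lam * (t - p)) + duhamel lam p (forcing (hist p (x w) (snd u0))) t" if "t \<ge> p" for t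
  proof -
    have "x w t = exp (kap * (t - p)) * \<Gamma> w t" unfolding x_def G[symmetric] w ..
    also have "\<dots> = exp (kap * (t - p)) * exp (- kap * (t - p)) * (fst u0 * exp (- lam * (t - p)) + D w t)"
      using that by (simp add: \<Gamma>_def max_def mult.assoc)
    also have "exp (kap * (t - p)) * exp (- kap * (t - p)) = 1" by (simp add: exp_add[symmetric])
    finally show ?thesis by (simp add: D_def Y_def \<phi>_def)
  qed
  then have "solution p u0 (x w)" unfolding solution_def using xc by blast
  then show ?thesis by blast
qed

lemma duhamel_shift: "duhamel lam (p + d) (\<lambda>s. \<xi> (s - d)) t = duhamel lam p \<xi> (t - d)"
  using itg_translate[of "\<lambda>s. exp (- lam * (t - s)) * \<xi> (s - d)" d p "t - d"]
  by (simp add: duhamel_def algebra_simps)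

lemma hist_shift: "hist (p + d) (\<lambda>t. x (t - d)) \<phi> r = hist p x \<phi> (r - d)"
  by (auto simp: hist_def algebra_simps)

lemma solution_shift:
  assumes x: "solution p u0 x" and fd: "\<And>t v. f (t + d) v = f t v" and gd: "\<And>t. g (t + d) = g t"
  shows "solution (p + d) u0 (\<lambda>t. x (t - d))"
  unfolding solution_def
proof (intro conjI allI impI)
  show "continuous_on {p + d..} (\<lambda>t. x (t - d))"
    using x unfolding solution_def by (auto intro!: continuous_on_compose2[of "{p..}" x] continuous_intros)
  fix t assume t: "p + d \<le> t"
  have "forcing (\<lambda>r. y (r - d)) s = forcing y (s - d)" for y s
    using delayed_shift[of \<tau> \<rho> y "-d" s] fd[of "s - d"] gd[of "s - d"] by (simp add: forcing_def)
  then have "forcing (hist (p + d) (\<lambda>t. x (t - d)) (snd u0)) = (\<lambda>s. forcing (hist p x (snd u0)) (s - d))"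
    unfolding hist_shift[abs_def] by blast
  then have "duhamel lam (p + d) (forcing (hist (p + d) (\<lambda>t. x (t - d)) (snd u0))) t
      = duhamel lam p (forcing (hist p x (snd u0))) (t - d)" by (simp add: duhamel_shift)
  then show "x (t - d) = fst u0 * exp (- lam * (t - (p + d))) + duhamel lam (p + d) (forcing (hist (p + d) (\<lambda>t. x (t - d)) (snd u0))) t"
    using x t unfolding solution_def by (simp add: algebra_simps)
qed

lemma hist_cong: "(\<And>t. t \<ge> p \<Longrightarrow> x t = x' t) \<Longrightarrow> hist p x \<phi> = hist p x' \<phi>"
  by (auto simp: hist_def fun_eq_iff)

end

section \<open>Periodic coefficients and the cocycle over the circle\<close>

lemma periodic_int:
  fixes h :: "real \<Rightarrow> 'a"
  assumes "\<And>t. h (t + \<sigma>) = h t"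
  shows "h (t + of_int n * \<sigma>) = h t"
proof (induction n rule: int_induct[where k=0])
  case (step1 i)
  then show ?case using assms[of "t + of_int i * \<sigma>"] by (simp add: algebra_simps)
next
  case (step2 i)
  then show ?case using assms[of "t + of_int (i - 1) * \<sigma>"] by (simp add: algebra_simps)
qed simp

locale periodic_delay_equation = delay_equation +
  fixes \<sigma> :: real
  assumes \<sigma>: "\<sigma> > 0" and f_periodic: "\<And>t v. f (t + \<sigma>) v = f t v" and g_periodic: "\<And>t. g (t + \<sigma>) = g t"
    and f_mono: "\<And>t v w. v \<le> w \<Longrightarrow> f t v \<le> f t w"
begin

lemma base_congruent:
  assumes "\<theta> \<in> base \<sigma>" "p \<in> \<theta>" "p' \<in> \<theta>"
  shows "\<exists>n. p' = p + of_int n * \<sigma>"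
proof -
  obtain x where "\<theta> = {y. [x = y] (rmod \<sigma>)}"
    using assms(1) by (auto simp: base_def quotient_def)
  then have "[p = p'] (rmod \<sigma>)" using assms(2,3) rcong_sym rcong_trans by blast
  then show ?thesis by (simp add: rcong_altdef)
qed

lemma base_nonempty: "\<theta> \<in> base \<sigma> \<Longrightarrow> \<exists>p. p \<in> \<theta>"
  by (auto simp: base_def quotient_def)

lemma shift_base:
  assumes "\<theta> \<in> base \<sigma>" shows "Defs.shift s \<theta> \<in> base \<sigma>"
proof -
  obtain x where x: "\<theta> = {y. [x = y] (rmod \<sigma>)}"
    using assms by (auto simp: base_def quotient_def)
  have "Defs.shift s \<theta> = {y. [x + s = y] (rmod \<sigma>)}"
    unfolding x Defs.shift_def
  proof (intro equalityI subsetI)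
    fix y assume "y \<in> {y. [x + s = y] (rmod \<sigma>)}"
    then have "[x = y - s] (rmod \<sigma>)" by (auto simp: rcong_altdef algebra_simps)
    then show "y \<in> (\<lambda>p. p + s) ` {y. [x = y] (rmod \<sigma>)}" by (intro image_eqI[of _ _ "y - s"]) auto
  qed auto
  then show ?thesis by (auto simp: base_def quotient_def)
qed

text \<open>The description in \<open>cocycle\<close> admits any representative of the base point.
  Two of them differ by a multiple of the period, and by uniqueness the solution from one is the
  time shift of the solution from the other, so the described value is unique.\<close>

lemma cocycle_eq_state:
  assumes \<theta>: "\<theta> \<in> base \<sigma>" and p: "p \<in> \<theta>" and u0: "u0 \<in> H \<tau>" and x: "solution p u0 x" and t: "t \<ge> 0"
  shows "cocycle lam \<tau> b \<rho> f g t \<theta> u0 = state \<tau> (hist p x (snd u0)) (t + p)"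
  unfolding cocycle_def
proof (rule the_equality)
  show "\<exists>p'\<in>\<theta>. \<exists>u. mild_solution lam \<tau> b \<rho> f g p' u0 u \<and> state \<tau> (hist p x (snd u0)) (t + p) = u (t + p')"
    using mild_solution_of_solution[OF u0 x] p by blast
next
  fix w assume "\<exists>p'\<in>\<theta>. \<exists>u. mild_solution lam \<tau> b \<rho> f g p' u0 u \<and> w = u (t + p')"
  then obtain p' u where p': "p' \<in> \<theta>" and u: "mild_solution lam \<tau> b \<rho> f g p' u0 u" and w: "w = u (t + p')" by blast
  obtain n where n: "p' = p + of_int n * \<sigma>" using base_congruent[OF \<theta> p p'] by blast
  define d where "d = of_int n * \<sigma>"
  have p'd: "p' = p + d" by (simp add: n d_def)
  have fd: "f (t + d) v = f t v" for t v unfolding d_def by (rule periodic_int) (rule f_periodic)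
  have gd: "g (t + d) = g t" for t unfolding d_def by (rule periodic_int) (rule g_periodic)
  have "solution p' u0 (\<lambda>t. x (t - d))" unfolding p'd by (rule solution_shift[OF x fd gd])
  moreover have "solution p' u0 (\<lambda>t. fst (u t))" by (rule solution_of_mild_solution[OF u0 u])
  ultimately have "fst (u s) = x (s - d)" if "s \<ge> p'" for s using solution_unique that by blast
  then have h: "hist p' (\<lambda>t. fst (u t)) (snd u0) = hist p' (\<lambda>t. x (t - d)) (snd u0)" by (intro hist_cong)
  have "w = state \<tau> (hist p' (\<lambda>t. fst (u t)) (snd u0)) (t + p')"
    unfolding w by (rule solution_of_mild_solution(2)[OF u0 u]) (use t in simp)
  also have "\<dots> = state \<tau> (hist p x (snd u0)) (t + p)"
    unfolding h unfolding p'd state_def hist_shift by (simp add: algebra_simps)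
  finally show "w = state \<tau> (hist p x (snd u0)) (t + p)" .
qed

end

section \<open>Fourier transforms and the frequency condition\<close>

text \<open>The Gaussian is the characteristic function of the normal density. Inserting this and
  exchanging the integrals turns the left-hand side into the mean of the Fourier transform of
  \<open>\<Phi>\<close> with a positive weight.\<close>

lemma integral_gaussian_times_nonneg:
  fixes \<Phi> :: "real \<Rightarrow> real"
  assumes int: "integrable lborel \<Phi>"
    and pos: "\<And>\<omega>. Re (\<integral>r. complex_of_real (\<Phi> r) * iexp (\<omega> * r) \<partial>lborel) \<ge> 0"
  shows "(\<integral>r. \<Phi> r * exp (- r\<^sup>2 / 2) \<partial>lborel) \<ge> 0"
proof -
  let ?n = "\<lambda>x. complex_of_real (std_normal_density x)"
  have [measurable]: "\<Phi> \<in> borel_measurable borel" using int by auto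
  have n: "integrable lborel ?n"
    using integrable_normal_density[of 1 0] by (intro integrable_of_real) simp
  have cint: "integrable lborel (\<lambda>r. complex_of_real (\<Phi> r))" using int by simp
  have char: "(\<integral>x. ?n x * iexp (x * r) \<partial>lborel) = complex_of_real (exp (- r\<^sup>2 / 2))" for r
  proof -
    have "char std_normal_distribution r = (\<integral>x. std_normal_density x *\<^sub>R iexp (r * x) \<partial>lborel)"
      unfolding char_def by (subst integral_density) auto
    then show ?thesis unfolding char_std_normal_distribution by (simp add: scaleR_conv_of_real mult.commute)
  qed
  define k where "k x r = iexp (x * r)" for x r :: real
  have k: "case_prod k \<in> borel_measurable (lborel \<Otimes>\<^sub>M lborel)" unfolding k_def by measurable
  have kb: "norm (k x r) \<le> 1" for x r by (simp add: k_def)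
  have "complex_of_real (\<integral>r. \<Phi> r * exp (- r\<^sup>2 / 2) \<partial>lborel) = (\<integral>r. complex_of_real (\<Phi> r) * (\<integral>x. ?n x * k x r \<partial>lborel) \<partial>lborel)"
    unfolding k_def char by (simp only: of_real_mult[symmetric] integral_complex_of_real)
  also have "\<dots> = (\<integral>x. ?n x * (\<integral>r. complex_of_real (\<Phi> r) * k x r \<partial>lborel) \<partial>lborel)"
    by (rule Fubini_kernel(1)[OF n cint k kb, symmetric])
  finally have eq: "complex_of_real (\<integral>r. \<Phi> r * exp (- r\<^sup>2 / 2) \<partial>lborel)
      = (\<integral>x. ?n x * (\<integral>r. complex_of_real (\<Phi> r) * k x r \<partial>lborel) \<partial>lborel)" .
  have "(\<integral>r. \<Phi> r * exp (- r\<^sup>2 / 2) \<partial>lborel) = Re (\<integral>x. ?n x * (\<integral>r. complex_of_real (\<Phi> r) * k x r \<partial>lborel) \<partial>lborel)"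
    unfolding eq[symmetric] by simp
  also have "\<dots> = (\<integral>x. Re (?n x * (\<integral>r. complex_of_real (\<Phi> r) * k x r \<partial>lborel)) \<partial>lborel)"
    by (rule integral_Re[symmetric]) (rule Fubini_kernel(2)[OF n cint k kb])
  also have "\<dots> \<ge> 0"
    by (rule integral_nonneg_AE) (use pos in \<open>auto simp: k_def intro!: AE_I2 mult_nonneg_nonneg\<close>)
  finally show ?thesis .
qed

text \<open>Testing against the Gaussian kernels of width \<open>e n\<close>, which concentrate at \<open>0\<close> and have a
  positive Fourier transform.\<close>

lemma nonneg_at_0_of_Fourier_nonneg:
  fixes \<Phi> :: "real \<Rightarrow> real"
  assumes int: "integrable lborel \<Phi>" and B: "\<And>r. \<bar>\<Phi> r\<bar> \<le> B" and cont: "isCont \<Phi> 0"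
    and pos: "\<And>\<omega>. Re (\<integral>r. complex_of_real (\<Phi> r) * iexp (\<omega> * r) \<partial>lborel) \<ge> 0"
  shows "\<Phi> 0 \<ge> 0"
proof -
  have [measurable]: "\<Phi> \<in> borel_measurable borel" using int by auto
  define e where "e n = inverse (real (Suc n))" for n
  have e: "e n > 0" for n by (simp add: e_def)
  have e0: "e \<longlonglongrightarrow> 0" unfolding e_def by (rule LIMSEQ_inverse_real_of_nat)
  let ?A = "\<lambda>n. \<integral>r. \<Phi> (e n * r) * exp (- r\<^sup>2 / 2) \<partial>lborel"
  have A: "?A n \<ge> 0" for n
  proof (rule integral_gaussian_times_nonneg)
    show "integrable lborel (\<lambda>r. \<Phi> (e n * r))"
      using lborel_integrable_real_affine[OF int, of "e n" 0] e[of n] by simp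
    fix \<omega>
    \<comment> \<open>Contracting the argument by \<open>e n\<close> dilates the frequency, so the
      transform at every frequency keeps its nonnegative real part.\<close>
    have "(\<integral>r. complex_of_real (\<Phi> r) * iexp (\<omega> / e n * r) \<partial>lborel)
        = \<bar>e n\<bar> *\<^sub>R (\<integral>r. complex_of_real (\<Phi> (0 + e n * r)) * iexp (\<omega> / e n * (0 + e n * r)) \<partial>lborel)"
      by (rule lborel_integral_real_affine) (use e[of n] in simp)
    also have "\<dots> = e n *\<^sub>R (\<integral>r. complex_of_real (\<Phi> (e n * r)) * iexp (\<omega> * r) \<partial>lborel)"
      using e[of n] by simp
    finally have "Re (\<integral>r. complex_of_real (\<Phi> r) * iexp (\<omega> / e n * r) \<partial>lborel)
      = e n * Re (\<integral>r. complex_of_real (\<Phi> (e n * r)) * iexp (\<omega> * r) \<partial>lborel)" by simp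
    then have "0 \<le> e n * Re (\<integral>r. complex_of_real (\<Phi> (e n * r)) * iexp (\<omega> * r) \<partial>lborel)"
      using pos[of "\<omega> / e n"] by simp
    then show "Re (\<integral>r. complex_of_real (\<Phi> (e n * r)) * iexp (\<omega> * r) \<partial>lborel) \<ge> 0"
      using e[of n] by (simp add: zero_le_mult_iff)
  qed
  have gauss: "(\<lambda>r. exp (- r\<^sup>2 / 2)) = (\<lambda>r. sqrt (2 * pi) * std_normal_density r)"
    by (auto simp: std_normal_density_def)
  have ig: "integrable lborel (\<lambda>r::real. exp (- r\<^sup>2 / 2))"
    unfolding gauss using integrable_normal_density[of 1 0] by simp
  have Ig: "(\<integral>r. exp (- r\<^sup>2 / 2) \<partial>lborel) = sqrt (2 * pi)"
    unfolding gauss using integral_normal_density[of 1 0] by simp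
  have "?A \<longlonglongrightarrow> (\<integral>r. \<Phi> 0 * exp (- r\<^sup>2 / 2) \<partial>lborel)"
  proof (rule integral_dominated_convergence[where w="\<lambda>r. B * exp (- r\<^sup>2 / 2)"])
    show "integrable lborel (\<lambda>r::real. B * exp (- r\<^sup>2 / 2))" using ig by simp
    show "AE r in lborel. (\<lambda>n. \<Phi> (e n * r) * exp (- r\<^sup>2 / 2)) \<longlonglongrightarrow> \<Phi> 0 * exp (- r\<^sup>2 / 2)"
    proof (rule AE_I2)
      fix r :: real
      have "(\<lambda>n. e n * r) \<longlonglongrightarrow> 0" using e0 by (rule tendsto_mult_left_zero)
      then have "(\<lambda>n. \<Phi> (e n * r)) \<longlonglongrightarrow> \<Phi> 0" by (rule isCont_tendsto_compose[OF cont])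
      then show "(\<lambda>n. \<Phi> (e n * r) * exp (- r\<^sup>2 / 2)) \<longlonglongrightarrow> \<Phi> 0 * exp (- r\<^sup>2 / 2)"
        by (rule tendsto_mult_right)
    qed
    show "AE r in lborel. norm (\<Phi> (e n * r) * exp (- r\<^sup>2 / 2)) \<le> B * exp (- r\<^sup>2 / 2)" for n
      using B by (intro AE_I2) (simp add: abs_mult mult_right_mono)
  qed auto
  then have "?A \<longlonglongrightarrow> \<Phi> 0 * sqrt (2 * pi)" by (simp only: integral_mult_right_zero Ig)
  then have "0 \<le> \<Phi> 0 * sqrt (2 * pi)" by (rule LIMSEQ_le_const) (use A in auto)
  then show ?thesis using pi_gt_zero by (auto simp: zero_le_mult_iff)
qed

text \<open>The exponent has the positive sign of characteristic functions; the transfer function is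
  therefore evaluated at -\<open>\<omega>\<close> in \<open>frequency_inequality\<close>.\<close>

definition fourier :: "(real \<Rightarrow> real) \<Rightarrow> real \<Rightarrow> complex" where
  "fourier h \<omega> = (\<integral>r. complex_of_real (h r) * iexp (\<omega> * r) \<partial>lborel)"

lemma integrable_bounded_support:
  assumes "h \<in> borel_measurable borel" "\<And>s. \<bar>h s\<bar> \<le> c" "\<And>s. s \<notin> {a..b} \<Longrightarrow> h s = 0"
  shows "integrable lborel (h :: real \<Rightarrow> real)"
proof (rule Bochner_Integration.integrable_bound)
  show "integrable lborel (\<lambda>s. c * indicator {a..b} s)" by (auto intro!: integrable_real_indicator simp: emeasure_lborel_Icc_eq)
  have "\<bar>h s\<bar> \<le> c * indicator {a..b} s" for s using assms(2,3)[of s] by (auto simp: indicator_def)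
  then show "AE s in lborel. norm (h s) \<le> norm (c * indicator {a..b} s)"
    by (intro AE_I2) (auto intro: order_trans[OF _ abs_ge_self])
qed (use assms in simp)

text \<open>The cross-correlation \<open>\<Phi>\<close> of \<open>v\<close> and \<open>h\<close> has the Fourier transform
  \<open>fourier v \<omega> * cnj (fourier h \<omega>)\<close>.\<close>

theorem Parseval_nonneg:
  fixes v h :: "real \<Rightarrow> real"
  assumes v: "v \<in> borel_measurable borel" "\<And>s. \<bar>v s\<bar> \<le> c" "\<And>s. \<bar>s\<bar> > M \<Longrightarrow> v s = 0"
    and h: "h \<in> borel_measurable borel" "\<And>s. \<bar>h s\<bar> \<le> c" "\<And>s. \<bar>s\<bar> > M \<Longrightarrow> h s = 0"
    and cont: "AE t in lborel. isCont v t"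
    and pos: "\<And>\<omega>. Re (fourier v \<omega> * cnj (fourier h \<omega>)) \<ge> 0"
  shows "(\<integral>t. v t * h t \<partial>lborel) \<ge> 0"
proof -
  have [measurable]: "v \<in> borel_measurable borel" "h \<in> borel_measurable borel" by fact+
  have c0: "c \<ge> 0" using v(2)[of 0] by linarith
  have vi: "integrable lborel v" and hi: "integrable lborel h"
    by (rule integrable_bounded_support[of _ c "-M" M]; use v h in force)+
  define \<Phi> where "\<Phi> r = (\<integral>t. v (t + r) * h t \<partial>lborel)" for r
  have [measurable]: "\<Phi> \<in> borel_measurable borel" unfolding \<Phi>_def by measurable
  have ih: "integrable lborel (\<lambda>t. c * \<bar>h t\<bar>)" using hi by simp
  have dom: "norm (v (t + r) * h t) \<le> c * \<bar>h t\<bar>" for t r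
    using v(2)[of "t + r"] by (simp add: abs_mult mult_right_mono)
  have ivh: "integrable lborel (\<lambda>t. v (t + r) * h t)" for r
    by (rule Bochner_Integration.integrable_bound[OF ih]) (use dom c0 in \<open>auto intro!: AE_I2\<close>)
  have \<Phi>b: "\<bar>\<Phi> r\<bar> \<le> (\<integral>t. c * \<bar>h t\<bar> \<partial>lborel)" for r
  proof -
    have "norm (\<Phi> r) \<le> (\<integral>t. norm (v (t + r) * h t) \<partial>lborel)" unfolding \<Phi>_def by (rule integral_norm_bound)
    also have "\<dots> \<le> (\<integral>t. c * \<bar>h t\<bar> \<partial>lborel)"
      by (intro integral_mono integrable_norm ivh ih dom)
    finally show ?thesis by simp
  qed
  have \<Phi>s: "\<Phi> r = 0" if r: "\<bar>r\<bar> > 2 * M" for r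
  proof -
    have "v (t + r) * h t = 0" for t
    proof (cases "\<bar>t\<bar> > M")
      case False
      then have "\<bar>t + r\<bar> > M" using r by linarith
      then show ?thesis using v(3) by simp
    qed (use h(3) in simp)
    then have "(\<lambda>t. v (t + r) * h t) = (\<lambda>_. 0)" by blast
    then show ?thesis unfolding \<Phi>_def by (simp only: integral_zero)
  qed
  have \<Phi>i: "integrable lborel \<Phi>"
    by (rule integrable_bounded_support[where a="-2*M" and b="2*M", OF _ \<Phi>b]) (use \<Phi>s in force)+
  have ct: "isCont \<Phi> 0"
    unfolding isCont_def tendsto_at_iff_sequentially comp_def
  proof (intro allI impI)
    fix X :: "nat \<Rightarrow> real" assume X: "\<forall>i. X i \<in> UNIV - {0}" "X \<longlonglongrightarrow> 0"
    show "(\<lambda>i. \<Phi> (X i)) \<longlonglongrightarrow> \<Phi> 0"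
      unfolding \<Phi>_def
    proof (rule integral_dominated_convergence[OF _ _ ih])
      show "AE t in lborel. (\<lambda>i. v (t + X i) * h t) \<longlonglongrightarrow> v (t + 0) * h t"
        using cont
      proof eventually_elim
        case (elim t)
        have "(\<lambda>i. t + X i) \<longlonglongrightarrow> t + 0" by (intro tendsto_intros X)
        then have "(\<lambda>i. v (t + X i)) \<longlonglongrightarrow> v t" using isCont_tendsto_compose[OF elim] by simp
        then show ?case by (auto intro!: tendsto_mult_right)
      qed
      show "AE t in lborel. norm (v (t + X i) * h t) \<le> c * \<bar>h t\<bar>" for i using dom by (intro AE_I2)
    qed simp_all
  qed
  have "Re (\<integral>r. complex_of_real (\<Phi> r) * iexp (\<omega> * r) \<partial>lborel) \<ge> 0" for \<omega>
  proof -
    \<comment> \<open>The indicator contains the support of \<open>\<Phi>\<close> and supplies the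
      integrable factor in r that \<open>Fubini_kernel\<close> asks for.\<close>
    define g :: "real \<Rightarrow> complex" where "g r = complex_of_real (indicator {-2*M..2*M} r)" for r
    define k where "k t r = complex_of_real (v (t + r)) * iexp (\<omega> * r)" for t r
    have g: "integrable lborel g" unfolding g_def
      by (intro integrable_of_real integrable_real_indicator) (auto simp: emeasure_lborel_Icc_eq)
    have hc: "integrable lborel (\<lambda>t. complex_of_real (h t))" using hi by simp
    have k: "case_prod k \<in> borel_measurable (lborel \<Otimes>\<^sub>M lborel)" unfolding k_def by measurable
    have kb: "norm (k t r) \<le> c" for t r using v(2) by (simp add: k_def norm_mult)
    have "(\<integral>r. complex_of_real (\<Phi> r) * iexp (\<omega> * r) \<partial>lborel)
        = (\<integral>r. g r * (\<integral>t. complex_of_real (h t) * k t r \<partial>lborel) \<partial>lborel)"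
    proof (rule Bochner_Integration.integral_cong[OF refl])
      fix r
      have "(\<integral>t. complex_of_real (h t) * k t r \<partial>lborel) = (\<integral>t. complex_of_real (v (t + r) * h t) * iexp (\<omega> * r) \<partial>lborel)"
        by (simp add: k_def ac_simps)
      also have "\<dots> = complex_of_real (\<Phi> r) * iexp (\<omega> * r)"
        unfolding \<Phi>_def integral_mult_left_zero integral_complex_of_real ..
      finally have eq: "(\<integral>t. complex_of_real (h t) * k t r \<partial>lborel) = complex_of_real (\<Phi> r) * iexp (\<omega> * r)" .
      show "complex_of_real (\<Phi> r) * iexp (\<omega> * r) = g r * (\<integral>t. complex_of_real (h t) * k t r \<partial>lborel)"
      proof (cases "r \<in> {-2*M..2*M}")
        case False
        then have "\<bar>r\<bar> > 2 * M" by (auto simp: abs_if split: if_splits)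
        then show ?thesis using \<Phi>s by (simp add: eq)
      qed (simp add: g_def eq)
    qed
    also have "\<dots> = (\<integral>t. complex_of_real (h t) * (\<integral>r. g r * k t r \<partial>lborel) \<partial>lborel)"
      by (rule Fubini_kernel(1)[OF hc g k kb, symmetric])
    also have "\<dots> = (\<integral>t. (complex_of_real (h t) * iexp (- \<omega> * t)) * fourier v \<omega> \<partial>lborel)"
    proof (rule Bochner_Integration.integral_cong[OF refl])
      fix t
      show "complex_of_real (h t) * (\<integral>r. g r * k t r \<partial>lborel) = (complex_of_real (h t) * iexp (- \<omega> * t)) * fourier v \<omega>"
      proof (cases "\<bar>t\<bar> > M")
        case True then show ?thesis using h(3) by simp
      next
        case False
        have "(\<integral>r. g r * k t r \<partial>lborel) = (\<integral>r. iexp (- \<omega> * t) * (complex_of_real (v (t + r)) * iexp (\<omega> * (t + r))) \<partial>lborel)"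
        proof (rule Bochner_Integration.integral_cong[OF refl])
          fix r
          have "\<bar>r\<bar> \<le> 2 * M \<or> v (t + r) = 0" using False v(3)[of "t + r"] by linarith
          moreover have "iexp (- \<omega> * t) * iexp (\<omega> * (t + r)) = iexp (\<omega> * r)"
            by (simp add: exp_add[symmetric] algebra_simps)
          ultimately show "g r * k t r = iexp (- \<omega> * t) * (complex_of_real (v (t + r)) * iexp (\<omega> * (t + r)))"
            by (auto simp: g_def k_def indicator_def mult.left_commute)
        qed
        also have "\<dots> = iexp (- \<omega> * t) * (\<integral>r. complex_of_real (v (t + r)) * iexp (\<omega> * (t + r)) \<partial>lborel)" by simp
        also have "\<dots> = iexp (- \<omega> * t) * fourier v \<omega>"
          unfolding fourier_def integral_translate[of "\<lambda>r. complex_of_real (v r) * iexp (\<omega> * r)"] ..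
        finally show ?thesis by simp
      qed
    qed
    also have "\<dots> = (\<integral>t. complex_of_real (h t) * iexp (- \<omega> * t) \<partial>lborel) * fourier v \<omega>" by simp
    also have "(\<integral>t. complex_of_real (h t) * iexp (- \<omega> * t) \<partial>lborel) = cnj (fourier h \<omega>)"
      unfolding fourier_def by (subst Bochner_Integration.integral_cnj[symmetric]) (simp add: exp_cnj)
    finally show ?thesis using pos[of \<omega>] by (simp add: mult.commute)
  qed
  from nonneg_at_0_of_Fourier_nonneg[OF \<Phi>i \<Phi>b ct this] show ?thesis by (simp add: \<Phi>_def)
qed

section \<open>The transfer function on the line Re p = -\<open>\<nu>\<close>\<close>

context delay_equation
begin

text \<open>The factor of the transfer function that stays bounded along the line; the decay in
  \<open>\<omega>\<close> comes from the other factor.\<close>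

definition kernel_transform :: "real \<Rightarrow> real \<Rightarrow> complex" where
  "kernel_transform \<nu> \<omega> = (LINT s:{-\<tau>..0}|lborel. of_real (\<rho> s) * exp ((\<i> * of_real \<omega> - of_real \<nu>) * of_real s))"

lemma transfer_W_eq:
  "transfer_W lam \<tau> b \<rho> (\<i> * of_real \<omega> - of_real \<nu>)
    = - (of_real b / (of_real lam + (\<i> * of_real \<omega> - of_real \<nu>))) * kernel_transform \<nu> \<omega>"
  by (simp add: transfer_W_def kernel_transform_def)

lemma kernel_transform_integral:
  "kernel_transform \<nu> \<omega> = integral {-\<tau>..0} (\<lambda>s. of_real (\<rho> s) * exp ((\<i> * of_real \<omega> - of_real \<nu>) * of_real s))"
  unfolding kernel_transform_def
  by (intro set_borel_integral_eq_integral(2) borel_integrable_atLeastAtMost' continuous_intros \<rho>)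

lemma kernel_transform_continuous: "continuous_on S (kernel_transform \<nu>)"
proof -
  have r: "continuous_on (UNIV \<times> cbox (-\<tau>) 0) (\<lambda>x. \<rho> (snd x))"
    by (rule continuous_on_compose2[OF \<rho>]) (auto intro!: continuous_intros)
  have "continuous_on (UNIV \<times> cbox (-\<tau>) 0)
      (\<lambda>(\<omega>, s). of_real (\<rho> s) * exp ((\<i> * of_real \<omega> - of_real \<nu>) * of_real s) :: complex)"
    unfolding case_prod_unfold by (intro continuous_intros r)
  from integral_continuous_on_param[OF this]
  have "continuous_on UNIV (kernel_transform \<nu>)"
    unfolding kernel_transform_integral[abs_def] by simp
  then show ?thesis using continuous_on_subset by blast
qed

lemma kernel_transform_bound: "\<exists>R\<ge>0. \<forall>\<omega>. norm (kernel_transform \<nu> \<omega>) \<le> R"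
proof -
  define R where "R = (SUP r\<in>{-\<tau>..0}. \<bar>\<rho> r\<bar>)"
  have R: "R \<ge> 0" "\<And>r. r \<in> {-\<tau>..0} \<Longrightarrow> \<bar>\<rho> r\<bar> \<le> R" using \<rho>_bound \<rho>_bound_nonneg by (auto simp: R_def)
  have "norm (kernel_transform \<nu> \<omega>) \<le> R * exp (\<bar>\<nu>\<bar> * \<tau>) * (0 - - \<tau>)" for \<omega>
    unfolding kernel_transform_integral
  proof (rule integral_bound)
    show "continuous_on {-\<tau>..0} (\<lambda>s. of_real (\<rho> s) * exp ((\<i> * of_real \<omega> - of_real \<nu>) * of_real s) :: complex)"
      by (intro continuous_intros \<rho>)
    fix s assume s: "s \<in> {-\<tau>..0}"
    have "- \<nu> * s \<le> \<bar>\<nu>\<bar> * \<tau>"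
    proof -
      have "- \<nu> * s \<le> \<bar>\<nu>\<bar> * \<bar>s\<bar>" using abs_ge_self[of "- \<nu> * s"] by (simp add: abs_mult)
      also have "\<dots> \<le> \<bar>\<nu>\<bar> * \<tau>" using s by (intro mult_left_mono) auto
      finally show ?thesis .
    qed
    then have "exp (- \<nu> * s) \<le> exp (\<bar>\<nu>\<bar> * \<tau>)" by simp
    then show "norm (of_real (\<rho> s) * exp ((\<i> * of_real \<omega> - of_real \<nu>) * of_real s) :: complex) \<le> R * exp (\<bar>\<nu>\<bar> * \<tau>)"
      using R s by (auto simp: norm_mult intro!: mult_mono)
  qed (use \<tau> in simp)
  then show ?thesis using R \<tau> by (intro exI[of _ "R * exp (\<bar>\<nu>\<bar> * \<tau>) * (0 - - \<tau>)"]) auto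
qed

text \<open>For large frequencies \<open>W\<close> is small, since its denominator is at least the
  modulus of \<open>\<omega>\<close>; on the remaining compact interval a continuous positive
  function has a positive minimum.\<close>

lemma transfer_margin:
  assumes \<nu>: "\<nu> > lam"
    and W: "\<And>\<omega>. Re (transfer_W lam \<tau> b \<rho> (\<i> * of_real \<omega> - of_real \<nu>)) + 1 / \<mu> > 0"
  shows "\<exists>\<delta>>0. \<forall>\<omega>. Re (transfer_W lam \<tau> b \<rho> (\<i> * of_real \<omega> - of_real \<nu>)) + 1 / \<mu> \<ge> \<delta>"
proof -
  define V where "V \<omega> = transfer_W lam \<tau> b \<rho> (\<i> * of_real \<omega> - of_real \<nu>)" for \<omega>
  obtain R where R: "R \<ge> 0" "\<And>\<omega>. norm (kernel_transform \<nu> \<omega>) \<le> R" using kernel_transform_bound by blast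
  have nz: "of_real lam + (\<i> * of_real \<omega> - of_real \<nu>) \<noteq> (0::complex)" for \<omega>
    using \<nu> by (auto simp: complex_eq_iff)
  have Vc: "continuous_on S V" for S
    unfolding V_def transfer_W_eq by (intro continuous_intros kernel_transform_continuous) (use nz in auto)
  \<comment> \<open>Beyond this frequency \<open>R\<close> over the modulus of
    \<open>\<omega>\<close> is at most 1/(2 \<open>\<mu>\<close>); the added 1 keeps it positive
    when \<open>R\<close> = 0.\<close>
  define \<Omega> where "\<Omega> = 2 * \<mu> * R + 1"
  have \<Omega>: "\<Omega> > 0" using R \<mu> by (auto simp: \<Omega>_def intro: add_nonneg_pos)
  have far: "Re (V \<omega>) + 1 / \<mu> \<ge> 1 / (2 * \<mu>)" if w: "\<bar>\<omega>\<bar> \<ge> \<Omega>" for \<omega>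
  proof -
    have "\<bar>\<omega>\<bar> \<le> norm (of_real lam + (\<i> * of_real \<omega> - of_real \<nu>) :: complex)"
      using abs_Im_le_cmod[of "of_real lam + (\<i> * of_real \<omega> - of_real \<nu>)"] by simp
    then have "norm (V \<omega>) \<le> R / \<bar>\<omega>\<bar>"
      unfolding V_def transfer_W_eq using b R(2)[of \<omega>] w \<Omega> R(1)
      by (auto simp: norm_mult norm_divide intro!: frac_le)
    also have "\<dots> \<le> R / \<Omega>" using w \<Omega> R by (intro divide_left_mono) auto
    also have "\<dots> \<le> 1 / (2 * \<mu>)" using \<Omega> \<mu> R by (simp add: \<Omega>_def field_simps)
    finally have "norm (V \<omega>) \<le> 1 / (2 * \<mu>)" .
    then have "Re (V \<omega>) \<ge> - (1 / (2 * \<mu>))" using abs_Re_le_cmod[of "V \<omega>"] by linarith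
    then show ?thesis using \<mu> by (simp add: field_simps)
  qed
  have "continuous_on {-\<Omega>..\<Omega>} (\<lambda>\<omega>. Re (V \<omega>) + 1 / \<mu>)" by (intro continuous_intros Vc)
  then obtain m where m: "\<And>\<omega>. \<omega> \<in> {-\<Omega>..\<Omega>} \<Longrightarrow> Re (V m) + 1 / \<mu> \<le> Re (V \<omega>) + 1 / \<mu>"
    using continuous_attains_inf[of "{-\<Omega>..\<Omega>}"] \<Omega> by fastforce
  define \<delta> where "\<delta> = min (Re (V m) + 1 / \<mu>) (1 / (2 * \<mu>))"
  have "\<delta> > 0" using W[of m] \<mu> by (simp add: \<delta>_def V_def)
  moreover have "Re (V \<omega>) + 1 / \<mu> \<ge> \<delta>" for \<omega>
  proof (cases "\<bar>\<omega>\<bar> \<ge> \<Omega>")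
    case True
    then show ?thesis using far[of \<omega>] by (simp add: \<delta>_def min_le_iff_disj)
  next
    case False
    then have "\<omega> \<in> {-\<Omega>..\<Omega>}" by (auto simp: abs_less_iff not_le)
    then show ?thesis using m[of \<omega>] by (simp add: \<delta>_def min_le_iff_disj)
  qed
  ultimately show ?thesis unfolding V_def by blast
qed

text \<open>Since \<open>z\<close> vanishes at both ends, its truncation is a solution on the whole line with the
  truncated input. Weighted with \<open>exp (\<nu> * t)\<close>, input and output are related by the transfer
  function on the line \<open>Re p = -\<nu>\<close>.\<close>

lemma frequency_inequality:
  assumes \<nu>: "\<nu> > lam" and W: "\<And>\<omega>. Re (transfer_W lam \<tau> b \<rho> (\<i> * of_real \<omega> - of_real \<nu>)) + 1 / \<mu> \<ge> \<delta>"
    and T: "t1 < T" and z0: "z t1 = 0" "z T = 0" and \<xi>: "continuous_on {t1..T} \<xi>"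
    and der: "\<And>t. t \<in> {t1..T} \<Longrightarrow> (z has_real_derivative - lam * z t + b * \<xi> t) (at t within {t1..T})"
  shows "itg (\<lambda>t. exp (2 * \<nu> * t) * ((1 / \<mu> - \<delta>) * (\<xi> t)\<^sup>2 - \<xi> t * delayed \<tau> \<rho> (\<lambda>r. indicator {t1..T} r * z r) t)) t1 T \<ge> 0"
proof -
  define Z where "Z r = indicator {t1..T} r * z r" for r
  define w where "w r = indicator {t1..T} r * (exp (\<nu> * r) * z r)" for r
  define h where "h r = indicator {t1..T} r * (exp (\<nu> * r) * \<xi> r)" for r
  \<comment> \<open>The weight at the present time equals the weight at the delayed time times
    exp(-\<open>\<nu>\<close> s). Moving this factor into the kernel makes \<open>y\<close> a
    convolution of \<open>\<rho>'\<close> with the weighted truncation \<open>w\<close>.\<close>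
  define \<rho>' where "\<rho>' s = exp (- \<nu> * s) * \<rho> s" for s
  define y where "y = delayed \<tau> \<rho>' w"
  define c where "c = 1 / \<mu> - \<delta>"
  \<comment> \<open>Chosen so that v h is the integrand of the claim on [t1, T], while the transform
    of \<open>v\<close> turns out to be (c + \<open>W\<close>) times that of
    \<open>h\<close>.\<close>
  define v where "v t = c * h t - y t" for t
  have zc: "continuous_on {t1..T} z" using der by (intro DERIV_continuous_on)
  have \<rho>': "continuous_on {-\<tau>..0} \<rho>'" unfolding \<rho>'_def by (intro continuous_intros \<rho>)
  have bdI: "\<exists>K. \<forall>r. \<bar>indicator {a..e} r * q r\<bar> \<le> K" if "continuous_on {a..e} q" for a e and q :: "real \<Rightarrow> real"
  proof -
    have "bounded (q ` {a..e})" by (intro compact_imp_bounded compact_continuous_image that) auto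
    then obtain K where "\<And>r. r \<in> {a..e} \<Longrightarrow> \<bar>q r\<bar> \<le> K" by (metis bounded_iff imageI real_norm_def)
    then show ?thesis by (intro exI[of _ "max K 0"]) (auto simp: indicator_def le_max_iff_disj)
  qed
  have cw: "continuous_on {t1..T} (\<lambda>r. exp (\<nu> * r) * z r)" and ch: "continuous_on {t1..T} (\<lambda>r. exp (\<nu> * r) * \<xi> r)"
    by (intro continuous_intros zc \<xi>)+
  have sw: "square_integrable w" unfolding w_def by (rule square_integrable_cut_continuous[OF cw])
  have lw: "locally_L2 w" by (rule square_integrable_imp_locally_L2[OF sw])
  have [measurable]: "w \<in> borel_measurable borel" by (rule square_integrable_measurable[OF sw])
  have hm [measurable]: "h \<in> borel_measurable borel"
    unfolding h_def by (rule square_integrable_measurable[OF square_integrable_cut_continuous[OF ch]])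
  have yc: "continuous_on UNIV y" unfolding y_def by (rule delayed_continuous[OF \<rho>' lw])
  have [measurable]: "y \<in> borel_measurable borel" by (rule borel_measurable_continuous_onI[OF yc])
  obtain Kw where Kw: "\<And>r. \<bar>w r\<bar> \<le> Kw" using bdI[OF cw] unfolding w_def by blast
  obtain Kh where Kh: "\<And>r. \<bar>h r\<bar> \<le> Kh" using bdI[OF ch] unfolding h_def by blast
  obtain Kr where Kr: "\<And>r. \<bar>indicator {-\<tau>..0} r * \<rho>' r\<bar> \<le> Kr" using bdI[OF \<rho>'] by blast
  have Kr': "\<bar>\<rho>' r\<bar> \<le> Kr" if "-\<tau> \<le> r" "r \<le> 0" for r using Kr[of r] that by simp
  have yb: "\<bar>y t\<bar> \<le> Kr * Kw * (0 - - \<tau>)" for t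
    unfolding y_def delayed_def
  proof (rule itg_abs_le_const)
    fix r assume "-\<tau> \<le> r" "r \<le> 0"
    then show "\<bar>\<rho>' r * w (t + r)\<bar> \<le> Kr * Kw"
      using Kr' Kw[of "t + r"] order_trans[OF abs_ge_zero Kr] unfolding abs_mult by (intro mult_mono) auto
  qed (use \<tau> in simp)
  have ys: "y t = 0" if "t \<notin> {t1..T + \<tau>}" for t
    unfolding y_def delayed_def by (rule itg_eq_0) (use that in \<open>auto simp: w_def indicator_def\<close>)
  have y_eq: "y t = exp (\<nu> * t) * delayed \<tau> \<rho> Z t" for t
  proof -
    have "y t = itg (\<lambda>r. exp (\<nu> * t) * (\<rho> r * Z (t + r))) (-\<tau>) 0"
      unfolding y_def delayed_def
    proof (rule itg_cong)
      fix r
      have "exp (- \<nu> * r) * exp (\<nu> * (t + r)) = exp (\<nu> * t)" by (simp add: exp_add[symmetric] algebra_simps)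
      then show "\<rho>' r * w (t + r) = exp (\<nu> * t) * (\<rho> r * Z (t + r))"
        by (auto simp: \<rho>'_def w_def Z_def indicator_def)
    qed
    then show ?thesis by (simp only: itg_scale delayed_def)
  qed
  have hi: "integrable lborel h"
    by (rule integrable_bounded_support[where a=t1 and b=T, OF hm Kh]) (auto simp: h_def)
  have yi: "integrable lborel y"
    by (rule integrable_bounded_support[where a=t1 and b="T + \<tau>", OF _ yb ys]) auto
  have Fv: "Re (fourier v \<omega> * cnj (fourier h \<omega>)) \<ge> 0" for \<omega>
  proof -
    define a where "a = of_real \<nu> + \<i> * of_real \<omega>"
    define A where "A = of_real (\<nu> - lam) + \<i> * of_real \<omega>"
    have A0: "A \<noteq> 0" using \<nu> by (auto simp: A_def complex_eq_iff)
    have ie: "complex_of_real (exp (\<nu> * r)) * iexp (\<omega> * r) = exp (a * of_real r)" for r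
      by (simp add: a_def exp_of_real[symmetric] exp_add[symmetric] algebra_simps)
    have fw: "fourier w \<omega> = (\<integral>r. indicator {t1..T} r *\<^sub>R (of_real (z r) * exp (a * of_real r)) \<partial>lborel)"
      unfolding fourier_def w_def ie[symmetric]
      by (rule Bochner_Integration.integral_cong) (auto simp: indicator_def)
    have fh: "fourier h \<omega> = (\<integral>r. indicator {t1..T} r *\<^sub>R (of_real (\<xi> r) * exp (a * of_real r)) \<partial>lborel)"
      unfolding fourier_def h_def ie[symmetric]
      by (rule Bochner_Integration.integral_cong) (auto simp: indicator_def)
    have iw: "integrable lborel (\<lambda>r. indicator {t1..T} r *\<^sub>R (of_real (z r) * exp (a * of_real r)) :: complex)"
      and ih: "integrable lborel (\<lambda>r. indicator {t1..T} r *\<^sub>R (of_real (\<xi> r) * exp (a * of_real r)) :: complex)"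
      by (rule borel_integrable_atLeastAtMost'[unfolded set_integrable_def], intro continuous_intros zc \<xi>)+
    \<comment> \<open>Integrating the derivative of z exp(a r): the boundary terms vanish because
      \<open>z\<close> is zero at both ends. What remains is the algebraic relation A w + b h = 0
      between the transforms, solvable since \<open>\<nu>\<close> differs from
      \<open>lam\<close>.\<close>
    have "(\<integral>r. indicator {t1..T} r *\<^sub>R (of_real (- lam * z r + b * \<xi> r) * exp (a * of_real r) + of_real (z r) * (a * exp (a * of_real r))) \<partial>lborel)
        = of_real (z T) * exp (a * of_real T) - of_real (z t1) * exp (a * of_real t1)"
    proof (rule integral_FTC_atLeastAtMost)
      fix r assume r: "t1 \<le> r" "r \<le> T"
      have 1: "((\<lambda>r. complex_of_real (z r)) has_vector_derivative of_real (- lam * z r + b * \<xi> r)) (at r within {t1..T})"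
        using der[of r] r by (intro has_vector_derivative_of_real) auto
      have 2: "((\<lambda>r. exp (a * of_real r)) has_vector_derivative a * exp (a * of_real r)) (at r within {t1..T})"
        by (rule has_vector_derivative_real_field) (auto intro!: derivative_eq_intros)
      show "((\<lambda>r. of_real (z r) * exp (a * of_real r)) has_vector_derivative
          of_real (- lam * z r + b * \<xi> r) * exp (a * of_real r) + of_real (z r) * (a * exp (a * of_real r))) (at r within {t1..T})"
        using has_vector_derivative_mult[OF 1 2] by (simp add: add.commute)
    next
      show "continuous_on {t1..T} (\<lambda>r. of_real (- lam * z r + b * \<xi> r) * exp (a * of_real r) + of_real (z r) * (a * exp (a * of_real r)) :: complex)"
        by (intro continuous_intros zc \<xi>)
    qed (use T in simp)
    also have "\<dots> = 0" using z0 by simp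
    also have "(\<integral>r. indicator {t1..T} r *\<^sub>R (of_real (- lam * z r + b * \<xi> r) * exp (a * of_real r) + of_real (z r) * (a * exp (a * of_real r))) \<partial>lborel)
        = (\<integral>r. A * (indicator {t1..T} r *\<^sub>R (of_real (z r) * exp (a * of_real r)))
            + of_real b * (indicator {t1..T} r *\<^sub>R (of_real (\<xi> r) * exp (a * of_real r))) \<partial>lborel)"
      by (rule Bochner_Integration.integral_cong) (auto simp: indicator_def A_def a_def algebra_simps)
    also have "\<dots> = A * fourier w \<omega> + of_real b * fourier h \<omega>"
      unfolding fw fh
      by (subst Bochner_Integration.integral_add)
         (intro integrable_mult_right iw ih, intro integrable_mult_right iw ih, simp only: integral_mult_right_zero)
    finally have rel: "fourier w \<omega> = - of_real b * fourier h \<omega> / A"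
      using A0 by (simp add: field_simps add_eq_0_iff)
    have fy: "fourier y \<omega> = fourier w \<omega> * kernel_transform \<nu> (- \<omega>)"
    proof -
      \<comment> \<open>\<open>y\<close> lives on [t1, T + \<open>\<tau>\<close>], because the delay
        window still sees \<open>z\<close> after \<open>T\<close>; the cut-off makes this factor
        integrable.\<close>
      define F where "F t = indicator {t1..T + \<tau>} t *\<^sub>R iexp (\<omega> * t)" for t :: real
      define G where "G r = complex_of_real (indicator {-\<tau>..0} r * \<rho>' r)" for r
      define k where "k t r = complex_of_real (w (t + r))" for t r
      have Fi: "integrable lborel F" unfolding F_def
        by (rule borel_integrable_atLeastAtMost'[unfolded set_integrable_def], intro continuous_intros)
      have Gi: "integrable lborel G" unfolding G_def
        using borel_integrable_atLeastAtMost'[OF \<rho>'] by (simp add: set_integrable_def del: of_real_mult)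
      have k: "case_prod k \<in> borel_measurable (lborel \<Otimes>\<^sub>M lborel)" unfolding k_def by measurable
      have kb: "norm (k t r) \<le> Kw" for t r using Kw by (simp add: k_def)
      have "fourier y \<omega> = (\<integral>t. F t * (\<integral>r. G r * k t r \<partial>lborel) \<partial>lborel)"
        unfolding fourier_def
      proof (rule Bochner_Integration.integral_cong[OF refl])
        fix t
        have "(\<integral>r. G r * k t r \<partial>lborel) = complex_of_real (y t)"
          unfolding G_def k_def of_real_mult[symmetric] integral_complex_of_real y_def delayed_def itg_def by (simp only: mult.assoc)
        then show "complex_of_real (y t) * iexp (\<omega> * t) = F t * (\<integral>r. G r * k t r \<partial>lborel)"
          using ys[of t] by (cases "t \<in> {t1..T + \<tau>}") (auto simp: F_def)
      qed
      also have "\<dots> = (\<integral>r. G r * (\<integral>t. F t * k t r \<partial>lborel) \<partial>lborel)" by (rule Fubini_kernel(1)[OF Fi Gi k kb])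
      also have "\<dots> = (\<integral>r. (G r * iexp (- \<omega> * r)) * fourier w \<omega> \<partial>lborel)"
      proof (rule Bochner_Integration.integral_cong[OF refl])
        fix r
        show "G r * (\<integral>t. F t * k t r \<partial>lborel) = (G r * iexp (- \<omega> * r)) * fourier w \<omega>"
        proof (cases "r \<in> {-\<tau>..0}")
          case False then show ?thesis by (simp add: G_def)
        next
          case True
          have "(\<integral>t. F t * k t r \<partial>lborel) = (\<integral>t. iexp (- \<omega> * r) * (complex_of_real (w (r + t)) * iexp (\<omega> * (r + t))) \<partial>lborel)"
          proof (rule Bochner_Integration.integral_cong[OF refl])
            fix t
            have "t \<in> {t1..T + \<tau>} \<or> w (r + t) = 0" using True by (auto simp: w_def indicator_def)
            moreover have "iexp (- \<omega> * r) * iexp (\<omega> * (r + t)) = iexp (\<omega> * t)"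
              by (simp add: exp_add[symmetric] algebra_simps)
            ultimately show "F t * k t r = iexp (- \<omega> * r) * (complex_of_real (w (r + t)) * iexp (\<omega> * (r + t)))"
              by (auto simp: F_def k_def indicator_def add.commute mult.left_commute)
          qed
          also have "\<dots> = iexp (- \<omega> * r) * (\<integral>t. complex_of_real (w (r + t)) * iexp (\<omega> * (r + t)) \<partial>lborel)"
            by (rule integral_mult_right_zero)
          also have "\<dots> = iexp (- \<omega> * r) * fourier w \<omega>"
            unfolding fourier_def integral_translate[of "\<lambda>t. complex_of_real (w t) * iexp (\<omega> * t)"] ..
          finally show ?thesis by simp
        qed
      qed
      also have "\<dots> = (\<integral>r. G r * iexp (- \<omega> * r) \<partial>lborel) * fourier w \<omega>" by (rule integral_mult_left_zero)
      also have "(\<integral>r. G r * iexp (- \<omega> * r) \<partial>lborel) = kernel_transform \<nu> (- \<omega>)"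
        unfolding kernel_transform_def set_lebesgue_integral_def
      proof (rule Bochner_Integration.integral_cong[OF refl])
        fix r
        have "complex_of_real (- \<nu> * r) + \<i> * of_real (- \<omega> * r) = (\<i> * of_real (- \<omega>) - of_real \<nu>) * of_real r"
          by (simp add: algebra_simps)
        then have "complex_of_real (exp (- \<nu> * r)) * iexp (- \<omega> * r) = exp ((\<i> * of_real (- \<omega>) - of_real \<nu>) * of_real r)"
          by (simp only: exp_of_real[symmetric] exp_add[symmetric])
        then show "G r * iexp (- \<omega> * r) = indicator {-\<tau>..0} r *\<^sub>R (of_real (\<rho> r) * exp ((\<i> * of_real (- \<omega>) - of_real \<nu>) * of_real r))"
          by (auto simp: G_def \<rho>'_def indicator_def mult.left_commute mult.assoc)
      qed
      finally show ?thesis by (simp add: mult.commute)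
    qed
    define V where "V = transfer_W lam \<tau> b \<rho> (\<i> * of_real (- \<omega>) - of_real \<nu>)"
    have "of_real lam + (\<i> * of_real (- \<omega>) - of_real \<nu>) = - A" by (simp add: A_def)
    then have V: "V = of_real b / A * kernel_transform \<nu> (- \<omega>)"
      unfolding V_def transfer_W_eq by simp
    have "fourier v \<omega> = of_real c * fourier h \<omega> - fourier y \<omega>"
    proof -
      have i1: "integrable lborel (\<lambda>r. complex_of_real (h r) * iexp (\<omega> * r))"
        by (rule Bochner_Integration.integrable_bound[OF hi]) (auto simp: norm_mult)
      have i2: "integrable lborel (\<lambda>r. complex_of_real (y r) * iexp (\<omega> * r))"
        by (rule Bochner_Integration.integrable_bound[OF yi]) (auto simp: norm_mult)
      have "fourier v \<omega> = (\<integral>r. of_real c * (complex_of_real (h r) * iexp (\<omega> * r)) - complex_of_real (y r) * iexp (\<omega> * r) \<partial>lborel)"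
        unfolding fourier_def v_def by (rule Bochner_Integration.integral_cong) (auto simp: algebra_simps)
      then show ?thesis using i1 i2 by (simp add: fourier_def)
    qed
    also have "\<dots> = (of_real c + V) * fourier h \<omega>"
      unfolding fy rel V by (simp add: algebra_simps)
    finally have "fourier v \<omega> * cnj (fourier h \<omega>) = (of_real c + V) * (fourier h \<omega> * cnj (fourier h \<omega>))"
      by (simp only: mult.assoc)
    also have "\<dots> = (of_real c + V) * of_real ((norm (fourier h \<omega>))\<^sup>2)"
      by (simp only: complex_norm_square)
    finally have eq: "fourier v \<omega> * cnj (fourier h \<omega>) = (of_real c + V) * of_real ((norm (fourier h \<omega>))\<^sup>2)" .
    have "Re (fourier v \<omega> * cnj (fourier h \<omega>)) = (c + Re V) * (norm (fourier h \<omega>))\<^sup>2"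
      unfolding eq by (simp del: of_real_power)
    moreover have "c + Re V \<ge> 0" using W[of "- \<omega>"] by (simp only: V_def c_def)
    ultimately show ?thesis by simp
  qed
  define M where "M = max \<bar>t1\<bar> \<bar>T + \<tau>\<bar>"
  define Kc where "Kc = max Kh (\<bar>c\<bar> * Kh + Kr * Kw * (0 - - \<tau>))"
  have "(\<integral>t. v t * h t \<partial>lborel) \<ge> 0"
  proof (rule Parseval_nonneg[where c=Kc and M=M])
    show "\<bar>v s\<bar> \<le> Kc" for s
    proof -
      have "\<bar>v s\<bar> \<le> \<bar>c * h s\<bar> + \<bar>y s\<bar>" unfolding v_def by (rule abs_triangle_ineq4)
      also have "\<bar>c * h s\<bar> \<le> \<bar>c\<bar> * Kh" unfolding abs_mult using Kh by (intro mult_left_mono) auto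
      finally show ?thesis using yb[of s] by (simp add: Kc_def)
    qed
    show "\<bar>h s\<bar> \<le> Kc" for s using Kh[of s] by (simp add: Kc_def)
    show "h s = 0" if "\<bar>s\<bar> > M" for s using that \<tau> by (auto simp: h_def indicator_def M_def)
    show "v s = 0" if "\<bar>s\<bar> > M" for s
    proof -
      have "s \<notin> {t1..T + \<tau>}" using that by (auto simp: M_def)
      then show ?thesis using ys[of s] \<tau> by (auto simp: v_def h_def indicator_def)
    qed
    \<comment> \<open>Only \<open>h\<close> jumps, and only at the two ends; \<open>y\<close> is
      continuous as a convolution.\<close>
    show "AE t in lborel. isCont v t"
      using AE_neq[of t1] AE_neq[of T]
    proof eventually_elim
      case (elim t)
      have "isCont h t"
      proof (cases "t \<in> {t1..T}")
        case True
        have "continuous_on {t1..T} h" using ch by (rule continuous_on_eq) (simp add: h_def)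
        then show ?thesis using True elim by (intro continuous_on_interior[of "{t1..T}"]) auto
      next
        case False
        have "continuous_on (- {t1..T}) h"
          by (rule continuous_on_eq[of _ "\<lambda>_. 0"]) (auto simp: h_def)
        then show ?thesis using False by (subst (asm) continuous_on_eq_continuous_at) auto
      qed
      moreover have "isCont y t" using yc by (simp add: continuous_on_eq_continuous_at)
      ultimately show ?case unfolding v_def by (intro continuous_intros)
    qed
    show "v \<in> borel_measurable borel" unfolding v_def by measurable
  qed (use Fv in auto)
  also have "(\<integral>t. v t * h t \<partial>lborel) = itg (\<lambda>t. exp (2 * \<nu> * t) * ((1 / \<mu> - \<delta>) * (\<xi> t)\<^sup>2 - \<xi> t * delayed \<tau> \<rho> Z t)) t1 T"
    unfolding itg_def
  proof (rule Bochner_Integration.integral_cong[OF refl])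
    fix t
    have "exp (2 * \<nu> * t) = exp (\<nu> * t) * exp (\<nu> * t)" by (simp add: exp_add[symmetric])
    then show "v t * h t = indicator {t1..T} t * (exp (2 * \<nu> * t) * ((1 / \<mu> - \<delta>) * (\<xi> t)\<^sup>2 - \<xi> t * delayed \<tau> \<rho> Z t))"
      unfolding v_def y_eq h_def c_def by (auto simp: indicator_def algebra_simps power2_eq_square)
  qed
  finally show ?thesis unfolding Z_def .
qed

end

section \<open>Convergence of bounded solutions\<close>

lemma itg_mono_continuous:
  assumes "a \<le> b" "continuous_on {a..b} y" "continuous_on {a..b} z" "\<And>r. a \<le> r \<Longrightarrow> r \<le> b \<Longrightarrow> y r \<le> z r"
  shows "itg y a b \<le> itg z a b"
  unfolding itg_def
proof (rule integral_mono)
  show "integrable lborel (\<lambda>r. indicator {a..b} r * y r)" "integrable lborel (\<lambda>r. indicator {a..b} r * z r)"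
    using assms(2,3)[THEN borel_integrable_atLeastAtMost'] by (auto simp: set_integrable_def)
  show "indicator {a..b} r * y r \<le> indicator {a..b} r * z r" for r
    using assms(4) by (auto simp: indicator_def)
qed

lemma itg_add: "locally_L2 y \<Longrightarrow> locally_L2 z \<Longrightarrow> itg (\<lambda>r. y r + z r) a b = itg y a b + itg z a b"
  unfolding itg_def by (simp add: distrib_left locally_L2_integrable)

lemma itg_nonneg: "(\<And>r. a \<le> r \<Longrightarrow> r \<le> b \<Longrightarrow> 0 \<le> y r) \<Longrightarrow> 0 \<le> itg y a b"
  unfolding itg_def by (rule integral_nonneg_AE) (auto simp: indicator_def intro!: AE_I2)

lemma itg_dominated_convergence:
  assumes m: "\<And>n. (\<lambda>r. indicator {a..b} r * y n r) \<in> borel_measurable borel"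
    and le: "\<And>n r. a \<le> r \<Longrightarrow> r \<le> b \<Longrightarrow> \<bar>y n r\<bar> \<le> C"
    and lim: "\<And>r. a \<le> r \<Longrightarrow> r \<le> b \<Longrightarrow> (\<lambda>n. y n r) \<longlonglongrightarrow> Y r"
  shows "(\<lambda>n. itg (y n) a b) \<longlonglongrightarrow> itg Y a b"
  unfolding itg_def
proof (rule integral_dominated_convergence[where w="\<lambda>r. C * indicator {a..b} r"])
  have pl: "(\<lambda>n. indicator {a..b} r * y n r) \<longlonglongrightarrow> indicator {a..b} r * Y r" for r
    using lim[of r] by (cases "r \<in> {a..b}") (auto intro!: tendsto_mult_left)
  then show "AE r in lborel. (\<lambda>n. indicator {a..b} r * y n r) \<longlonglongrightarrow> indicator {a..b} r * Y r" by simp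
  have "(\<lambda>r. indicator {a..b} r * Y r) \<in> borel_measurable borel"
    by (rule borel_measurable_LIMSEQ_real[OF pl m])
  then show "(\<lambda>r. indicator {a..b} r * Y r) \<in> borel_measurable lborel" by simp
  show "integrable lborel (\<lambda>r. C * indicator {a..b} r)"
    by (auto intro!: integrable_real_indicator simp: emeasure_lborel_Icc_eq)
  show "AE r in lborel. norm (indicator {a..b} r * y n r) \<le> C * indicator {a..b} r" for n
    using le by (intro AE_I2) (auto simp: indicator_def)
qed (use m in simp)

lemma sign_constant_if_no_zero:
  fixes z :: "real \<Rightarrow> real"
  assumes c: "continuous_on {t0..} z" and nz: "\<And>t. t \<ge> t0 \<Longrightarrow> z t \<noteq> 0"
  shows "(\<forall>t\<ge>t0. z t > 0) \<or> (\<forall>t\<ge>t0. z t < 0)"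
proof -
  have ci: "continuous_on {t0..t} z" for t using c by (rule continuous_on_subset) auto
  show ?thesis
  proof (cases "z t0 > 0")
    case True
    have "z t > 0" if "t \<ge> t0" for t
    proof (rule ccontr)
      assume "\<not> z t > 0"
      then have "z t \<le> 0" "0 \<le> z t0" using True by auto
      from IVT2'[OF this that ci] obtain s where "t0 \<le> s" "z s = 0" by blast
      then show False using nz by blast
    qed
    then show ?thesis by blast
  next
    case False
    have "z t < 0" if "t \<ge> t0" for t
    proof (rule ccontr)
      assume "\<not> z t < 0"
      then have "z t0 \<le> 0" "0 \<le> z t" using False by auto
      from IVT'[OF this that ci] obtain s where "t0 \<le> s" "z s = 0" by blast
      then show False using nz by blast
    qed
    then show ?thesis by blast
  qed
qed

context delay_equation
begin

lemma delayed_bound: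
  "\<exists>R\<ge>0. \<forall>B y t. (\<forall>r. \<bar>y r\<bar> \<le> B) \<longrightarrow> \<bar>delayed \<tau> \<rho> y t\<bar> \<le> R * B"
proof -
  define R where "R = (SUP r\<in>{-\<tau>..0}. \<bar>\<rho> r\<bar>)"
  have R: "R \<ge> 0" "\<And>r. r \<in> {-\<tau>..0} \<Longrightarrow> \<bar>\<rho> r\<bar> \<le> R" using \<rho>_bound \<rho>_bound_nonneg by (auto simp: R_def)
  have "\<bar>delayed \<tau> \<rho> y t\<bar> \<le> (R * \<tau>) * B" if y: "\<forall>r. \<bar>y r\<bar> \<le> B" for y B t
  proof -
    have "\<bar>delayed \<tau> \<rho> y t\<bar> \<le> R * B * (0 - - \<tau>)"
      unfolding delayed_def
      by (rule itg_abs_le_const) (use R y \<tau> in \<open>auto simp: abs_mult intro!: mult_mono\<close>)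
    then show ?thesis by (simp add: ac_simps)
  qed
  then show ?thesis using R \<tau> by (intro exI[of _ "R * \<tau>"]) auto
qed

lemma delayed_tendsto:
  assumes x: "\<And>n. continuous_on UNIV (y n)" and le: "\<And>n r. \<bar>y n r\<bar> \<le> B"
    and lim: "\<And>r. (\<lambda>n. y n r) \<longlonglongrightarrow> Y r"
  shows "(\<lambda>n. delayed \<tau> \<rho> (y n) t) \<longlonglongrightarrow> delayed \<tau> \<rho> Y t"
  unfolding delayed_def
proof (rule itg_dominated_convergence)
  define R where "R = (SUP r\<in>{-\<tau>..0}. \<bar>\<rho> r\<bar>)"
  have R: "R \<ge> 0" "\<And>r. r \<in> {-\<tau>..0} \<Longrightarrow> \<bar>\<rho> r\<bar> \<le> R" using \<rho>_bound \<rho>_bound_nonneg by (auto simp: R_def)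
  show "\<bar>\<rho> r * y n (t + r)\<bar> \<le> R * B" if "-\<tau> \<le> r" "r \<le> 0" for n r
    unfolding abs_mult using R le that by (intro mult_mono) auto
  show "(\<lambda>n. \<rho> r * y n (t + r)) \<longlonglongrightarrow> \<rho> r * Y (t + r)" for r by (intro tendsto_intros lim)
  have "continuous_on {-\<tau>..0} (\<lambda>r. \<rho> r * y n (t + r))" for n
    by (intro continuous_intros \<rho> continuous_on_compose2[OF x]) auto
  then show "(\<lambda>r. indicator {-\<tau>..0} r * (\<rho> r * y n (t + r))) \<in> borel_measurable borel" for n
    using borel_measurable_continuous_on_indicator[of "{-\<tau>..0}" "\<lambda>r. \<rho> r * y n (t + r)"] by simp
qed

end

section \<open>Dichotomy for the difference over one period, and the limit of the shifts\<close>

context periodic_delay_equation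
begin

text \<open>Monotonicity gives \<open>\<xi>\<close> and v - w the same sign, so their product is the
  product of the moduli and the Lipschitz bound can be multiplied by the modulus of
  \<open>\<xi>\<close>.\<close>

lemma sector:
  fixes t v w :: real
  defines "\<xi> \<equiv> f t v - f t w"
  shows "\<xi>\<^sup>2 / \<mu> \<le> \<xi> * (v - w)"
proof -
  have L: "\<bar>\<xi>\<bar> \<le> \<mu> * \<bar>v - w\<bar>" unfolding \<xi>_def by (rule Lip)
  have s: "\<xi> * (v - w) = \<bar>\<xi>\<bar> * \<bar>v - w\<bar>"
    using f_mono[of v w t] f_mono[of w v t] by (cases "v \<le> w") (auto simp: \<xi>_def algebra_simps)
  have "\<xi>\<^sup>2 = \<bar>\<xi>\<bar> * \<bar>\<xi>\<bar>" by (simp add: power2_eq_square)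
  also have "\<dots> \<le> \<bar>\<xi>\<bar> * (\<mu> * \<bar>v - w\<bar>)" using L by (intro mult_left_mono) auto
  finally show ?thesis unfolding s using \<mu> by (simp add: field_simps)
qed

lemma forcing_periodic: "forcing y (t + \<sigma>) = b * f t (delayed \<tau> \<rho> y (t + \<sigma>)) + g t"
  by (simp add: forcing_def f_periodic g_periodic)

text \<open>The equation is asked for after \<open>a\<close> only: in the application the delay
  window has by then left the initial L2 history, and the function is continued continuously to
  earlier times.\<close>

definition orbit :: "real \<Rightarrow> (real \<Rightarrow> real) \<Rightarrow> bool" where
  "orbit a x \<longleftrightarrow> continuous_on UNIV x \<and> (\<forall>t>a. (x has_real_derivative - lam * x t + forcing x t) (at t))"

text \<open>Truncating between the zero \<open>t1\<close> and a later zero \<open>T\<close> of the difference \<open>z\<close> changes the delayed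
  term on \<open>[t1, t1 + \<tau>]\<close> only, so the weighted energy of the input on \<open>[t1, T]\<close> is bounded
  independently of \<open>T\<close>.\<close>

lemma shift_difference_decays:
  assumes x: "orbit a x" and \<nu>: "\<nu> > lam" and \<delta>: "\<delta> > 0"
    and W: "\<And>\<omega>. Re (transfer_W lam \<tau> b \<rho> (\<i> * of_real \<omega> - of_real \<nu>)) + 1 / \<mu> \<ge> \<delta>"
    and t1: "t1 > a" "x (t1 + \<sigma>) = x t1" and zeros: "\<And>t. \<exists>T\<ge>t. x (T + \<sigma>) = x T"
  shows "\<exists>C. \<forall>t\<ge>t1. \<bar>x (t + \<sigma>) - x t\<bar> \<le> C * exp (- lam * t)"
proof -
  define z where "z t = x (t + \<sigma>) - x t" for t
  define \<xi> where "\<xi> t = f t (delayed \<tau> \<rho> x (t + \<sigma>)) - f t (delayed \<tau> \<rho> x t)" for t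
  have xc: "continuous_on UNIV x" and xd: "\<And>t. t > a \<Longrightarrow> (x has_real_derivative - lam * x t + forcing x t) (at t)"
    using x by (auto simp: orbit_def)
  have Lx: "locally_L2 x" by (rule locally_L2_continuous[OF xc])
  have xsc: "continuous_on UNIV (\<lambda>t. x (t + \<sigma>))" by (rule continuous_on_compose2[OF xc]) (auto intro!: continuous_intros)
  have zc: "continuous_on UNIV z" unfolding z_def by (intro continuous_intros xc xsc)
  have dc: "continuous_on UNIV (delayed \<tau> \<rho> x)" by (rule delayed_continuous[OF \<rho> Lx])
  have dsc: "continuous_on UNIV (\<lambda>t. delayed \<tau> \<rho> x (t + \<sigma>))"
    by (rule continuous_on_compose2[OF dc]) (auto intro!: continuous_intros)
  have \<xi>c: "continuous_on S \<xi>" for S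
  proof -
    have "continuous_on UNIV \<xi>" unfolding \<xi>_def by (intro continuous_intros continuous_on_f dc dsc)
    then show ?thesis using continuous_on_subset by blast
  qed
  have dz: "delayed \<tau> \<rho> z t = delayed \<tau> \<rho> x (t + \<sigma>) - delayed \<tau> \<rho> x t" for t
    unfolding z_def delayed_diff[OF \<rho> locally_L2_continuous[OF xsc] Lx] delayed_shift ..
  have zd: "(z has_real_derivative - lam * z t + b * \<xi> t) (at t)" if "t > a" for t
  proof -
    have "((\<lambda>t. x (t + \<sigma>)) has_real_derivative - lam * x (t + \<sigma>) + forcing x (t + \<sigma>)) (at t)"
      using xd[of "t + \<sigma>"] that \<sigma> by (simp add: DERIV_shift)
    from DERIV_diff[OF this xd[OF that]] show ?thesis
      unfolding z_def by (rule DERIV_cong) (simp add: forcing_periodic \<xi>_def, simp add: forcing_def algebra_simps)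
  qed
  \<comment> \<open>For times up to \<open>T\<close> the truncation at \<open>T\<close> is
    invisible, so \<open>D\<close> is the delayed term of \<open>frequency_inequality\<close> for
    every \<open>T\<close>; from t1 + \<open>\<tau>\<close> on it is the delayed term of
    \<open>z\<close>.\<close>
  define D where "D = delayed \<tau> \<rho> (\<lambda>r. indicator {t1..} r * z r)"
  have Dc: "continuous_on S D" for S
  proof -
    have "continuous_on UNIV D" unfolding D_def
      by (intro delayed_continuous[OF \<rho>] locally_L2_continuous_on continuous_on_subset[OF zc]) auto
    then show ?thesis using continuous_on_subset by blast
  qed
  have dzc: "continuous_on S (delayed \<tau> \<rho> z)" for S
    using delayed_continuous[OF \<rho> locally_L2_continuous[OF zc]] continuous_on_subset by blast
  \<comment> \<open>\<open>P\<close> is the integrand of the frequency inequality, \<open>Q\<close>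
    the weighted energy of the input, and \<open>E\<close> the error made by forgetting
    \<open>z\<close> before \<open>t1\<close>.\<close>
  define P where "P t = exp (2 * \<nu> * t) * ((1 / \<mu> - \<delta>) * (\<xi> t)\<^sup>2 - \<xi> t * D t)" for t
  define Q where "Q t = exp (2 * \<nu> * t) * (\<xi> t)\<^sup>2" for t
  define E where "E t = exp (2 * \<nu> * t) * \<bar>\<xi> t * (delayed \<tau> \<rho> z t - D t)\<bar>" for t
  have Pc: "continuous_on S P" and Qc: "continuous_on S Q" and Ec: "continuous_on S E" for S
    unfolding P_def Q_def E_def by (intro continuous_intros \<xi>c Dc dzc)+
  \<comment> \<open>The sector condition absorbs the term with 1/\<open>\<mu>\<close> and leaves the
    margin: \<open>P\<close> is nonpositive up to \<open>E\<close>, with a gain of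
    \<open>\<delta>\<close> times \<open>Q\<close>.\<close>
  have PE: "P t \<le> E t - \<delta> * Q t" for t
  proof -
    have "(\<xi> t)\<^sup>2 / \<mu> \<le> \<xi> t * delayed \<tau> \<rho> z t" unfolding \<xi>_def dz by (rule sector)
    then have "(1 / \<mu> - \<delta>) * (\<xi> t)\<^sup>2 - \<xi> t * D t \<le> \<xi> t * (delayed \<tau> \<rho> z t - D t) - \<delta> * (\<xi> t)\<^sup>2"
      by (simp add: algebra_simps)
    also have "\<dots> \<le> \<bar>\<xi> t * (delayed \<tau> \<rho> z t - D t)\<bar> - \<delta> * (\<xi> t)\<^sup>2" by simp
    finally have "P t \<le> exp (2 * \<nu> * t) * (\<bar>\<xi> t * (delayed \<tau> \<rho> z t - D t)\<bar> - \<delta> * (\<xi> t)\<^sup>2)"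
      unfolding P_def by (intro mult_left_mono) auto
    then show ?thesis by (simp add: E_def Q_def algebra_simps)
  qed
  define K where "K = itg E t1 (t1 + \<tau>)"
  have Q_at_zero: "\<delta> * itg Q t1 T \<le> K" if T: "T \<ge> t1 + \<tau>" "z T = 0" for T
  proof -
    have tT: "t1 < T" using T \<tau> by simp
    have "0 \<le> itg (\<lambda>t. exp (2 * \<nu> * t) * ((1 / \<mu> - \<delta>) * (\<xi> t)\<^sup>2 - \<xi> t * delayed \<tau> \<rho> (\<lambda>r. indicator {t1..T} r * z r) t)) t1 T"
    proof (rule frequency_inequality)
      show "lam < \<nu>" "t1 < T" "z T = 0" "continuous_on {t1..T} \<xi>" by (fact \<nu> tT T(2) \<xi>c)+
      show "\<delta> \<le> Re (transfer_W lam \<tau> b \<rho> (\<i> * of_real \<omega> - of_real \<nu>)) + 1 / \<mu>" for \<omega> by (rule W)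
      show "z t1 = 0" using t1 by (simp add: z_def)
      show "(z has_real_derivative - lam * z t + b * \<xi> t) (at t within {t1..T})" if "t \<in> {t1..T}" for t
        by (rule has_field_derivative_at_within[OF zd]) (use that t1 in simp)
    qed
    also have "\<dots> = itg P t1 T"
    proof (rule itg_cong)
      fix t assume t: "t1 \<le> t" "t \<le> T"
      have "delayed \<tau> \<rho> (\<lambda>r. indicator {t1..T} r * z r) t = D t"
        unfolding D_def by (rule delayed_cong) (use t in \<open>auto simp: indicator_def\<close>)
      then show "exp (2 * \<nu> * t) * ((1 / \<mu> - \<delta>) * (\<xi> t)\<^sup>2 - \<xi> t * delayed \<tau> \<rho> (\<lambda>r. indicator {t1..T} r * z r) t) = P t"
        by (simp add: P_def)
    qed
    also have "\<dots> \<le> itg (\<lambda>t. E t - \<delta> * Q t) t1 T"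
      by (rule itg_mono_continuous) (use tT PE in \<open>auto intro!: continuous_intros Pc Qc Ec\<close>)
    also have "\<dots> = itg E t1 T - \<delta> * itg Q t1 T"
      by (subst itg_diff) (auto intro!: locally_L2_continuous continuous_intros Ec Qc simp: itg_scale)
    also have "itg E t1 T = K + itg E (t1 + \<tau>) T"
      unfolding K_def using T(1) \<tau> by (intro itg_split locally_L2_continuous Ec) auto
    also have "itg E (t1 + \<tau>) T = 0"
    proof (rule itg_eq_0)
      fix t assume "t1 + \<tau> \<le> t"
      then have "D t = delayed \<tau> \<rho> z t" unfolding D_def by (intro delayed_cong) auto
      then show "E t = 0" by (simp add: E_def)
    qed
    finally show ?thesis by simp
  qed
  \<comment> \<open>\<open>Q\<close> is nonnegative, so the bound at a later zero \<open>T\<close>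
    bounds all earlier integrals, uniformly in \<open>t\<close>.\<close>
  have Qb: "itg Q t1 t \<le> K / \<delta>" if t: "t \<ge> t1" for t
  proof -
    obtain T where T: "T \<ge> max t (t1 + \<tau>)" "z T = 0" using zeros[of "max t (t1 + \<tau>)"] by (auto simp: z_def)
    have "itg Q t1 T = itg Q t1 t + itg Q t T"
      using T t by (intro itg_split locally_L2_continuous Qc) auto
    moreover have "itg Q t T \<ge> 0" by (rule itg_nonneg) (simp add: Q_def)
    ultimately have "\<delta> * itg Q t1 t \<le> \<delta> * itg Q t1 T" using \<delta> by (intro mult_left_mono) auto
    also have "\<dots> \<le> K" using T by (intro Q_at_zero) auto
    finally show ?thesis using \<delta> by (simp add: field_simps)
  qed
  \<comment> \<open>Write exp(\<open>lam\<close> s) as exp((\<open>lam\<close> -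
    \<open>\<nu>\<close>) s) exp(\<open>\<nu>\<close> s) and split the product with
    \<open>\<xi>\<close> by the inequality u w at most (u^2 + w^2)/2; \<open>m\<close> is the rate
    of u^2, and \<open>C\<close> is half the sum of the two integral bounds.\<close>
  define m where "m = 2 * (\<nu> - lam)"
  have m: "m > 0" using \<nu> by (simp add: m_def)
  define C where "C = (exp (- m * t1) / m + K / \<delta>) / 2"
  have "\<bar>z t\<bar> \<le> C * exp (- lam * t)" if t: "t \<ge> t1" for t
  proof -
    have yc: "continuous_on S (\<lambda>s. exp (lam * s) * (b * \<xi> s))" for S by (intro continuous_intros \<xi>c)
    have "itg (\<lambda>s. exp (lam * s) * (b * \<xi> s)) t1 t = exp (lam * t) * z t - exp (lam * t1) * z t1"
    proof (rule itg_continuous_FTC[OF t _ yc])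
      fix s assume s: "t1 \<le> s" "s \<le> t"
      have "(z has_real_derivative - lam * z s + b * \<xi> s) (at s within {t1..t})"
        by (rule has_field_derivative_at_within[OF zd]) (use s t1 in simp)
      then show "((\<lambda>s. exp (lam * s) * z s) has_real_derivative exp (lam * s) * (b * \<xi> s)) (at s within {t1..t})"
        by (auto intro!: derivative_eq_intros simp: algebra_simps)
    qed
    moreover have "z t1 = 0" using t1(2) by (simp add: z_def)
    ultimately have eq: "exp (lam * t) * z t = itg (\<lambda>s. exp (lam * s) * (b * \<xi> s)) t1 t" by (simp only: mult_zero_right diff_zero)
    have "\<bar>itg (\<lambda>s. exp (lam * s) * (b * \<xi> s)) t1 t\<bar> \<le> itg (\<lambda>s. 1/2 * (exp (- m * s) + Q s)) t1 t"
    proof (rule itg_abs_le[OF t])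
      fix s
      define u where "u = exp ((lam - \<nu>) * s)"
      define w where "w = exp (\<nu> * s) * \<bar>\<xi> s\<bar>"
      have "(lam - \<nu>) * s + \<nu> * s = lam * s" by (simp add: algebra_simps)
      then have "u * exp (\<nu> * s) = exp (lam * s)" by (simp only: u_def exp_add[symmetric])
      then have "\<bar>exp (lam * s) * (b * \<xi> s)\<bar> = u * w"
        unfolding w_def mult.assoc[symmetric] using b by (simp add: abs_mult)
      also have "\<dots> \<le> 1/2 * (u\<^sup>2 + w\<^sup>2)"
        using zero_le_power2[of "u - w"] by (simp add: power2_diff)
      also have "u\<^sup>2 = exp (- m * s)"
      proof -
        have "2 * ((lam - \<nu>) * s) = - m * s" by (simp add: m_def algebra_simps)
        then show ?thesis unfolding u_def exp_double[symmetric] by simp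
      qed
      also have "w\<^sup>2 = Q s"
        unfolding w_def Q_def power_mult_distrib exp_double[symmetric] by (simp add: mult.assoc)
      finally show "\<bar>exp (lam * s) * (b * \<xi> s)\<bar> \<le> 1/2 * (exp (- m * s) + Q s)" .
    next
      have "continuous_on {t1..t} (\<lambda>s. 1/2 * (exp (- m * s) + Q s))" by (intro continuous_intros Qc)
      then show "integrable lborel (\<lambda>s. indicator {t1..t} s * (1/2 * (exp (- m * s) + Q s)))"
        using borel_integrable_atLeastAtMost' by (fastforce simp: set_integrable_def)
    qed
    moreover have "itg (\<lambda>s. 1/2 * (exp (- m * s) + Q s)) t1 t \<le> C"
    proof -
      have "itg (\<lambda>s. 1/2 * (exp (- m * s) + Q s)) t1 t = 1/2 * itg (\<lambda>s. exp (- m * s) + Q s) t1 t"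
        by (rule itg_scale)
      also have "itg (\<lambda>s. exp (- m * s) + Q s) t1 t = itg (\<lambda>s. exp (- m * s)) t1 t + itg Q t1 t"
        by (intro itg_add locally_L2_continuous continuous_intros Qc)
      also have "itg (\<lambda>s. exp (- m * s)) t1 t = - exp (- m * t) / m - - exp (- m * t1) / m"
        by (rule itg_continuous_FTC[OF t]) (use m in \<open>auto intro!: derivative_eq_intros continuous_intros\<close>)
      finally have "itg (\<lambda>s. 1/2 * (exp (- m * s) + Q s)) t1 t = (exp (- m * t1) / m - exp (- m * t) / m + itg Q t1 t) / 2" by simp
      moreover have "exp (- m * t) / m \<ge> 0" using m by simp
      ultimately show ?thesis using Qb[OF t] unfolding C_def by simp
    qed
    ultimately have "\<bar>exp (lam * t) * z t\<bar> \<le> C" unfolding eq by (rule order_trans)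
    then have "exp (lam * t) * \<bar>z t\<bar> \<le> C" by (simp add: abs_mult)
    then show ?thesis by (simp add: exp_minus field_simps)
  qed
  then show ?thesis unfolding z_def by blast
qed

text \<open>The values of \<open>z\<close> at \<open>t + real n * \<sigma>\<close> are the
  increments of the sequence. If they eventually have one sign, the bounded sequence is eventually
  monotone; otherwise they decay geometrically and the telescoping sum converges.\<close>

lemma shifts_converge:
  assumes x: "orbit a x" and B: "\<And>t. \<bar>x t\<bar> \<le> B" and \<nu>: "\<nu> > lam" and \<delta>: "\<delta> > 0"
    and W: "\<And>\<omega>. Re (transfer_W lam \<tau> b \<rho> (\<i> * of_real \<omega> - of_real \<nu>)) + 1 / \<mu> \<ge> \<delta>"
  shows "convergent (\<lambda>n. x (t + real n * \<sigma>))"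
proof -
  define z where "z t = x (t + \<sigma>) - x t" for t
  have xc: "continuous_on UNIV x" using x by (simp add: orbit_def)
  have zc: "continuous_on S z" for S
    unfolding z_def by (intro continuous_intros continuous_on_compose2[OF xc]) auto
  define s where "s n = x (t + real n * \<sigma>)" for n
  have sz: "s (Suc n) - s n = z (t + real n * \<sigma>)" for n by (simp add: s_def z_def algebra_simps)
  have sB: "Bseq (\<lambda>n. s (n + N))" for N by (rule BseqI'[of _ B]) (simp add: s_def B)
  have large: "\<exists>N. \<forall>n\<ge>N. t + real n * \<sigma> \<ge> t0" for t0
  proof -
    obtain N :: nat where N: "real N > (t0 - t) / \<sigma>" using reals_Archimedean2 by blast
    have "t + real n * \<sigma> \<ge> t0" if "n \<ge> N" for n
    proof -
      have "(t0 - t) / \<sigma> \<le> real n" using N that by linarith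
      then show ?thesis using \<sigma> by (simp add: field_simps)
    qed
    then show ?thesis by blast
  qed
  have "convergent s"
  proof (cases "\<exists>t0. \<forall>t\<ge>t0. z t \<noteq> 0")
    case True
    then obtain t0 where "\<And>t. t \<ge> t0 \<Longrightarrow> z t \<noteq> 0" by blast
    then have sign: "(\<forall>t\<ge>t0. z t > 0) \<or> (\<forall>t\<ge>t0. z t < 0)" by (intro sign_constant_if_no_zero zc)
    obtain N where N: "\<And>n. n \<ge> N \<Longrightarrow> t + real n * \<sigma> \<ge> t0" using large by blast
    have "monoseq (\<lambda>n. s (n + N))"
      using sign
    proof
      assume pos: "\<forall>t\<ge>t0. z t > 0"
      have "s (n + N) \<le> s (Suc n + N)" for n
      proof -
        have "z (t + real (n + N) * \<sigma>) > 0" using pos N[of "n + N"] by simp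
        then show ?thesis using sz[of "n + N"] unfolding add_Suc by linarith
      qed
      then show ?thesis by (intro mono_SucI1) simp
    next
      assume neg: "\<forall>t\<ge>t0. z t < 0"
      have "s (Suc n + N) \<le> s (n + N)" for n
      proof -
        have "z (t + real (n + N) * \<sigma>) < 0" using neg N[of "n + N"] by simp
        then show ?thesis using sz[of "n + N"] unfolding add_Suc by linarith
      qed
      then show ?thesis by (intro mono_SucI2) simp
    qed
    then have "convergent (\<lambda>n. s (n + N))" using sB by (intro Bseq_monoseq_convergent)
    then show ?thesis by (simp add: convergent_ignore_initial_segment)
  next
    case False
    then have zeros: "\<exists>T\<ge>t0. x (T + \<sigma>) = x T" for t0 by (auto simp: z_def)
    \<comment> \<open>Asking for a + 1 makes \<open>t1\<close> strictly larger than
      \<open>a\<close>.\<close>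
    obtain t1 where t1: "t1 \<ge> a + 1" "x (t1 + \<sigma>) = x t1" using zeros by blast
    have t1a: "t1 > a" using t1(1) by simp
    obtain C where C: "\<And>t. t \<ge> t1 \<Longrightarrow> \<bar>z t\<bar> \<le> C * exp (- lam * t)"
      using shift_difference_decays[OF x \<nu> \<delta> W t1a t1(2) zeros] unfolding z_def by blast
    obtain N where N: "\<And>n. n \<ge> N \<Longrightarrow> t + real n * \<sigma> \<ge> t1" using large by blast
    have "summable (\<lambda>n. z (t + real n * \<sigma>))"
    proof (rule summable_comparison_test'[where N=N])
      have "norm (exp (- lam * \<sigma>)) < 1" using lam \<sigma> by simp
      then show "summable (\<lambda>n. (C * exp (- lam * t)) * exp (- lam * \<sigma>) ^ n)"
        by (intro summable_mult summable_geometric)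
      fix n assume "n \<ge> N"
      then have "\<bar>z (t + real n * \<sigma>)\<bar> \<le> C * exp (- lam * (t + real n * \<sigma>))" by (intro C N)
      also have "exp (- lam * (t + real n * \<sigma>)) = exp (- lam * t) * exp (- lam * \<sigma>) ^ n"
        by (simp add: exp_of_nat_mult[symmetric] exp_add[symmetric] algebra_simps)
      finally show "norm (z (t + real n * \<sigma>)) \<le> (C * exp (- lam * t)) * exp (- lam * \<sigma>) ^ n"
        by (simp add: mult.assoc)
    qed
    then have "(\<lambda>m. \<Sum>n<m. z (t + real n * \<sigma>)) \<longlonglongrightarrow> (\<Sum>n. z (t + real n * \<sigma>))" by (rule summable_LIMSEQ)
    moreover have "(\<Sum>n<m. z (t + real n * \<sigma>)) = s m - s 0" for m
      unfolding sz[symmetric] by (rule sum_lessThan_telescope)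
    ultimately have "(\<lambda>m. (s m - s 0) + s 0) \<longlonglongrightarrow> (\<Sum>n. z (t + real n * \<sigma>)) + s 0" by (intro tendsto_intros) simp
    then show ?thesis by (auto simp: convergent_def)
  qed
  then show ?thesis by (simp add: s_def[abs_def])
qed

text \<open>A bounded orbit has a bounded derivative, so its shifts share a Lipschitz constant. This
  upgrades pointwise convergence to uniform convergence on a period, which is convergence of x - X
  at infinity. The equation for \<open>X\<close> is obtained from its integrated form by dominated
  convergence.\<close>

theorem bounded_orbit_converges:
  assumes x: "orbit a x" and B: "\<And>t. \<bar>x t\<bar> \<le> B" and \<nu>: "\<nu> > lam" and \<delta>: "\<delta> > 0"
    and W: "\<And>\<omega>. Re (transfer_W lam \<tau> b \<rho> (\<i> * of_real \<omega> - of_real \<nu>)) + 1 / \<mu> \<ge> \<delta>"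
  shows "\<exists>X. (\<forall>t. X (t + \<sigma>) = X t) \<and> continuous_on UNIV X \<and>
    (\<forall>t. (X has_real_derivative - lam * X t + forcing X t) (at t)) \<and> ((\<lambda>t. x t - X t) \<longlongrightarrow> 0) at_top"
proof -
  have xc: "continuous_on UNIV x" and xd: "\<And>t. t > a \<Longrightarrow> (x has_real_derivative - lam * x t + forcing x t) (at t)"
    using x by (auto simp: orbit_def)
  define X where "X t = lim (\<lambda>n. x (t + real n * \<sigma>))" for t
  have X: "(\<lambda>n. x (t + real n * \<sigma>)) \<longlonglongrightarrow> X t" for t
    unfolding X_def using shifts_converge[OF x B \<nu> \<delta> W] by (simp add: convergent_LIMSEQ_iff)
  have per: "X (t + \<sigma>) = X t" for t
  proof -
    have "(\<lambda>n. x (t + real (Suc n) * \<sigma>)) \<longlonglongrightarrow> X t" using X by (rule LIMSEQ_Suc)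
    moreover have "(\<lambda>n. x (t + real (Suc n) * \<sigma>)) = (\<lambda>n. x (t + \<sigma> + real n * \<sigma>))" by (simp add: algebra_simps)
    ultimately show ?thesis using X[of "t + \<sigma>"] LIMSEQ_unique by metis
  qed
  have pern: "X (t + real n * \<sigma>) = X t" for t n
    using periodic_int[where h=X and \<sigma>=\<sigma> and t=t and n="int n", OF per] by simp
  obtain R where R: "R \<ge> 0" "\<And>B y t. (\<forall>r. \<bar>y r\<bar> \<le> B) \<Longrightarrow> \<bar>delayed \<tau> \<rho> y t\<bar> \<le> R * B"
    using delayed_bound by blast
  \<comment> \<open>Bounds the right-hand side for every function bounded by \<open>B\<close>; the
    added 1 allows division by \<open>L\<close>.\<close>
  define L where "L = lam * B + (\<mu> * (R * B) + F0) + 1"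
  have B0: "B \<ge> 0" using B[of 0] by linarith
  have F00: "F0 \<ge> 0" using bounded_forcing[of 0] by linarith
  have L1: "L \<ge> 1" unfolding L_def using lam \<mu> R(1) B0 F00 by simp
  have rhs: "\<bar>- lam * y t + forcing y t\<bar> \<le> L" if y: "\<forall>r. \<bar>y r\<bar> \<le> B" for y t
  proof -
    have "\<bar>f t (delayed \<tau> \<rho> y t)\<bar> \<le> \<mu> * \<bar>delayed \<tau> \<rho> y t\<bar> + \<bar>f t 0\<bar>"
      using Lip[of t "delayed \<tau> \<rho> y t" 0] unfolding diff_zero by linarith
    moreover have "\<mu> * \<bar>delayed \<tau> \<rho> y t\<bar> \<le> \<mu> * (R * B)" using R(2)[OF y] \<mu> by (intro mult_left_mono) auto
    moreover have "\<bar>forcing y t\<bar> \<le> \<bar>f t (delayed \<tau> \<rho> y t)\<bar> + \<bar>g t\<bar>"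
      unfolding forcing_def using b abs_triangle_ineq[of "b * f t (delayed \<tau> \<rho> y t)" "g t"] by (simp add: abs_mult)
    moreover have "\<bar>- lam * y t\<bar> \<le> lam * B" using y lam by (simp add: abs_mult)
    ultimately show ?thesis using bounded_forcing[of t] abs_triangle_ineq[of "- lam * y t" "forcing y t"]
      unfolding L_def by linarith
  qed
  have xL: "\<bar>x s - x t\<bar> \<le> L * \<bar>s - t\<bar>" if "s > a" "t > a" for s t
    using field_differentiable_bound[of "{a<..}" x "\<lambda>t. - lam * x t + forcing x t" L s t] that rhs[of x] B xd
    by (auto simp: has_field_derivative_at_within)
  have large: "\<forall>\<^sub>F n in sequentially. t + real n * \<sigma> > t0" for t t0
  proof -
    obtain N :: nat where N: "real N > (t0 - t) / \<sigma>" using reals_Archimedean2 by blast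
    show ?thesis
    proof (rule eventually_sequentiallyI)
      fix n assume "N \<le> n"
      then have "(t0 - t) / \<sigma> < real n" using N by linarith
      then show "t + real n * \<sigma> > t0" using \<sigma> by (simp add: field_simps)
    qed
  qed
  have XL: "\<bar>X s - X t\<bar> \<le> L * \<bar>s - t\<bar>" for s t
  proof (rule tendsto_upperbound)
    show "(\<lambda>n. \<bar>x (s + real n * \<sigma>) - x (t + real n * \<sigma>)\<bar>) \<longlonglongrightarrow> \<bar>X s - X t\<bar>" by (intro tendsto_intros X)
    show "\<forall>\<^sub>F n in sequentially. \<bar>x (s + real n * \<sigma>) - x (t + real n * \<sigma>)\<bar> \<le> L * \<bar>s - t\<bar>"
      using large[of a s] large[of a t]
    proof eventually_elim
      case (elim n)
      show ?case using xL[OF elim] by simp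
    qed
  qed simp
  have Xc: "continuous_on UNIV X"
  proof (rule continuous_at_imp_continuous_on, rule ballI)
    fix t
    have "((\<lambda>s. L * \<bar>s - t\<bar>) \<longlongrightarrow> L * \<bar>t - t\<bar>) (at t)" by (intro tendsto_intros)
    then have lim: "((\<lambda>s. L * \<bar>s - t\<bar>) \<longlongrightarrow> 0) (at t)" by simp
    have "((\<lambda>s. X s - X t) \<longlongrightarrow> 0) (at t)"
      by (rule Lim_null_comparison[OF _ lim]) (intro always_eventually allI, simp only: real_norm_def XL)
    then show "isCont X t" by (simp add: isCont_def LIM_zero_iff)
  qed
  have XB: "\<bar>X t\<bar> \<le> B" for t
    by (rule tendsto_upperbound[OF tendsto_rabs[OF X]]) (simp_all add: B)
  have conv: "((\<lambda>t. x t - X t) \<longlongrightarrow> 0) at_top"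
  proof (rule tendstoI)
    fix e :: real assume e: "e > 0"
    \<comment> \<open>A grid of mesh \<open>h\<close> over one period, indexed by 0 to
      \<open>m\<close>: moving to a grid point changes \<open>x\<close> and \<open>X\<close> by at
      most \<open>e/3\<close> each, and at the finitely many grid points convergence is
      simultaneous.\<close>
    define h where "h = e / (3 * L)"
    have h: "h > 0" "L * h = e / 3" using e L1 by (auto simp: h_def)
    define m where "m = nat \<lceil>\<sigma> / h\<rceil>"
    have "\<forall>\<^sub>F n in sequentially. \<forall>i\<in>{..m}. dist (x (real i * h + real n * \<sigma>)) (X (real i * h)) < e / 3"
      using e by (intro eventually_ball_finite ballI tendstoD[OF X]) simp_all
    moreover have "\<forall>\<^sub>F n in sequentially. 0 + real n * \<sigma> > a" by (rule large)
    ultimately have "\<forall>\<^sub>F n in sequentially. (\<forall>i\<in>{..m}. dist (x (real i * h + real n * \<sigma>)) (X (real i * h)) < e / 3) \<and> real n * \<sigma> > a"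
      by eventually_elim auto
    then obtain N where N: "\<And>n i. n \<ge> N \<Longrightarrow> i \<le> m \<Longrightarrow> \<bar>x (real i * h + real n * \<sigma>) - X (real i * h)\<bar> < e / 3"
      "\<And>n. n \<ge> N \<Longrightarrow> real n * \<sigma> > a"
      unfolding eventually_sequentially by (auto simp: dist_real_def)
    have "\<forall>\<^sub>F t in at_top. t \<ge> max 0 (real N * \<sigma>)" by (rule eventually_ge_at_top)
    then show "\<forall>\<^sub>F t in at_top. dist (x t - X t) 0 < e"
    proof eventually_elim
      case (elim t)
      define n where "n = nat \<lfloor>t / \<sigma>\<rfloor>"
      define s where "s = t - real n * \<sigma>"
      have tt: "0 \<le> t" "real N * \<sigma> \<le> t" using elim unfolding max.bounded_iff by blast+
      have t0: "t / \<sigma> \<ge> 0" using tt(1) \<sigma> by simp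
      have n: "real n \<le> t / \<sigma>" "t / \<sigma> < real n + 1" using t0 unfolding n_def by linarith+
      have s: "0 \<le> s" "s < \<sigma>" using n \<sigma> by (auto simp: s_def field_simps)
      have nN: "n \<ge> N"
      proof -
        have "real N \<le> t / \<sigma>" using tt(2) \<sigma> by (simp add: field_simps)
        then show ?thesis using n by linarith
      qed
      \<comment> \<open>\<open>s\<close> is \<open>t\<close> reduced modulo the period, and
        \<open>i * h\<close> is the grid point at or just before \<open>s\<close>.\<close>
      define i where "i = nat \<lfloor>s / h\<rfloor>"
      have s0: "s / h \<ge> 0" using s h by simp
      have i: "real i \<le> s / h" "s / h < real i + 1" using s0 unfolding i_def by linarith+
      have im: "i \<le> m"
      proof -
        have "s / h \<le> \<sigma> / h" using s h by (simp add: divide_right_mono)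
        then have "real i \<le> \<sigma> / h" using i by linarith
        then show ?thesis unfolding m_def by linarith
      qed
      have ih: "\<bar>s - real i * h\<bar> \<le> h" using i h by (auto simp: field_simps abs_le_iff)
      have Lh: "L * \<bar>s - real i * h\<bar> \<le> e / 3" using mult_left_mono[OF ih, of L] L1 h by simp
      have t: "t = s + real n * \<sigma>" by (simp add: s_def)
      have na: "real n * \<sigma> > a" by (rule N(2)[OF nN])
      have "\<bar>x t - x (real i * h + real n * \<sigma>)\<bar> \<le> L * \<bar>t - (real i * h + real n * \<sigma>)\<bar>"
        using na s h unfolding t by (intro xL) (auto intro: add_nonneg_pos order.strict_trans2)
      then have 1: "\<bar>x t - x (real i * h + real n * \<sigma>)\<bar> \<le> e / 3" using Lh by (simp add: t)
      have 2: "\<bar>x (real i * h + real n * \<sigma>) - X (real i * h)\<bar> < e / 3" by (rule N(1)[OF nN im])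
      have "X t = X s" unfolding t by (rule pern)
      then have 3: "\<bar>X t - X (real i * h)\<bar> \<le> e / 3" using XL[of s "real i * h"] Lh by simp
      show ?case using 1 2 3 unfolding dist_real_def by linarith
    qed
  qed
  define Hr where "Hr t = - lam * X t + forcing X t" for t
  have Hc: "continuous_on S Hr" for S
  proof -
    have "continuous_on UNIV Hr" unfolding Hr_def
      by (intro continuous_intros Xc forcing_continuous locally_L2_continuous)
    then show ?thesis using continuous_on_subset by blast
  qed
  \<comment> \<open>The shifts satisfy the same equation by periodicity, and their right-hand sides
    are bounded by \<open>L\<close> and converge pointwise.\<close>
  have Xint: "X t - X s = itg Hr s t" if st: "s \<le> t" for s t
  proof -
    define hn where "hn n r = - lam * x (r + real n * \<sigma>) + forcing x (r + real n * \<sigma>)" for n r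
    have hnc: "continuous_on S (hn n)" for S n
    proof -
      have "continuous_on UNIV (\<lambda>t. - lam * x t + forcing x t)"
        by (intro continuous_intros xc forcing_continuous locally_L2_continuous)
      then show ?thesis unfolding hn_def by (rule continuous_on_compose2) (auto intro!: continuous_intros)
    qed
    have "(\<lambda>n. itg (hn n) s t) \<longlonglongrightarrow> itg Hr s t"
    proof (rule itg_dominated_convergence)
      show "(\<lambda>r. indicator {s..t} r * hn n r) \<in> borel_measurable borel" for n
        using borel_measurable_continuous_on_indicator[OF _ hnc, of "{s..t}" n] by simp
      show "\<bar>hn n r\<bar> \<le> L" for n r unfolding hn_def using rhs[of x] B by blast
      show "(\<lambda>n. hn n r) \<longlonglongrightarrow> Hr r" for r
      proof -
        have "(\<lambda>n. delayed \<tau> \<rho> (\<lambda>u. x (u + real n * \<sigma>)) r) \<longlonglongrightarrow> delayed \<tau> \<rho> X r"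
          by (rule delayed_tendsto[OF _ B X]) (auto intro!: continuous_on_compose2[OF xc] continuous_intros)
        then have d: "(\<lambda>n. delayed \<tau> \<rho> x (r + real n * \<sigma>)) \<longlonglongrightarrow> delayed \<tau> \<rho> X r" by (simp only: delayed_shift)
        have "continuous_on UNIV (\<lambda>v::real. (r, v))" by (intro continuous_on_Pair continuous_on_const continuous_on_id)
        from continuous_on_compose2[OF f this] have "continuous_on UNIV (\<lambda>v. f r v)" by simp
        then have "(\<lambda>n. f r (delayed \<tau> \<rho> x (r + real n * \<sigma>))) \<longlonglongrightarrow> f r (delayed \<tau> \<rho> X r)"
          by (rule continuous_on_tendsto_compose[OF _ d]) auto
        then have "(\<lambda>n. - lam * x (r + real n * \<sigma>) + (b * f r (delayed \<tau> \<rho> x (r + real n * \<sigma>)) + g r))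
            \<longlonglongrightarrow> - lam * X r + (b * f r (delayed \<tau> \<rho> X r) + g r)"
          by (intro tendsto_intros X)
        moreover have "forcing x (r + real n * \<sigma>) = b * f r (delayed \<tau> \<rho> x (r + real n * \<sigma>)) + g r" for n
          using periodic_int[where h="\<lambda>t. f t (delayed \<tau> \<rho> x (r + real n * \<sigma>))" and t=r and n="int n" and \<sigma>=\<sigma>]
            periodic_int[where h=g and t=r and n="int n" and \<sigma>=\<sigma>] by (simp add: forcing_def f_periodic g_periodic)
        ultimately show ?thesis by (simp add: hn_def Hr_def forcing_def[of X])
      qed
    qed
    moreover have "\<forall>\<^sub>F n in sequentially. itg (hn n) s t = x (t + real n * \<sigma>) - x (s + real n * \<sigma>)"
      using large[of a s]
    proof eventually_elim
      case (elim n)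
      show ?case
      proof (rule itg_continuous_FTC[OF st _ hnc])
        fix r assume r: "s \<le> r" "r \<le> t"
        have "(x has_real_derivative hn n r) (at (r + real n * \<sigma>))"
          unfolding hn_def using elim r by (intro xd) simp
        then have "((\<lambda>r. x (r + real n * \<sigma>)) has_real_derivative hn n r) (at r)"
          unfolding DERIV_shift[of x "hn n r" r "real n * \<sigma>"] .
        then show "((\<lambda>r. x (r + real n * \<sigma>)) has_real_derivative hn n r) (at r within {s..t})"
          by (rule has_field_derivative_at_within)
      qed
    qed
    ultimately have "(\<lambda>n. x (t + real n * \<sigma>) - x (s + real n * \<sigma>)) \<longlonglongrightarrow> itg Hr s t"
      by (rule Lim_transform_eventually)
    then show ?thesis using LIMSEQ_unique tendsto_diff[OF X X] by blast
  qed
  have "(X has_real_derivative Hr t) (at t)" for t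
  proof -
    have eq: "X s = X (t - 1) + integral {t - 1..s} Hr" if "s \<in> {t-1..t+1}" for s
      using Xint[of "t - 1" s] that set_borel_integral_eq_integral(2)[OF borel_integrable_atLeastAtMost'[OF Hc, of "t-1" s]]
      by (simp add: itg_def set_lebesgue_integral_def)
    have "((\<lambda>s. X (t - 1) + integral {t - 1..s} Hr) has_real_derivative 0 + Hr t) (at t within {t-1..t+1})"
      by (intro DERIV_add DERIV_const integral_has_real_derivative Hc) auto
    then have "((\<lambda>s. X (t - 1) + integral {t - 1..s} Hr) has_real_derivative Hr t) (at t within {t-1..t+1})" by simp
    then have "(X has_real_derivative Hr t) (at t within {t-1..t+1})"
      by (rule has_field_derivative_transform_within[OF _ zero_less_one]) (auto intro!: eq[symmetric] simp: dist_real_def)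
    then show ?thesis using at_within_interior[of t "{t-1..t+1}"] by simp
  qed
  then show ?thesis using per Xc conv unfolding Hr_def by blast
qed

end

section \<open>From scalar orbits back to trajectories in the phase space\<close>

lemma periodic_continuous_bounded:
  fixes h :: "real \<Rightarrow> real"
  assumes c: "continuous_on UNIV h" and per: "\<And>t. h (t + \<sigma>) = h t" and \<sigma>: "\<sigma> > 0"
  shows "\<exists>K. \<forall>t. \<bar>h t\<bar> \<le> K"
proof -
  have "bounded (h ` {0..\<sigma>})"
    by (intro compact_imp_bounded compact_continuous_image continuous_on_subset[OF c]) auto
  then obtain K where K: "\<And>t. t \<in> {0..\<sigma>} \<Longrightarrow> \<bar>h t\<bar> \<le> K" by (metis bounded_iff imageI real_norm_def)
  have "\<bar>h t\<bar> \<le> K" for t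
  proof -
    define n where "n = \<lfloor>t / \<sigma>\<rfloor>"
    have n: "of_int n \<le> t / \<sigma>" "t / \<sigma> < of_int n + 1" unfolding n_def by linarith+
    then have "t + of_int (- n) * \<sigma> \<in> {0..\<sigma>}" using \<sigma> by (auto simp: field_simps)
    then show ?thesis using K periodic_int[of h \<sigma> t "- n", OF per] by metis
  qed
  then show ?thesis by blast
qed

text \<open>Restarting \<open>X\<close> at \<open>p\<close> from its own segment gives back
  \<open>X\<close>, almost everywhere only, since the segment is an element of \<open>l2\<close>.
  This is how \<open>X\<close> becomes a solution from each of its states.\<close>

lemma hist_seg:
  assumes X: "locally_L2 X"
  shows "AE r in lborel. p - \<tau> \<le> r \<longrightarrow> hist p X (seg \<tau> (\<lambda>s. X (p + s))) r = X r"
  by (rule eventually_mono[OF AE_translate[OF rep_seg[OF locally_L2_translate[OF X, of p], of \<tau>], of "-p"]])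
     (auto simp: hist_def indicator_def)

lemma variation_of_constants:
  assumes der: "\<And>s. p \<le> s \<Longrightarrow> (X has_real_derivative - lam * X s + \<xi> s) (at s)"
    and \<xi>: "continuous_on {p..} \<xi>" and t: "p \<le> t"
  shows "X t = X p * exp (- lam * (t - p)) + duhamel lam p \<xi> t"
proof -
  have "duhamel lam p \<xi> t = exp (- lam * (t - t)) * X t - exp (- lam * (t - p)) * X p"
    unfolding duhamel_def
  proof (rule itg_continuous_FTC[OF t])
    fix s assume s: "p \<le> s" "s \<le> t"
    have "(X has_real_derivative - lam * X s + \<xi> s) (at s within {p..t})"
      using der[OF s(1)] by (rule has_field_derivative_at_within)
    then show "((\<lambda>s. exp (- lam * (t - s)) * X s) has_real_derivative exp (- lam * (t - s)) * \<xi> s) (at s within {p..t})"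
      by (auto intro!: derivative_eq_intros simp: algebra_simps)
  next
    show "continuous_on {p..t} (\<lambda>s. exp (- lam * (t - s)) * \<xi> s)"
      by (intro continuous_intros continuous_on_subset[OF \<xi>]) auto
  qed
  then show ?thesis by simp
qed

lemma duhamel_derivative:
  assumes \<xi>: "continuous_on {p..} \<xi>" and t: "p < t"
  shows "(duhamel lam p \<xi> has_real_derivative - lam * duhamel lam p \<xi> t + \<xi> t) (at t)"
proof -
  let ?I = "\<lambda>t. integral {p..t} (\<lambda>s. exp (lam * s) * \<xi> s)"
  have "(?I has_real_derivative exp (lam * t) * \<xi> t) (at t within {p..t + 1})"
    using t by (intro integral_has_real_derivative continuous_intros continuous_on_subset[OF \<xi>]) auto
  moreover have "at t within {p..t + 1} = at t" using t by (intro at_within_interior) simp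
  ultimately have I: "(?I has_real_derivative exp (lam * t) * \<xi> t) (at t)" by simp
  have e: "exp (- lam * t) * exp (lam * t) = 1" by (simp add: exp_add[symmetric])
  have "((\<lambda>t. exp (- lam * t) * ?I t) has_real_derivative
      exp (- lam * t) * (- lam) * ?I t + exp (lam * t) * \<xi> t * exp (- lam * t)) (at t)"
    by (rule DERIV_mult[OF _ I]) (auto intro!: derivative_eq_intros)
  moreover have "exp (- lam * t) * (- lam) * ?I t + exp (lam * t) * \<xi> t * exp (- lam * t) = - lam * duhamel lam p \<xi> t + \<xi> t"
    using duhamel_eq[OF \<xi> less_imp_le[OF t], of lam] e by (simp add: algebra_simps)
  ultimately have "((\<lambda>t. exp (- lam * t) * ?I t) has_real_derivative - lam * duhamel lam p \<xi> t + \<xi> t) (at t)" by simp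
  then show ?thesis
    by (rule has_field_derivative_transform_within_open[of _ _ _ "{p<..}"]) (use t duhamel_eq[OF \<xi>] in auto)
qed

context periodic_delay_equation
begin

theorem bounded_trajectory_converges:
  assumes \<nu>: "\<nu> > lam"
    and W: "\<And>\<omega>. Re (transfer_W lam \<tau> b \<rho> (\<i> * of_real \<omega> - of_real \<nu>)) + 1 / \<mu> > 0"
    and q: "q \<in> base \<sigma>" and u0: "u0 \<in> H \<tau>"
    and bdd: "bounded ((\<lambda>t. cocycle lam \<tau> b \<rho> f g t q u0) ` {0..})"
  shows "\<exists>v. periodic_trajectory (H \<tau>) (cocycle lam \<tau> b \<rho> f g) \<sigma> q v
    \<and> ((\<lambda>t. cocycle lam \<tau> b \<rho> f g t q u0 - v t) \<longlongrightarrow> 0) at_top"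
proof -
  obtain \<delta> where \<delta>: "\<delta> > 0" "\<And>\<omega>. Re (transfer_W lam \<tau> b \<rho> (\<i> * of_real \<omega> - of_real \<nu>)) + 1 / \<mu> \<ge> \<delta>"
    using transfer_margin[OF \<nu> W] by blast
  obtain p where p: "p \<in> q" using base_nonempty[OF q] by blast
  obtain x where x: "solution p u0 x" using solution_exists by blast
  define y where "y = hist p x (snd u0)"
  have xc: "continuous_on {p..} x" using x by (simp add: solution_def)
  have y: "locally_L2 y" unfolding y_def by (rule locally_L2_hist[OF xc])
  have coc: "cocycle lam \<tau> b \<rho> f g t q u0 = state \<tau> y (t + p)" if "t \<ge> 0" for t
    unfolding y_def by (rule cocycle_eq_state[OF q p u0 x that])
  \<comment> \<open>Freezing \<open>x\<close> before \<open>p\<close> gives a continuous function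
    bounded on the whole line that agrees with \<open>y\<close> from \<open>p\<close> on.\<close>
  define xh where "xh t = x (max p t)" for t
  have xhc: "continuous_on UNIV xh"
    unfolding xh_def by (rule continuous_on_compose2[OF xc]) (auto intro!: continuous_intros)
  have yxh: "y t = xh t" if "t \<ge> p" for t using that by (simp add: y_def hist_def xh_def max_def)
  obtain B where B: "\<And>t. t \<ge> 0 \<Longrightarrow> norm (cocycle lam \<tau> b \<rho> f g t q u0) \<le> B"
    using bdd unfolding bounded_iff by auto
  have xhB: "\<bar>xh t\<bar> \<le> B" for t
  proof -
    define s where "s = max p t - p"
    have s: "s \<ge> 0" by (simp add: s_def)
    have "fst (cocycle lam \<tau> b \<rho> f g s q u0) = xh t"
      using yxh[of "s + p"] s unfolding coc[OF s] by (simp add: state_def s_def xh_def)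
    moreover have "norm (fst c) \<le> norm c" for c :: "real \<times> l2"
      using norm_fst_le[of "fst c" "snd c"] by (simp only: prod.collapse)
    ultimately show ?thesis using B[OF s] by (metis order_trans real_norm_def)
  qed
  \<comment> \<open>After \<open>p + \<tau>\<close> the delay window lies in [p, \<infinity>), so
    the forcing of \<open>y\<close> is the forcing of \<open>xh\<close>.\<close>
  have "orbit (p + \<tau>) xh"
    unfolding orbit_def
  proof (intro conjI allI impI xhc)
    fix t assume t: "p + \<tau> < t"
    then have tp: "p < t" using \<tau> by simp
    have \<xi>: "continuous_on {p..} (forcing y)" using forcing_continuous[OF y] continuous_on_subset by blast
    have "((\<lambda>t. fst u0 * exp (- lam * (t - p)) + duhamel lam p (forcing y) t) has_real_derivative
        fst u0 * (exp (- lam * (t - p)) * (- lam)) + (- lam * duhamel lam p (forcing y) t + forcing y t)) (at t)"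
      by (intro DERIV_add duhamel_derivative \<xi> tp) (auto intro!: derivative_eq_intros)
    moreover have "fst u0 * (exp (- lam * (t - p)) * (- lam)) + (- lam * duhamel lam p (forcing y) t + forcing y t)
        = - lam * xh t + forcing xh t"
    proof -
      have "forcing y t = forcing xh t" by (rule forcing_cong) (use t yxh in auto)
      moreover have "xh t = fst u0 * exp (- lam * (t - p)) + duhamel lam p (forcing y) t"
        using x tp by (simp add: xh_def solution_def y_def)
      ultimately show ?thesis by (simp add: algebra_simps)
    qed
    ultimately have "((\<lambda>t. fst u0 * exp (- lam * (t - p)) + duhamel lam p (forcing y) t) has_real_derivative
        - lam * xh t + forcing xh t) (at t)" by simp
    then show "(xh has_real_derivative - lam * xh t + forcing xh t) (at t)"
      by (rule has_field_derivative_transform_within_open[of _ _ _ "{p<..}"])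
         (use tp x in \<open>auto simp: xh_def solution_def y_def\<close>)
  qed
  from bounded_orbit_converges[OF this xhB \<nu> \<delta>]
  obtain X where per: "\<And>t. X (t + \<sigma>) = X t" and Xc: "continuous_on UNIV X"
    and Xd: "\<And>t. (X has_real_derivative - lam * X t + forcing X t) (at t)"
    and conv: "((\<lambda>t. xh t - X t) \<longlongrightarrow> 0) at_top" by blast
  have X: "locally_L2 X" by (rule locally_L2_continuous[OF Xc])
  \<comment> \<open>Time 0 of the trajectory is the time \<open>p\<close> of the scalar equation, as
    in \<open>coc\<close>.\<close>
  define v where "v t = state \<tau> X (t + p)" for t
  have vc: "continuous_on UNIV v"
    unfolding v_def
    by (rule continuous_on_compose2[OF state_continuous[OF X Xc]]) (auto intro!: continuous_intros)
  have vH: "v s \<in> H \<tau>" for s unfolding v_def by (rule state_in_H[OF X])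
  have vcoc: "v (t + s) = cocycle lam \<tau> b \<rho> f g t (Defs.shift s q) (v s)" if t: "t \<ge> 0" for t s
  proof -
    define p' where "p' = s + p"
    have p': "p' \<in> Defs.shift s q" unfolding Defs.shift_def p'_def using p by (intro image_eqI[of _ _ p]) auto
    define h where "h = hist p' X (snd (v s))"
    have Xp: "continuous_on {p'..} X" using Xc continuous_on_subset by blast
    have h: "locally_L2 h" unfolding h_def by (rule locally_L2_hist[OF Xp])
    have hX: "AE r in lborel. p' - \<tau> \<le> r \<longrightarrow> h r = X r"
      using hist_seg[OF X, of p' \<tau>] by (simp add: h_def v_def state_def p'_def)
    have "solution p' (v s) X"
      unfolding solution_def h_def[symmetric]
    proof (intro conjI allI impI Xp)
      fix t assume t: "p' \<le> t"
      have fX: "forcing h r = forcing X r" if "p' \<le> r" for r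
        by (rule forcing_cong_AE[OF h X]) (use hX that in \<open>auto elim!: eventually_mono\<close>)
      have "X t = X p' * exp (- lam * (t - p')) + duhamel lam p' (forcing X) t"
        by (rule variation_of_constants[OF Xd _ t]) (use forcing_continuous[OF X] continuous_on_subset in blast)
      also have "duhamel lam p' (forcing X) t = duhamel lam p' (forcing h) t"
        by (rule duhamel_cong) (simp add: fX)
      finally show "X t = fst (v s) * exp (- lam * (t - p')) + duhamel lam p' (forcing h) t"
        by (simp add: v_def state_def p'_def)
    qed
    from cocycle_eq_state[OF shift_base[OF q] p' vH this t]
    have "cocycle lam \<tau> b \<rho> f g t (Defs.shift s q) (v s) = state \<tau> h (t + p')" by (simp add: h_def)
    also have "\<dots> = state \<tau> X (t + p')"
    proof -
      have "seg \<tau> (\<lambda>r. h (t + p' + r)) = seg \<tau> (\<lambda>r. X (t + p' + r))"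
        by (intro seg_cong locally_L2_translate h X)
           (use AE_translate[OF hX, of "t + p'"] t in \<open>auto elim!: eventually_mono\<close>)
      moreover have "h (t + p') = X (t + p')" using t by (simp add: h_def hist_def)
      ultimately show ?thesis by (simp add: state_def)
    qed
    finally show ?thesis by (simp add: v_def p'_def add.assoc)
  qed
  have vper: "v (t + \<sigma>) = v t" for t
  proof -
    have "X (t + \<sigma> + p + r) = X (t + p + r)" for r using per[of "t + p + r"] by (simp add: ac_simps)
    then show ?thesis using per[of "t + p"] by (simp add: v_def state_def ac_simps)
  qed
  have "((\<lambda>t. cocycle lam \<tau> b \<rho> f g t q u0 - v t) \<longlongrightarrow> 0) at_top"
  proof (rule tendstoI)
    fix e :: real assume e: "e > 0"
    \<comment> \<open>A function bounded by \<open>e'\<close> on the window has state norm at most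
      \<open>e' * c\<close>; halving \<open>e\<close> makes the estimate strict.\<close>
    define c where "c = 1 + sqrt \<tau>"
    define e' where "e' = e / 2 / c"
    have c: "c > 0" using \<tau> by (simp add: c_def add_pos_nonneg)
    then have "e' * c = e / 2" by (simp add: e'_def)
    then have e': "e' > 0" "e' * (1 + sqrt \<tau>) < e" using e c by (simp_all add: e'_def c_def[symmetric])
    have "\<forall>\<^sub>F t in at_top. dist (xh t - X t) 0 < e'" using conv e'(1) by (rule tendstoD)
    then obtain t0 where t0: "\<And>t. t \<ge> t0 \<Longrightarrow> \<bar>xh t - X t\<bar> < e'" unfolding eventually_at_top_linorder by auto
    have "\<forall>\<^sub>F t in at_top. t \<ge> max \<tau> (t0 + \<tau> - p)" by (rule eventually_ge_at_top)
    then show "\<forall>\<^sub>F t in at_top. dist (cocycle lam \<tau> b \<rho> f g t q u0 - v t) 0 < e"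
    proof eventually_elim
      case (elim t)
      then have t: "t \<ge> \<tau>" "t + p - \<tau> \<ge> t0" by auto
      have close: "\<bar>y (t + p + s) - X (t + p + s)\<bar> \<le> e'" if "s \<in> {-\<tau>..0}" for s
        using t0[of "t + p + s"] yxh[of "t + p + s"] that t by (auto intro: less_imp_le)
      have "cocycle lam \<tau> b \<rho> f g t q u0 - v t = (y (t + p) - X (t + p), seg \<tau> (\<lambda>s. y (t + p + s) - X (t + p + s)))"
        using coc[of t] t \<tau> by (simp add: v_def state_def seg_diff locally_L2_translate y X)
      also have "norm \<dots> \<le> norm (y (t + p) - X (t + p)) + norm (seg \<tau> (\<lambda>s. y (t + p + s) - X (t + p + s)))"
        by (rule norm_Pair_le)
      also have "\<dots> \<le> e' + e' * sqrt \<tau>"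
      proof (rule add_mono)
        show "norm (y (t + p) - X (t + p)) \<le> e'" using close[of 0] \<tau> by simp
        show "norm (seg \<tau> (\<lambda>s. y (t + p + s) - X (t + p + s))) \<le> e' * sqrt \<tau>"
          by (rule norm_seg_le)
             (use close e' \<tau> locally_L2_measurable[OF locally_L2_diff[OF locally_L2_translate[OF y] locally_L2_translate[OF X]]] in auto)
      qed
      also have "\<dots> < e" using e'(2) by (simp add: distrib_left)
      finally show ?case by simp
    qed
  qed
  moreover have "periodic_trajectory (H \<tau>) (cocycle lam \<tau> b \<rho> f g) \<sigma> q v"
    unfolding periodic_trajectory_def using vc vH vcoc vper by blast
  ultimately show ?thesis by blast
qed

end

text \<open>\<open>deriv\<close> is total, so bounds on it carry information only where the
  derivative exists; the chain rule along v |-> (t, v) provides this.\<close>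

lemma continuously_differentiable_partial:
  assumes "continuously_differentiable (\<lambda>(t, v). f t v :: real)"
  shows "continuous_on UNIV (\<lambda>(t::real, v::real). f t v)"
    and "(f t has_real_derivative deriv (f t) v) (at v)"
proof -
  obtain F' :: "real \<times> real \<Rightarrow> (real \<times> real) \<Rightarrow>\<^sub>L real" where
    F': "\<And>z. ((\<lambda>(t, v). f t v) has_derivative blinfun_apply (F' z)) (at z)"
    using assms unfolding continuously_differentiable_def by blast
  show "continuous_on UNIV (\<lambda>(t, v). f t v)"
    using F' has_derivative_continuous by (intro continuous_at_imp_continuous_on) blast
  have "((\<lambda>v. (t, v)) has_derivative (\<lambda>h. (0, h))) (at v)"
    by (auto intro!: derivative_eq_intros)
  from has_derivative_compose[OF this F'[of "(t, v)"]]
  have "f t differentiable (at v)" unfolding differentiable_def by auto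
  then show "(f t has_real_derivative deriv (f t) v) (at v)"
    by (simp add: DERIV_deriv_iff_real_differentiable)
qed

theorem theorem6:
  fixes lam \<tau> \<sigma> \<mu>0 b \<nu> :: real
    and \<rho> g :: "real \<Rightarrow> real" and f :: "real \<Rightarrow> real \<Rightarrow> real"
    and q :: "real set" and u0 :: "real \<times> l2"
  assumes "lam > 0" "\<tau> > 0" "\<sigma> > 0" "\<mu>0 > 0" "b \<in> {1, -1}"
    and "continuous_on {-\<tau>..0} \<rho>"
    and "continuous_on UNIV g"
    and "continuously_differentiable (\<lambda>(t, v). f t v)"
    and "\<forall>t v. 0 \<le> deriv (f t) v \<and> deriv (f t) v \<le> \<mu>0"
    and "\<forall>t. g (t + \<sigma>) = g t"
    and "\<forall>t v. f (t + \<sigma>) v = f t v"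
    and "\<nu> > lam"
    and "\<forall>\<omega>::real. Re (transfer_W lam \<tau> b \<rho> (\<i> * of_real \<omega> - of_real \<nu>)) + 1 / \<mu>0 > 0"
    and "q \<in> base \<sigma>" "u0 \<in> H \<tau>"
    and "bounded ((\<lambda>t. cocycle lam \<tau> b \<rho> f g t q u0) ` {0..})"
  shows "\<exists>v. periodic_trajectory (H \<tau>) (cocycle lam \<tau> b \<rho> f g) \<sigma> q v
    \<and> ((\<lambda>t. cocycle lam \<tau> b \<rho> f g t q u0 - v t) \<longlongrightarrow> 0) at_top"
proof -
  note fc = continuously_differentiable_partial(1)[OF assms(8)]
  note fd = continuously_differentiable_partial(2)[OF assms(8)]
  \<comment> \<open>Continuity and periodicity of \<open>f t 0\<close> and \<open>g t\<close>
    provide the bound \<open>F0\<close> for the locale.\<close>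
  have "continuous_on UNIV (\<lambda>t::real. (t, 0::real))" by (intro continuous_intros)
  from continuous_on_compose2[OF fc this] have f0: "continuous_on UNIV (\<lambda>t. f t 0)" by simp
  have "continuous_on UNIV (\<lambda>t. \<bar>f t 0\<bar> + \<bar>g t\<bar>)" by (intro continuous_intros f0 assms(7))
  from periodic_continuous_bounded[OF this, of \<sigma>] assms(3,10,11)
  obtain F0 where F0: "\<And>t. \<bar>\<bar>f t 0\<bar> + \<bar>g t\<bar>\<bar> \<le> F0" by auto
  interpret periodic_delay_equation lam \<tau> b \<mu>0 F0 \<rho> g f \<sigma>
  proof
    show "\<bar>f t v - f t w\<bar> \<le> \<mu>0 * \<bar>v - w\<bar>" for t v w
    proof -
      have "norm (deriv (f t) z) \<le> \<mu>0" for z using assms(9) by simp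
      then have "norm (f t v - f t w) \<le> \<mu>0 * norm (v - w)"
        using fd by (intro field_differentiable_bound[of UNIV "f t" "deriv (f t)"]) auto
      then show ?thesis by simp
    qed
    show "f t v \<le> f t w" if "v \<le> w" for t v w
      using that by (rule DERIV_nonneg_imp_nondecreasing) (use fd assms(9) in blast)
    show "\<bar>f t 0\<bar> + \<bar>g t\<bar> \<le> F0" for t using F0[of t] by simp
  qed (use assms fc in auto)
  show ?thesis
    by (rule bounded_trajectory_converges) (use assms in auto)
qed

end
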